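(* Let $\alpha>0$ and $\kappa>0$ be constants independent of $n$, let $m=\alpha n$, and let $H$ be an $m\times n$ matrix with i.i.d. standard normal components. For $\beta\in(0,1]$ define $$\xi_{box}(\beta)=\min_{\mathbf{x}_i\in\left[-\frac{1}{\sqrt{\beta n}},\frac{1}{\sqrt{\beta n}}\right],\ \|\mathbf{x}\|_2^2=1}\ \max_{\|\lambda\|_2=1,\ \lambda_i\ge0}\left(\frac{\kappa}{\sqrt\beta}\lambda^T\mathbf{1}-\lambda^TH\mathbf{x}\right),\qquad \xi_{box}=\min_{\beta\in(0,1]}\xi_{box}(\beta).$$ Set $$f_{gar}\left(\frac{\kappa}{\sqrt\beta}\right)=\frac{1}{\sqrt{2\pi}}\int_{-\frac{\kappa}{\sqrt\beta}}^\infty\left(z+\frac{\kappa}{\sqrt\beta}\right)^2e^{-\frac{z^2}{2}}dz=\frac{\kappa e^{-\frac{\kappa^2}{2\beta}}}{\sqrt{2\beta\pi}}+\frac{\left(\frac{\kappa^2}{\beta}+1\right)\mathrm{erfc}\left(-\frac{\kappa}{\sqrt{2\beta}}\right)}{2}$$ and $$\widehat{f_{box}}(\beta)=\frac{1}{\sqrt\beta}\max_{\gamma\ge0}\left(-\frac{e^{-2\gamma^2}}{\sqrt{2\pi}}+\gamma\,\mathrm{erfc}\left(\frac{2\gamma}{\sqrt2}\right)-\frac{1}{4\gamma}\left(\mathrm{erfc}\left(-\frac{2\gamma}{\sqrt2}\right)-1\right)-\gamma\beta\right).$$ Let $\epsilon_1^{(m)},\epsilon_1^{(n)},\epsilon_5^{(g)}$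 be arbitrarily small positive constants independent of $n$. (i) Let $\beta\in(0,1]$ be a constant independent of $n$ and let $\xi_{box}^{(l)}(\beta)$ be a scalar (possibly depending on $n$) such that $$(1-\epsilon_1^{(m)})\sqrt{\alpha f_{gar}\left(\frac{\kappa}{\sqrt\beta}\right)}+(1+\epsilon_1^{(n)})\widehat{f_{box}}(\beta)-\epsilon_5^{(g)}>\frac{\xi_{box}^{(l)}(\beta)}{\sqrt n}.$$ Then $\lim_{n\to\infty}P\left(\xi_{box}(\beta)\ge\xi_{box}^{(l)}(\beta)\right)\ge1$ (i.e. the limit equals $1$). (ii) Let $\xi_{box}^{(l)}$ be a scalar (possibly depending on $n$) such that $$\min_{\beta\in(0,1]}\left((1-\epsilon_1^{(m)})\sqrt{\alpha f_{gar}\left(\frac{\kappa}{\sqrt\beta}\right)}+(1+\epsilon_1^{(n)})\widehat{f_{box}}(\beta)-\epsilon_5^{(g)}\right)>\frac{\xi_{box}^{(l)}}{\sqrt n}.$$ Then $\lim_{n\to\infty}P\left(\xi_{box}\ge\xi_{box}^{(l)}\right)\ge1$ (i.e. the limit equals $1$), and, if $\xi_{box}^{(l)}>0$, with overwhelming probability the system $$H\mathbf{x}\ge\kappa,\qquad\mathbf{x}_i\in\left[-\frac{1}{\sqrt n},\frac{1}{\sqrt n}\right],\ 1\le i\le n,$$ is infeasible.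
   Context: Throughout $\mathbf{x}\in\mathbb{R}^n$, $\lambda\in\mathbb{R}^m$, and $\mathbf{1}$ is the $m$-dimensional all-ones vector. $H\mathbf{x}\ge\kappa$ means that every component of $H\mathbf{x}$ is at least $\kappa$. $\mathrm{erfc}(x)=\frac{2}{\sqrt\pi}\int_x^\infty e^{-t^2}dt$. Minima and maxima over $\beta$ and $\gamma$ are understood as infima and suprema when not attained, and the expression maximized over $\gamma$ is extended to $\gamma=0$ by its limit. The regime is $n\to\infty$ with $m=\alpha n$ (rounded to an integer if necessary). "With overwhelming probability" means with probability (over $H$) at least $1$ minus a quantity decaying exponentially in $n$. A nonzero $\mathbf{x}\in[-1/\sqrt n,1/\sqrt n]^n$ has $\|\mathbf{x}\|_2^2=\beta$ for some $\beta\in(0,1]$; dividing by $\sqrt\beta$ gives the scaled problem defining $\xi_{box}(\beta)$. *)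

theory Defs
  imports "HOL-Probability.Probability"
begin

text \<open>
  Since the dimensions vary with \<open>n\<close>, vectors and matrices are functions on \<open>nat\<close> of which only
  the entries with indices \<open>i < m\<close>, \<open>j < n\<close> matter.
\<close>

definition std_normal_matrix ::
    "'a measure \<Rightarrow> nat \<Rightarrow> nat \<Rightarrow> ('a \<Rightarrow> nat \<Rightarrow> nat \<Rightarrow> real) \<Rightarrow> bool" where
  "std_normal_matrix M m n H \<longleftrightarrow>
     prob_space M \<and>
     prob_space.indep_vars M (\<lambda>_. borel) (\<lambda>(i, j) \<omega>. H \<omega> i j) ({..<m} \<times> {..<n}) \<and>
     (\<forall>i<m. \<forall>j<n. distributed M lborel (\<lambda>\<omega>. H \<omega> i j) (\<lambda>x. ennreal (std_normal_density x)))"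

definition mat_vec :: "nat \<Rightarrow> (nat \<Rightarrow> nat \<Rightarrow> real) \<Rightarrow> (nat \<Rightarrow> real) \<Rightarrow> nat \<Rightarrow> real" where
  "mat_vec n H x i = (\<Sum>j<n. H i j * x j)"

definition box_sphere :: "real \<Rightarrow> nat \<Rightarrow> (nat \<Rightarrow> real) set" where
  "box_sphere \<beta> n =
     {x. (\<forall>j<n. x j \<in> {- 1 / sqrt (\<beta> * real n) .. 1 / sqrt (\<beta> * real n)}) \<and> (\<Sum>j<n. (x j)\<^sup>2) = 1}"

definition nonneg_sphere :: "nat \<Rightarrow> (nat \<Rightarrow> real) set" where
  "nonneg_sphere m = {l. (\<forall>i<m. l i \<ge> 0) \<and> (\<Sum>i<m. (l i)\<^sup>2) = 1}"

text \<open>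
  Minima and maxima are infima and suprema in \<open>ereal\<close>, so that they need no boundedness or
  nonemptiness side conditions.
\<close>

definition xi_box_at :: "real \<Rightarrow> nat \<Rightarrow> nat \<Rightarrow> (nat \<Rightarrow> nat \<Rightarrow> real) \<Rightarrow> real \<Rightarrow> ereal" where
  "xi_box_at \<kappa> m n H \<beta> =
     (INF x\<in>box_sphere \<beta> n. SUP l\<in>nonneg_sphere m.
        ereal (\<kappa> / sqrt \<beta> * (\<Sum>i<m. l i) - (\<Sum>i<m. l i * mat_vec n H x i)))"

definition xi_box :: "real \<Rightarrow> nat \<Rightarrow> nat \<Rightarrow> (nat \<Rightarrow> nat \<Rightarrow> real) \<Rightarrow> ereal" where
  "xi_box \<kappa> m n H = (INF \<beta>\<in>{0<..1}. xi_box_at \<kappa> m n H \<beta>)"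

definition box_feasible :: "real \<Rightarrow> nat \<Rightarrow> nat \<Rightarrow> (nat \<Rightarrow> nat \<Rightarrow> real) \<Rightarrow> bool" where
  "box_feasible \<kappa> m n H \<longleftrightarrow>
     (\<exists>x. (\<forall>j<n. x j \<in> {- 1 / sqrt (real n) .. 1 / sqrt (real n)}) \<and> (\<forall>i<m. mat_vec n H x i \<ge> \<kappa>))"

definition erfc :: "real \<Rightarrow> real" where
  "erfc x = 2 / sqrt pi * (LBINT t:{x..}. exp (- t\<^sup>2))"

definition f_gar :: "real \<Rightarrow> real" where
  "f_gar c = 1 / sqrt (2 * pi) * (LBINT z:{- c..}. (z + c)\<^sup>2 * exp (- z\<^sup>2 / 2))"

definition f_box_expr :: "real \<Rightarrow> real \<Rightarrow> real" where
  "f_box_expr \<beta> \<gamma> =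
     - exp (- 2 * \<gamma>\<^sup>2) / sqrt (2 * pi) + \<gamma> * erfc (2 * \<gamma> / sqrt 2)
     - 1 / (4 * \<gamma>) * (erfc (- 2 * \<gamma> / sqrt 2) - 1) - \<gamma> * \<beta>"

text \<open>
  The factor \<open>1 / (4 * \<gamma>)\<close> makes the expression meaningless at \<open>\<gamma> = 0\<close>; it is replaced there by
  its limit.  For \<open>\<beta> > 0\<close> it is bounded above on \<open>\<gamma> \<ge> 0\<close>, so the real supremum is the intended one.
\<close>

definition f_box_hat :: "real \<Rightarrow> real" where
  "f_box_hat \<beta> = 1 / sqrt \<beta> *
     (SUP \<gamma>\<in>{0..}. if \<gamma> = 0 then Lim (at_right 0) (f_box_expr \<beta>) else f_box_expr \<beta> \<gamma>)"

definition box_threshold :: "real \<Rightarrow> real \<Rightarrow> real \<Rightarrow> real \<Rightarrow> real \<Rightarrow> real \<Rightarrow> real" where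
  "box_threshold \<alpha> \<kappa> eps_m eps_n eps_g \<beta> =
     (1 - eps_m) * sqrt (\<alpha> * f_gar (\<kappa> / sqrt \<beta>)) + (1 + eps_n) * f_box_hat \<beta> - eps_g"

text \<open>For a sequence \<open>p\<close> of probabilities indexed by the dimension:\<close>

definition overwhelming :: "(nat \<Rightarrow> real) \<Rightarrow> bool" where
  "overwhelming p \<longleftrightarrow>
     (\<exists>C>0. \<exists>c>0. \<forall>\<^sub>F n in sequentially. p n \<ge> 1 - C * exp (- c * real n))"

end

theory Submission imports Defs begin

text \<open>
  For fixed \<open>\<beta>\<close>, maximising over \<open>\<lambda>\<close> turns \<open>\<xi>\<close> into the least value over the box part of the unit
  sphere of the length of the positive part of \<open>\<kappa> / sqrt \<beta> - H x\<close>, as long as this length is positive.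
  Gordon's comparison inequality bounds this least value from below by replacing the Gaussian matrix by
  two independent Gaussian vectors \<open>a\<close> and \<open>h\<close>: with an independent scalar Gaussian \<open>g\<close> added, the least
  length of the positive part of \<open>c - H x\<close> stochastically dominates the length of the positive part of
  \<open>c - a\<close> plus the least value of \<open>h \<bullet> x\<close>.
  The first term is of order \<open>sqrt (\<alpha> n f_gar c)\<close> by the law of large numbers.  The
  second one is bounded below by Lagrangian duality: for a multiplier \<open>\<gamma>\<close> of the constraint on the norm
  the minimum over the box splits into \<open>n\<close> one-dimensional minima, whose Gaussian expectation is exactly the
  expression that \<open>f_box_hat\<close> maximises.  Since \<open>f_gar\<close> and the dual function are expectations of functions
  of quadratic growth, both laws of large numbers come with exponential bounds (\<open>cramer_lower_tail\<close>).
  The scalar \<open>g\<close> exceeds a small multiple of \<open>sqrt n\<close> with exponentially small probability only.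

  Gordon's inequality is proved for probabilities by Gaussian interpolation (\<open>gordon_smooth\<close>).
  All Gaussians are placed in one array \<open>z\<close> on \<open>{..m} \<times> {..n}\<close>: the block \<open>i < m\<close>, \<open>j < n\<close> is \<open>H\<close>, the
  last column is \<open>a\<close>, the last row is \<open>h\<close> and the corner is \<open>g\<close>.  Rotating \<open>(H x, g)\<close> into \<open>(a, h \<bullet> x)\<close>
  and integrating by parts makes the derivative of the expectation of a product over \<open>x\<close>
  a sum over pairs \<open>x \<noteq> y\<close>.  It has a sign because the length of the positive part is a
  1-Lipschitz function.  Only the points \<open>x\<close> have to be discretised; the maximum over
  \<open>\<lambda>\<close> is kept in closed form.  A countable dense set of points \<open>x\<close> then gives the inequality for the whole box
  sphere, because the bounding event is the same for all finite sets (\<open>gordon_infinite\<close>).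

  Uniformity in \<open>\<beta>\<close> (\<open>uniform_norm_event\<close>) follows from finitely many values of \<open>\<beta>\<close>: the square root of
  \<open>f_gar\<close> is 1-Lipschitz, and for small \<open>\<beta>\<close> already the bound for the whole unit sphere suffices since
  \<open>f_gar c \<ge> c\<^sup>2\<close>.  If the level is negative there may be no positive part, and the
  sphere bound shows instead that some coordinate of \<open>H x\<close> lies below a constant (\<open>negative_level_event\<close>).
  A feasible point of the system, normalised, would make a positive part vanish.
\<close>

section \<open>Gaussian integrals\<close>

lemma integral_std_gauss:
  fixes f :: "real \<Rightarrow> real"
  assumes "f \<in> borel_measurable borel"
  shows "(\<integral>z. f z \<partial>std_normal_distribution) = (\<integral>z. std_normal_density z * f z \<partial>lborel)"
  using assms by (subst integral_density) auto

lemma integrable_std_gauss_iff: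
  fixes f :: "real \<Rightarrow> real"
  assumes "f \<in> borel_measurable borel"
  shows "integrable std_normal_distribution f \<longleftrightarrow> integrable lborel (\<lambda>z. std_normal_density z * f z)"
  using assms by (subst integrable_density) auto

text \<open>
  With \<open>y = x\<^sup>2 / 2\<close>, this is dominated by a constant times \<open>y ^ k / exp y\<close>.
\<close>

lemma std_normal_density_tendsto_0:
  "((\<lambda>x::real. x ^ k * std_normal_density x) \<longlongrightarrow> 0) at_top"
proof -
  have *: "((\<lambda>x::real. (x\<^sup>2/2) ^ k / exp (x\<^sup>2/2)) \<longlongrightarrow> 0) at_top"
  proof (rule filterlim_compose[OF tendsto_power_div_exp_0])
    show "filterlim (\<lambda>x::real. x\<^sup>2/2) at_top at_top"
      using filterlim_tendsto_pos_mult_at_top[OF tendsto_const[of "1/2::real"] _ filterlim_pow_at_top[of 2, OF _ filterlim_ident]]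
      by simp
  qed
  have "((\<lambda>x::real. 2^k / sqrt (2*pi) * ((x\<^sup>2/2) ^ k / exp (x\<^sup>2/2))) \<longlongrightarrow> 2^k / sqrt (2*pi) * 0) at_top"
    by (intro tendsto_intros *)
  then have 0: "((\<lambda>x::real. 2^k / sqrt (2*pi) * ((x\<^sup>2/2) ^ k / exp (x\<^sup>2/2))) \<longlongrightarrow> 0) at_top" by simp
  show ?thesis
  proof (rule Lim_null_comparison[OF _ 0])
    show "\<forall>\<^sub>F x in at_top. norm (x ^ k * std_normal_density x) \<le> 2^k / sqrt (2*pi) * ((x\<^sup>2/2) ^ k / exp (x\<^sup>2/2))"
      using eventually_ge_at_top[of 1]
    proof eventually_elim
      case (elim x)
      have "2^k * (x\<^sup>2/2)^k = (x\<^sup>2)^k" by (simp add: power_divide)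
      moreover have "x^k \<le> (x\<^sup>2)^k" using elim by (intro power_mono) (auto simp: power2_eq_square)
      moreover have "norm (x ^ k * std_normal_density x) = x^k / (sqrt (2*pi) * exp (x\<^sup>2/2))"
        using elim by (simp add: std_normal_density_def exp_minus field_simps)
      ultimately show ?case
        by (simp add: divide_right_mono)
    qed
  qed
qed

lemma std_normal_density_tendsto_0_at_bot:
  "((\<lambda>x::real. std_normal_density x) \<longlongrightarrow> 0) at_bot"
proof -
  have "((\<lambda>x::real. std_normal_density (-x)) \<longlongrightarrow> 0) at_top"
    using std_normal_density_tendsto_0[of 0] by (simp add: std_normal_density_def)
  then show ?thesis by (simp add: filterlim_at_bot_mirror)
qed

lemma DERIV_std_normal_density:
  "((\<lambda>x. std_normal_density x) has_real_derivative - x * std_normal_density x) (at x)"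
proof -
  have "((\<lambda>x::real. exp (- x\<^sup>2 / 2)) has_real_derivative - x * exp (- x\<^sup>2 / 2)) (at x)"
    by (auto intro!: derivative_eq_intros)
  from DERIV_cmult[OF this, of "1 / sqrt (2 * pi)"] show ?thesis
    unfolding std_normal_density_def by (simp add: mult_ac)
qed

text \<open>
  Integrability on the ray is assumed instead of a sign of the integrand, since moments of a tail at a
  negative point are needed.
\<close>

lemma lborel_integral_derivative_ray:
  fixes F f :: "real \<Rightarrow> real"
  assumes "set_integrable lborel {a..} f"
    and F: "\<And>x. (F has_real_derivative f x) (at x)" and f: "\<And>x. isCont f x"
    and T: "(F \<longlongrightarrow> 0) at_top"
  shows "(LBINT x:{a..}. f x) = - F a"
proof -
  have "((\<lambda>y. LINT x|lborel. indicator {..y} x *\<^sub>R (indicator {a..} x *\<^sub>R f x)) \<longlongrightarrow> (LBINT x:{a..}. f x)) at_top"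
    using assms(1) unfolding set_integrable_def set_lebesgue_integral_def
    by (intro tendsto_integral_at_top) auto
  moreover have "\<forall>\<^sub>F y in at_top. (LINT x|lborel. indicator {..y} x *\<^sub>R (indicator {a..} x *\<^sub>R f x)) = F y - F a"
    using eventually_ge_at_top[of a]
  proof eventually_elim
    case (elim y)
    have "(LINT x|lborel. indicator {..y} x *\<^sub>R (indicator {a..} x *\<^sub>R f x)) = (LINT x|lborel. f x * indicator {a..y} x)"
      by (intro Bochner_Integration.integral_cong) (auto split: split_indicator)
    also have "\<dots> = F y - F a" by (rule integral_FTC_Icc_real[OF elim F f])
    finally show ?case .
  qed
  ultimately have "((\<lambda>y. F y - F a) \<longlongrightarrow> (LBINT x:{a..}. f x)) at_top"
    by (rule Lim_transform_eventually)
  moreover have "((\<lambda>y. F y - F a) \<longlongrightarrow> 0 - F a) at_top" by (intro tendsto_intros T)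
  ultimately show ?thesis using tendsto_unique trivial_limit_at_top_linorder by fastforce
qed

lemma lborel_integral_derivative_line:
  fixes F f :: "real \<Rightarrow> real"
  assumes int: "integrable lborel f"
    and F: "\<And>x. (F has_real_derivative f x) (at x)" and f: "\<And>x. isCont f x"
    and T: "(F \<longlongrightarrow> 0) at_top" and B: "(F \<longlongrightarrow> 0) at_bot"
  shows "(\<integral>x. f x \<partial>lborel) = 0"
proof -
  have "(\<lambda>k::nat. LINT x|lborel. indicator {- real k..real k} x *\<^sub>R f x) \<longlonglongrightarrow> (LINT x|lborel. f x)"
  proof (rule integral_dominated_convergence[where w="\<lambda>x. norm (f x)"])
    show "AE x in lborel. (\<lambda>k. indicator {- real k..real k} x *\<^sub>R f x) \<longlonglongrightarrow> f x"
    proof (rule AE_I2)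
      fix x :: real
      obtain N :: nat where "\<bar>x\<bar> \<le> real N" using real_arch_simple by blast
      have "\<forall>\<^sub>F k in sequentially. f x = indicator {- real k..real k} x *\<^sub>R f x"
        using eventually_ge_at_top[of N]
        by eventually_elim (use \<open>\<bar>x\<bar> \<le> real N\<close> in \<open>auto split: split_indicator\<close>)
      then show "(\<lambda>k. indicator {- real k..real k} x *\<^sub>R f x) \<longlonglongrightarrow> f x"
        by (rule Lim_transform_eventually[OF tendsto_const])
    qed
  qed (use int in \<open>auto split: split_indicator\<close>)
  moreover have "(LINT x|lborel. indicator {- real k..real k} x *\<^sub>R f x) = F (real k) - F (- real k)" for k
    using integral_FTC_Icc_real[of "- real k" "real k" F f] F f by (simp add: mult.commute)
  ultimately have "(\<lambda>k. F (real k) - F (- real k)) \<longlonglongrightarrow> (LINT x|lborel. f x)" by simp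
  moreover have "(\<lambda>k. F (real k) - F (- real k)) \<longlonglongrightarrow> 0 - 0"
    by (intro tendsto_diff filterlim_compose[OF T] filterlim_compose[OF B] filterlim_real_sequentially
        filterlim_uminus_at_top[THEN iffD1, OF filterlim_real_sequentially])
  ultimately show ?thesis using LIMSEQ_unique by fastforce
qed

definition normal_tail :: "real \<Rightarrow> real" where
  "normal_tail t = (LBINT z:{t..}. std_normal_density z)"

lemma set_integrable_normal_power:
  assumes "A \<in> sets borel"
  shows "set_integrable lborel A (\<lambda>z. std_normal_density z * z ^ k)"
  unfolding set_integrable_def
  using integrable_mult_indicator[OF _ integrable_std_normal_moment[of k]] assms by auto

text \<open>
  The density \<open>\<phi>\<close> satisfies \<open>\<phi>' = - z \<phi>\<close>.
\<close>

lemma normal_tail_first_moment: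
  "(LBINT z:{t..}. std_normal_density z * z) = std_normal_density t"
proof -
  have "(LBINT z:{t..}. std_normal_density z * z) = - (- std_normal_density t)"
  proof (rule lborel_integral_derivative_ray)
    show "set_integrable lborel {t..} (\<lambda>z. std_normal_density z * z)"
      using set_integrable_normal_power[of "{t..}" 1] by simp
    show "((\<lambda>z. - std_normal_density z) has_real_derivative std_normal_density x * x) (at x)" for x
      using DERIV_minus[OF DERIV_std_normal_density[of x]] by (simp add: mult.commute)
    show "((\<lambda>z. - std_normal_density z) \<longlongrightarrow> 0) at_top"
      using tendsto_minus[OF std_normal_density_tendsto_0[of 0]] by simp
    show "isCont (\<lambda>z. std_normal_density z * z) x" for x
      by (intro continuous_intros DERIV_isCont[OF DERIV_std_normal_density])
  qed
  then show ?thesis by simp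
qed

text \<open>
  Because \<open>(z \<phi>)' = \<phi> - z\<^sup>2 \<phi>\<close>.
\<close>

lemma normal_tail_second_moment:
  "(LBINT z:{t..}. std_normal_density z * z\<^sup>2) = t * std_normal_density t + normal_tail t"
proof -
  have i: "set_integrable lborel {t..} (\<lambda>z. std_normal_density z * z\<^sup>2)"
    "set_integrable lborel {t..} std_normal_density"
    using set_integrable_normal_power[of "{t..}" 2] set_integrable_normal_power[of "{t..}" 0] by auto
  have "(LBINT z:{t..}. std_normal_density z * z\<^sup>2 - std_normal_density z) = - (- t * std_normal_density t)"
  proof (rule lborel_integral_derivative_ray)
    show "set_integrable lborel {t..} (\<lambda>z. std_normal_density z * z\<^sup>2 - std_normal_density z)"
      using i by (rule set_integral_diff)
    show "((\<lambda>z. - z * std_normal_density z) has_real_derivative std_normal_density x * x\<^sup>2 - std_normal_density x) (at x)" for x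
      by (auto intro!: derivative_eq_intros DERIV_std_normal_density simp: power2_eq_square)
    show "((\<lambda>z. - z * std_normal_density z) \<longlongrightarrow> 0) at_top"
      using tendsto_minus[OF std_normal_density_tendsto_0[of 1]] by simp
    show "isCont (\<lambda>z. std_normal_density z * z\<^sup>2 - std_normal_density z) x" for x
      by (intro continuous_intros DERIV_isCont[OF DERIV_std_normal_density])
  qed
  then show ?thesis using set_integral_diff(2)[OF i] by (simp add: normal_tail_def)
qed

lemma normal_tail_uminus: "normal_tail (- t) = 1 - normal_tail t"
proof -
  have i: "integrable lborel (\<lambda>z. indicator A z *\<^sub>R std_normal_density z)" if "A \<in> sets borel" for A
    using set_integrable_normal_power[OF that, of 0] by (simp add: set_integrable_def)
  have "normal_tail (- t) = (\<integral>z. indicator {-t..} (0 + (-1) * z) *\<^sub>R std_normal_density (0 + (-1) * z) \<partial>lborel)"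
    unfolding normal_tail_def set_lebesgue_integral_def
    by (subst lborel_integral_real_affine[of "-1" _ 0]) auto
  also have "\<dots> = (\<integral>z. indicator {..t} z *\<^sub>R std_normal_density z \<partial>lborel)"
    by (intro Bochner_Integration.integral_cong) (auto simp: std_normal_density_def split: split_indicator)
  also have "\<dots> + normal_tail t = (\<integral>z. indicator {..t} z *\<^sub>R std_normal_density z + indicator {t..} z *\<^sub>R std_normal_density z \<partial>lborel)"
    unfolding normal_tail_def set_lebesgue_integral_def
    by (subst Bochner_Integration.integral_add) (use i in auto)
  also have "\<dots> = (\<integral>z. std_normal_density z \<partial>lborel)"
  proof (rule integral_cong_AE)
    show "AE z in lborel. indicator {..t} z *\<^sub>R std_normal_density z + indicator {t..} z *\<^sub>R std_normal_density z = std_normal_density z"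
      using AE_lborel_singleton[of t] by eventually_elim (auto split: split_indicator)
  qed auto
  finally show ?thesis by simp
qed

lemma erfc_eq_normal_tail: "erfc x = 2 * normal_tail (x * sqrt 2)"
proof -
  have "(LBINT t:{x..}. exp (- t\<^sup>2)) = \<bar>1/sqrt 2\<bar> *\<^sub>R (\<integral>z. indicator {x..} (0 + 1/sqrt 2 * z) *\<^sub>R exp (- (0 + 1/sqrt 2 * z)\<^sup>2) \<partial>lborel)"
    unfolding set_lebesgue_integral_def by (rule lborel_integral_real_affine) auto
  also have "(\<integral>z. indicator {x..} (0 + 1/sqrt 2 * z) *\<^sub>R exp (- (0 + 1/sqrt 2 * z)\<^sup>2) \<partial>lborel)
     = (\<integral>z. sqrt (2*pi) * (indicator {x * sqrt 2..} z *\<^sub>R std_normal_density z) \<partial>lborel)"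
    by (intro Bochner_Integration.integral_cong)
       (auto simp: std_normal_density_def power_divide field_simps split: split_indicator)
  also have "\<dots> = sqrt (2*pi) * normal_tail (x * sqrt 2)"
    by (simp add: normal_tail_def set_lebesgue_integral_def)
  finally show ?thesis unfolding erfc_def
    by (simp add: real_sqrt_mult)
qed

section \<open>The functions of the threshold as Gaussian expectations\<close>

lemma f_gar_eq_set_integral:
  "f_gar c = (LBINT z:{-c..}. std_normal_density z * (z + c)\<^sup>2)"
proof -
  have "f_gar c = (\<integral>z. 1 / sqrt (2 * pi) * (indicator {-c..} z *\<^sub>R ((z + c)\<^sup>2 * exp (- z\<^sup>2 / 2))) \<partial>lborel)"
    unfolding f_gar_def set_lebesgue_integral_def by simp
  also have "\<dots> = (LBINT z:{-c..}. std_normal_density z * (z + c)\<^sup>2)"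
    unfolding set_lebesgue_integral_def
    by (intro Bochner_Integration.integral_cong) (auto simp: std_normal_density_def split: split_indicator)
  finally show ?thesis .
qed

lemma f_gar_eq_normal_tail:
  "f_gar c = c * std_normal_density c + (c\<^sup>2 + 1) * normal_tail (- c)"
proof -
  have i: "set_integrable lborel {-c..} (\<lambda>z. std_normal_density z * z\<^sup>2)"
    "set_integrable lborel {-c..} (\<lambda>z. 2 * c * (std_normal_density z * z))"
    "set_integrable lborel {-c..} (\<lambda>z. c\<^sup>2 * std_normal_density z)"
    using set_integrable_normal_power[of "{-c..}" 2] set_integrable_normal_power[of "{-c..}" 1]
      set_integrable_normal_power[of "{-c..}" 0] by auto
  have "f_gar c = (LBINT z:{-c..}. std_normal_density z * z\<^sup>2 + 2 * c * (std_normal_density z * z)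
      + c\<^sup>2 * std_normal_density z)"
    unfolding f_gar_eq_set_integral by (simp add: power2_eq_square algebra_simps)
  also have "\<dots> = (LBINT z:{-c..}. std_normal_density z * z\<^sup>2) + 2 * c * (LBINT z:{-c..}. std_normal_density z * z)
      + c\<^sup>2 * normal_tail (-c)"
    using i by (simp add: set_integral_add normal_tail_def)
  also have "\<dots> = c * std_normal_density (-c) + (c\<^sup>2 + 1) * normal_tail (- c)"
    unfolding normal_tail_first_moment normal_tail_second_moment by (simp add: algebra_simps)
  finally show ?thesis by (simp add: std_normal_density_def)
qed

lemma f_gar_closed_form:
  assumes "\<beta> > 0"
  shows "f_gar (\<kappa> / sqrt \<beta>) = \<kappa> * exp (- \<kappa>\<^sup>2 / (2 * \<beta>)) / sqrt (2 * \<beta> * pi)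
        + (\<kappa>\<^sup>2 / \<beta> + 1) * erfc (- \<kappa> / sqrt (2 * \<beta>)) / 2"
proof -
  have "- \<kappa> / sqrt (2 * \<beta>) * sqrt 2 = - (\<kappa> / sqrt \<beta>)"
    by (simp add: real_sqrt_mult)
  moreover have "(\<kappa> / sqrt \<beta>)\<^sup>2 = \<kappa>\<^sup>2 / \<beta>" using assms by (simp add: power_divide)
  ultimately show ?thesis
    using assms by (simp add: f_gar_eq_normal_tail erfc_eq_normal_tail std_normal_density_def real_sqrt_mult field_simps)
qed

text \<open>
  The reflection \<open>z \<mapsto> - z\<close> brings the defining integral into the form in which \<open>f_gar\<close> occurs below: as
  the mean square of one coordinate of the positive part of \<open>c - a\<close>.
\<close>

lemma f_gar_eq_expectation:
  "f_gar c = (\<integral>z. (max 0 (c - z))\<^sup>2 \<partial>std_normal_distribution)"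
proof -
  have "(\<integral>z. (max 0 (c - z))\<^sup>2 \<partial>std_normal_distribution) = (\<integral>z. std_normal_density z * (max 0 (c - z))\<^sup>2 \<partial>lborel)"
    by (rule integral_std_gauss) auto
  also have "\<dots> = (\<integral>z. std_normal_density (0 + (-1) * z) * (max 0 (c - (0 + (-1) * z)))\<^sup>2 \<partial>lborel)"
    by (subst lborel_integral_real_affine[of "-1" _ 0]) auto
  also have "\<dots> = f_gar c"
    unfolding f_gar_eq_set_integral set_lebesgue_integral_def
    by (intro Bochner_Integration.integral_cong)
       (auto simp: std_normal_density_def max_def add.commute split: split_indicator)
  finally show ?thesis ..
qed

text \<open>
  Growth at most \<open>A * (1 + z\<^sup>2)\<close> is the regularity that all functions of one Gaussian below share; it
  gives integrability here and exponential moments later.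
\<close>

lemma integrable_std_gauss_quadratic:
  fixes f :: "real \<Rightarrow> real"
  assumes [measurable]: "f \<in> borel_measurable borel" and f: "\<And>z. \<bar>f z\<bar> \<le> A * (1 + z\<^sup>2)"
  shows "integrable std_normal_distribution f"
proof -
  have "integrable lborel (\<lambda>z. A * (std_normal_density z + std_normal_density z * z\<^sup>2))"
    using integrable_std_normal_moment[of 2] by auto
  then have "integrable lborel (\<lambda>z. std_normal_density z * f z)"
  proof (rule Bochner_Integration.integrable_bound)
    show "AE z in lborel. norm (std_normal_density z * f z) \<le> norm (A * (std_normal_density z + std_normal_density z * z\<^sup>2))"
    proof (rule AE_I2)
      fix z
      have "norm (std_normal_density z * f z) \<le> std_normal_density z * (A * (1 + z\<^sup>2))"
        using f[of z] by (simp add: abs_mult mult_left_mono)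
      also have "\<dots> = A * (std_normal_density z + std_normal_density z * z\<^sup>2)" by (simp add: algebra_simps)
      finally show "norm (std_normal_density z * f z) \<le> norm (A * (std_normal_density z + std_normal_density z * z\<^sup>2))"
        by simp
    qed
  qed auto
  then show ?thesis by (subst integrable_std_gauss_iff) auto
qed

interpretation std_gauss: prob_space std_normal_distribution
  by (rule prob_space_normal_density) simp

lemma f_gar_nonneg: "0 \<le> f_gar c"
  unfolding f_gar_eq_expectation by (rule Bochner_Integration.integral_nonneg) auto

lemma max_0_sq_quadratic_bound: "\<bar>(max 0 (c - z))\<^sup>2\<bar> \<le> (2 + 2 * c\<^sup>2) * (1 + z\<^sup>2)" for c z :: real
proof -
  have "(max 0 (c - z))\<^sup>2 \<le> (c - z)\<^sup>2" by (auto simp: max_def)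
  also have "\<dots> \<le> 2 * c\<^sup>2 + 2 * z\<^sup>2" using zero_le_power2[of "c + z"] by (simp add: power2_eq_square algebra_simps)
  also have "\<dots> \<le> (2 + 2 * c\<^sup>2) * (1 + z\<^sup>2)" by (simp add: algebra_simps)
  finally show ?thesis by simp
qed

text \<open>
  The square root of \<open>f_gar c\<close> is the \<open>L\<^sup>2\<close> norm of the positive part of \<open>c - Z\<close>, which changes by at most \<open>d\<close> when
  \<open>c\<close> changes by \<open>d\<close>.  The mixed term is controlled by the variance being nonnegative.
\<close>

lemma sqrt_f_gar_lipschitz:
  assumes "d \<ge> 0"
  shows "sqrt (f_gar (c + d)) \<le> sqrt (f_gar c) + d"
proof -
  let ?X = "\<lambda>z. max 0 (c - z)"
  have i2: "integrable std_normal_distribution (\<lambda>z. (max 0 (c' - z))\<^sup>2)" for c' :: real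
    by (rule integrable_std_gauss_quadratic[OF _ max_0_sq_quadratic_bound]) auto
  have i1: "integrable std_normal_distribution ?X"
    by (rule std_gauss.square_integrable_imp_integrable[OF _ i2]) auto
  let ?E = "\<integral>z. ?X z \<partial>std_normal_distribution"
  have "0 \<le> (\<integral>z. (?X z - ?E)\<^sup>2 \<partial>std_normal_distribution)" by (rule Bochner_Integration.integral_nonneg) auto
  also have "\<dots> = f_gar c - ?E\<^sup>2"
    unfolding f_gar_eq_expectation by (rule std_gauss.variance_eq[OF i1 i2])
  finally have "?E\<^sup>2 \<le> f_gar c" by simp
  then have E: "?E \<le> sqrt (f_gar c)" by (rule real_le_rsqrt)
  have "f_gar (c + d) \<le> (\<integral>z. (?X z)\<^sup>2 + 2 * d * ?X z + d\<^sup>2 \<partial>std_normal_distribution)"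
    unfolding f_gar_eq_expectation
  proof (rule integral_mono)
    show "integrable std_normal_distribution (\<lambda>z. (?X z)\<^sup>2 + 2 * d * ?X z + d\<^sup>2)"
      using i1 i2[of c] by auto
    fix z
    have "(max 0 (c + d - z))\<^sup>2 \<le> (?X z + d)\<^sup>2"
      using assms by (intro power_mono) auto
    then show "(max 0 (c + d - z))\<^sup>2 \<le> (?X z)\<^sup>2 + 2 * d * ?X z + d\<^sup>2"
      by (simp add: power2_sum algebra_simps)
  qed (rule i2)
  also have "\<dots> = f_gar c + 2 * d * ?E + d\<^sup>2"
    unfolding f_gar_eq_expectation using i1 i2[of c] by (simp add: std_gauss.prob_space[simplified])
  also have "\<dots> \<le> f_gar c + 2 * d * sqrt (f_gar c) + d\<^sup>2"
    using E assms by (simp add: mult_left_mono)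
  also have "\<dots> = (sqrt (f_gar c) + d)\<^sup>2"
    using f_gar_nonneg[of c] by (simp add: power2_sum)
  finally show ?thesis
    using assms f_gar_nonneg[of c] by (intro real_le_lsqrt) auto
qed

text \<open>
  The minimum of \<open>h * y + \<gamma> * y\<^sup>2\<close> over \<open>\<bar>y\<bar> \<le> 1\<close>: the vertex of the parabola if it lies in the interval,
  the value at \<open>y = - sgn h\<close> otherwise.  At \<open>\<gamma> = 0\<close> the first case only occurs for \<open>h = 0\<close>, and the
  division by zero then yields the correct value 0.
\<close>

definition box_lagrangian_min :: "real \<Rightarrow> real \<Rightarrow> real" where
  "box_lagrangian_min \<gamma> h = (if \<bar>h\<bar> \<le> 2 * \<gamma> then - h\<^sup>2 / (4 * \<gamma>) else \<gamma> - \<bar>h\<bar>)"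

lemma borel_measurable_box_lagrangian_min [measurable]:
  "box_lagrangian_min \<gamma> \<in> borel_measurable borel"
  unfolding box_lagrangian_min_def by measurable

lemma box_lagrangian_min_le:
  assumes "\<bar>y\<bar> \<le> 1" "\<gamma> \<ge> 0"
  shows "box_lagrangian_min \<gamma> h \<le> h * y + \<gamma> * y\<^sup>2"
proof (cases "\<bar>h\<bar> \<le> 2 * \<gamma>")
  case True
  show ?thesis
  proof (cases "\<gamma> = 0")
    case True then show ?thesis using \<open>\<bar>h\<bar> \<le> 2 * \<gamma>\<close> by (simp add: box_lagrangian_min_def)
  next
    case False
    then have "\<gamma> > 0" using assms by simp
    have "0 \<le> (h + 2 * \<gamma> * y)\<^sup>2 / (4 * \<gamma>)" using \<open>\<gamma> > 0\<close> by simp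
    also have "\<dots> = h * y + \<gamma> * y\<^sup>2 + h\<^sup>2 / (4 * \<gamma>)"
      using \<open>\<gamma> > 0\<close> by (simp add: power2_eq_square field_simps)
    finally show ?thesis using True by (simp add: box_lagrangian_min_def)
  qed
next
  case False
  have "\<gamma> - \<bar>h\<bar> \<le> h * y + \<gamma> * y\<^sup>2"
  proof -
    have "- (h * y) \<le> \<bar>h\<bar> * \<bar>y\<bar>" by (metis abs_ge_minus_self abs_mult)
    moreover have "(1 - \<bar>y\<bar>) * (2 * \<gamma>) \<le> (1 - \<bar>y\<bar>) * \<bar>h\<bar>"
      using False assms by (intro mult_left_mono) auto
    moreover have "\<gamma> * (1 - y\<^sup>2) \<le> \<gamma> * (2 * (1 - \<bar>y\<bar>))"
      using assms zero_le_power2[of "1 - \<bar>y\<bar>"]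
      by (intro mult_left_mono) (auto simp: power2_diff)
    ultimately show ?thesis by (simp add: algebra_simps)
  qed
  then show ?thesis using False by (simp add: box_lagrangian_min_def)
qed

lemma box_lagrangian_min_le_0:
  assumes "\<gamma> \<ge> 0" shows "box_lagrangian_min \<gamma> h \<le> 0"
  using box_lagrangian_min_le[of 0 \<gamma> h] assms by simp

lemma box_lagrangian_min_near_0:
  assumes "\<gamma> \<ge> 0"
  shows "- \<bar>h\<bar> \<le> box_lagrangian_min \<gamma> h" "box_lagrangian_min \<gamma> h \<le> \<gamma> - \<bar>h\<bar>"
proof -
  show "box_lagrangian_min \<gamma> h \<le> \<gamma> - \<bar>h\<bar>"
    using box_lagrangian_min_le[of "- 1" \<gamma> h] box_lagrangian_min_le[of 1 \<gamma> h] assms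
    by (cases "h \<ge> 0") auto
  show "- \<bar>h\<bar> \<le> box_lagrangian_min \<gamma> h"
  proof (cases "\<bar>h\<bar> \<le> 2 * \<gamma> \<and> \<gamma> > 0")
    case True
    have "h\<^sup>2 \<le> \<bar>h\<bar> * (4 * \<gamma>)"
      using True assms mult_left_mono[of "\<bar>h\<bar>" "4 * \<gamma>" "\<bar>h\<bar>"] by (simp add: power2_eq_square)
    then show ?thesis using True by (simp add: box_lagrangian_min_def field_simps)
  next
    case False then show ?thesis using assms by (auto simp: box_lagrangian_min_def)
  qed
qed

lemma box_lagrangian_min_quadratic_bound:
  assumes "\<gamma> \<ge> 0" shows "\<bar>box_lagrangian_min \<gamma> h\<bar> \<le> 1 * (1 + h\<^sup>2)"
proof -
  have "\<bar>box_lagrangian_min \<gamma> h\<bar> \<le> \<bar>h\<bar>"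
    using box_lagrangian_min_near_0[OF assms, of h] box_lagrangian_min_le_0[OF assms, of h] by auto
  also have "\<dots> \<le> 1 + h\<^sup>2"
  proof -
    have "0 \<le> (\<bar>h\<bar> - 1)\<^sup>2" by simp
    then have "2 * \<bar>h\<bar> \<le> 1 + h\<^sup>2" by (simp add: power2_diff)
    then show ?thesis using abs_ge_zero[of h] by linarith
  qed
  finally show ?thesis by simp
qed

lemma integrable_box_lagrangian_min:
  "\<gamma> \<ge> 0 \<Longrightarrow> integrable std_normal_distribution (box_lagrangian_min \<gamma>)"
  by (rule integrable_std_gauss_quadratic[OF _ box_lagrangian_min_quadratic_bound]) auto

lemma lborel_integral_even:
  fixes g :: "real \<Rightarrow> real"
  assumes "integrable lborel g" "\<And>z. g (- z) = g z"
  shows "(\<integral>z. g z \<partial>lborel) = 2 * (LBINT z:{0..}. g z)"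
proof -
  have i: "integrable lborel (\<lambda>z. indicator A z *\<^sub>R g z)" if "A \<in> sets borel" for A
    using integrable_mult_indicator[OF _ assms(1)] that by auto
  have "(LBINT z:{0..}. g z) = (\<integral>z. indicator {0..} (0 + (-1) * z) *\<^sub>R g (0 + (-1) * z) \<partial>lborel)"
    unfolding set_lebesgue_integral_def
    by (subst lborel_integral_real_affine[of "-1" _ 0]) auto
  also have "\<dots> = (\<integral>z. indicator {..0} z *\<^sub>R g z \<partial>lborel)"
    using assms(2) by (intro Bochner_Integration.integral_cong) (auto split: split_indicator)
  also have "\<dots> + (LBINT z:{0..}. g z) = (\<integral>z. indicator {..0} z *\<^sub>R g z + indicator {0..} z *\<^sub>R g z \<partial>lborel)"
    unfolding set_lebesgue_integral_def
    by (subst Bochner_Integration.integral_add) (use i in auto)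
  also have "\<dots> = (\<integral>z. g z \<partial>lborel)"
  proof (rule integral_cong_AE)
    show "AE z in lborel. indicator {..0} z *\<^sub>R g z + indicator {0..} z *\<^sub>R g z = g z"
      using AE_lborel_singleton[of 0] by eventually_elim (auto split: split_indicator)
    show "(\<lambda>z. indicator {..0} z *\<^sub>R g z + indicator {0..} z *\<^sub>R g z) \<in> borel_measurable lborel"
      using i[of "{..0}"] i[of "{0..}"] by (intro borel_measurable_add borel_measurable_integrable) auto
  qed (use assms(1) in auto)
  finally show ?thesis by simp
qed

text \<open>
  The function is even and, on \<open>h \<ge> 0\<close>, is the parabola \<open>- h\<^sup>2 / (4 \<gamma>)\<close> plus a correction supported on
  \<open>h \<ge> 2 \<gamma>\<close>; so the expectation is a combination of truncated moments at \<open>0\<close> and \<open>2 \<gamma>\<close>.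
\<close>

lemma expectation_box_lagrangian_min:
  assumes "\<gamma> > 0"
  shows "f_box_expr \<beta> \<gamma> = (\<integral>h. box_lagrangian_min \<gamma> h \<partial>std_normal_distribution) - \<gamma> * \<beta>"
proof -
  let ?q = "box_lagrangian_min \<gamma>" and ?t = "2 * \<gamma>"
  have si: "set_integrable lborel {t..} (\<lambda>z. c * (std_normal_density z * z ^ k))" for t c k
    using set_integrable_normal_power[of "{t..}" k] by auto
  have "(\<integral>h. ?q h \<partial>std_normal_distribution) = (\<integral>z. std_normal_density z * ?q z \<partial>lborel)"
    by (rule integral_std_gauss) auto
  also have "\<dots> = 2 * (LBINT z:{0..}. std_normal_density z * ?q z)"
  proof (rule lborel_integral_even)
    show "integrable lborel (\<lambda>z. std_normal_density z * ?q z)"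
      using integrable_box_lagrangian_min[of \<gamma>] assms integrable_std_gauss_iff[of ?q] by auto
  qed (auto simp: std_normal_density_def box_lagrangian_min_def)
  also have "(LBINT z:{0..}. std_normal_density z * ?q z) =
      (LBINT z:{0..}. (- 1 / (4 * \<gamma>)) * (std_normal_density z * z ^ 2)) +
      (LBINT z:{?t..}. \<gamma> * (std_normal_density z * z ^ 0) + (-1) * (std_normal_density z * z ^ 1) + 1 / (4 * \<gamma>) * (std_normal_density z * z ^ 2))"
    (is "_ = (LBINT z:_. ?f z) + (LBINT z:_. ?g z)")
  proof -
    have "(LBINT z:{0..}. std_normal_density z * ?q z) = (\<integral>z. indicator {0..} z *\<^sub>R ?f z + indicator {?t..} z *\<^sub>R ?g z \<partial>lborel)"
      unfolding set_lebesgue_integral_def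
    proof (intro Bochner_Integration.integral_cong refl)
      fix z
      consider "z < 0" | "0 \<le> z" "z < ?t" | "z = ?t" | "z > ?t" by linarith
      then show "indicator {0..} z *\<^sub>R (std_normal_density z * ?q z) = indicator {0..} z *\<^sub>R ?f z + indicator {?t..} z *\<^sub>R ?g z"
        using assms
        by cases (auto simp: box_lagrangian_min_def field_simps power2_eq_square)
    qed
    also have "\<dots> = (LBINT z:{0..}. ?f z) + (LBINT z:{?t..}. ?g z)"
      unfolding set_lebesgue_integral_def
      by (intro Bochner_Integration.integral_add; fold set_integrable_def)
         (intro set_integral_add si)+
    finally show ?thesis .
  qed
  also have "(LBINT z:{0..}. ?f z) = - 1 / (4 * \<gamma>) * normal_tail 0"
    by (subst set_integral_mult_right) (simp add: normal_tail_second_moment)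
  also have "(LBINT z:{?t..}. ?g z) = \<gamma> * normal_tail ?t - std_normal_density ?t
      + 1 / (4 * \<gamma>) * (?t * std_normal_density ?t + normal_tail ?t)"
    using normal_tail_second_moment[of ?t] normal_tail_first_moment[of ?t]
    by (subst set_integral_add(2), (intro set_integral_add si)+)+
       (simp only: set_integral_mult_right, simp add: normal_tail_def)
  also have "normal_tail 0 = 1 / 2" using normal_tail_uminus[of 0] by simp
  finally have E: "(\<integral>h. ?q h \<partial>std_normal_distribution) = 2 * (- 1 / (4 * \<gamma>) * (1 / 2) + (\<gamma> * normal_tail ?t - std_normal_density ?t
      + 1 / (4 * \<gamma>) * (?t * std_normal_density ?t + normal_tail ?t)))" .
  have 1: "2 * \<gamma> / sqrt 2 * sqrt 2 = ?t" "- 2 * \<gamma> / sqrt 2 * sqrt 2 = - ?t" by auto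
  have 2: "- exp (- 2 * \<gamma>\<^sup>2) / sqrt (2 * pi) = - std_normal_density ?t"
    by (simp add: std_normal_density_def power_mult_distrib)
  show ?thesis
    unfolding f_box_expr_def erfc_eq_normal_tail 1 normal_tail_uminus[of ?t] E 2
    using assms by (simp add: divide_simps) (simp add: algebra_simps)
qed

text \<open>
  The limit at \<open>\<gamma> = 0\<close> in the definition is the value of the dual function there, because
  \<open>box_lagrangian_min \<gamma>\<close> is within \<open>\<gamma>\<close> of \<open>box_lagrangian_min 0\<close>.
\<close>

lemma f_box_hat_eq:
  assumes "\<beta> > 0"
  shows "f_box_hat \<beta> = 1 / sqrt \<beta> *
     (SUP \<gamma>\<in>{0..}. (\<integral>h. box_lagrangian_min \<gamma> h \<partial>std_normal_distribution) - \<gamma> * \<beta>)"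
proof -
  let ?e = "\<lambda>\<gamma>. (\<integral>h. box_lagrangian_min \<gamma> h \<partial>std_normal_distribution)"
  have b: "?e 0 \<le> ?e \<gamma>" "?e \<gamma> \<le> ?e 0 + \<gamma>" if "\<gamma> \<ge> 0" for \<gamma>
  proof -
    have i: "integrable std_normal_distribution (box_lagrangian_min \<gamma>)" "integrable std_normal_distribution (box_lagrangian_min 0)"
      using that integrable_box_lagrangian_min by auto
    have z: "box_lagrangian_min 0 h = - \<bar>h\<bar>" for h by (simp add: box_lagrangian_min_def)
    show "?e 0 \<le> ?e \<gamma>"
      using box_lagrangian_min_near_0(1)[OF that] by (intro integral_mono i) (simp add: z)
    have "?e \<gamma> \<le> (\<integral>h. box_lagrangian_min 0 h + \<gamma> \<partial>std_normal_distribution)"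
      using box_lagrangian_min_near_0(2)[OF that] by (intro integral_mono Bochner_Integration.integrable_add i) (auto simp: z add.commute)
    also have "\<dots> = ?e 0 + \<gamma>" using i std_gauss.prob_space by simp
    finally show "?e \<gamma> \<le> ?e 0 + \<gamma>" .
  qed
  have "(f_box_expr \<beta> \<longlongrightarrow> ?e 0) (at_right 0)"
  proof (rule Lim_null[THEN iffD2], rule Lim_null_comparison)
    show "\<forall>\<^sub>F \<gamma> in at_right 0. norm (f_box_expr \<beta> \<gamma> - ?e 0) \<le> \<gamma> * (1 + \<beta>)"
      using eventually_at_right_less[of 0]
    proof eventually_elim
      case (elim \<gamma>)
      have "\<gamma> * \<beta> \<ge> 0" using assms elim by simp
      with b[of \<gamma>] elim show ?case by (simp add: expectation_box_lagrangian_min[OF elim] abs_le_iff algebra_simps)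
    qed
    have "((\<lambda>\<gamma>. \<gamma> * (1 + \<beta>)) \<longlongrightarrow> 0 * (1 + \<beta>)) (at_right 0)" by (intro tendsto_intros)
    then show "((\<lambda>\<gamma>. \<gamma> * (1 + \<beta>)) \<longlongrightarrow> 0) (at_right 0)" by simp
  qed
  then have L: "Lim (at_right 0) (f_box_expr \<beta>) = ?e 0"
    by (intro tendsto_Lim) auto
  show ?thesis unfolding f_box_hat_def L
    by (intro arg_cong[of _ _ "\<lambda>x. 1 / sqrt \<beta> * x"] SUP_cong refl)
       (auto simp: expectation_box_lagrangian_min)
qed

lemma box_dual_le_0:
  assumes "\<gamma> \<ge> 0" "\<beta> > 0"
  shows "(\<integral>h. box_lagrangian_min \<gamma> h \<partial>std_normal_distribution) - \<gamma> * \<beta> \<le> 0"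
proof -
  have "(\<integral>h. box_lagrangian_min \<gamma> h \<partial>std_normal_distribution) \<le> (\<integral>h. 0 \<partial>std_normal_distribution)"
    using assms by (intro integral_mono integrable_box_lagrangian_min box_lagrangian_min_le_0) auto
  moreover have "\<gamma> * \<beta> \<ge> 0" using assms by simp
  ultimately show ?thesis by simp
qed

lemma f_box_hat_le_0:
  assumes "\<beta> > 0" shows "f_box_hat \<beta> \<le> 0"
proof -
  have "(SUP \<gamma>\<in>{0..}. (\<integral>h. box_lagrangian_min \<gamma> h \<partial>std_normal_distribution) - \<gamma> * \<beta>) \<le> 0"
    using box_dual_le_0[OF _ assms] by (intro cSUP_least) auto
  then show ?thesis using assms by (simp add: f_box_hat_eq divide_nonpos_nonneg)
qed

lemma f_box_hat_approx:
  assumes "\<beta> > 0" "e > 0"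
  obtains \<gamma> where "\<gamma> \<ge> 0" "f_box_hat \<beta> - e < 1 / sqrt \<beta> * ((\<integral>h. box_lagrangian_min \<gamma> h \<partial>std_normal_distribution) - \<gamma> * \<beta>)"
proof -
  let ?g = "\<lambda>\<gamma>. (\<integral>h. box_lagrangian_min \<gamma> h \<partial>std_normal_distribution) - \<gamma> * \<beta>"
  have "bdd_above (?g ` {0..})"
    using box_dual_le_0[OF _ assms(1)] by (intro bdd_aboveI2[of _ _ 0]) auto
  moreover have "sqrt \<beta> * e > 0" using assms by simp
  then have "(SUP \<gamma>\<in>{0..}. ?g \<gamma>) - sqrt \<beta> * e < (SUP \<gamma>\<in>{0..}. ?g \<gamma>)" by simp
  ultimately obtain \<gamma> where g: "\<gamma> \<ge> 0" "(SUP \<gamma>\<in>{0..}. ?g \<gamma>) - sqrt \<beta> * e < ?g \<gamma>"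
    using less_cSUP_iff[of "{0..}" ?g] by fastforce
  then have "1 / sqrt \<beta> * ((SUP \<gamma>\<in>{0..}. ?g \<gamma>) - sqrt \<beta> * e) < 1 / sqrt \<beta> * ?g \<gamma>"
    using assms by (intro mult_strict_left_mono) auto
  then show ?thesis using that[OF g(1)] assms by (simp add: f_box_hat_eq right_diff_distrib)
qed

section \<open>Exponential tail bounds for sums over independent Gaussians\<close>

text \<open>
  Up to a constant the integrand is the centred normal density of variance 2.
\<close>

lemma integrable_std_gauss_exp_square:
  "integrable std_normal_distribution (\<lambda>z. exp (z\<^sup>2 / 4))"
proof -
  have "integrable lborel (\<lambda>z. sqrt 2 * normal_density 0 (sqrt 2) z)" by auto
  also have "(\<lambda>z. sqrt 2 * normal_density 0 (sqrt 2) z) = (\<lambda>z. std_normal_density z * exp (z\<^sup>2 / 4))"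
  proof
    fix z :: real
    have "- z\<^sup>2 / 2 + z\<^sup>2 / 4 = - z\<^sup>2 / 4" by simp
    then have "exp (- z\<^sup>2 / 2) * exp (z\<^sup>2 / 4) = exp (- z\<^sup>2 / 4)" by (metis exp_add)
    then show "sqrt 2 * normal_density 0 (sqrt 2) z = std_normal_density z * exp (z\<^sup>2 / 4)"
      by (simp add: normal_density_def real_sqrt_mult field_simps)
  qed
  finally show ?thesis
    by (subst integrable_std_gauss_iff) auto
qed

text \<open>
  A Gaussian functional with negative mean \<open>- e\<close> has an exponential moment below 1: to first order in
  \<open>s\<close> the moment is \<open>1 - s * e\<close>, and the quadratic growth of \<open>f\<close> bounds the second-order term by
  \<open>s\<^sup>2\<close> times an exponential moment of \<open>\<bar>f\<bar>\<close>, which is finite for small \<open>s\<close>.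
\<close>

lemma exponential_moment_decay:
  fixes f :: "real \<Rightarrow> real"
  assumes [measurable]: "f \<in> borel_measurable borel" and f: "\<And>z. \<bar>f z\<bar> \<le> A * (1 + z\<^sup>2)"
    and neg: "(\<integral>z. f z \<partial>std_normal_distribution) < 0"
  obtains s c where "s > 0" "c > 0" "integrable std_normal_distribution (\<lambda>z. exp (s * f z))"
    "(\<integral>z. exp (s * f z) \<partial>std_normal_distribution) \<le> exp (- c)"
proof -
  define e where "e = - (\<integral>z. f z \<partial>std_normal_distribution)"
  have "e > 0" using neg by (simp add: e_def)
  define A' where "A' = max A 1"
  have "A' > 0" by (simp add: A'_def)
  have fA': "\<bar>f z\<bar> \<le> A' * (1 + z\<^sup>2)" for z
    by (rule order_trans[OF f]) (auto simp: A'_def intro!: mult_right_mono add_nonneg_nonneg)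
  \<comment> \<open>With this \<open>b\<close>, the exponential of \<open>2 * b * \<bar>f z\<bar>\<close> is dominated by a multiple of that of \<open>z\<^sup>2 / 4\<close>.\<close>
  define b where "b = 1 / (8 * A')"
  have "b > 0" using \<open>A' > 0\<close> by (simp add: b_def)
  have fi: "integrable std_normal_distribution f"
    by (rule integrable_std_gauss_quadratic[OF _ f]) auto
  have bnd: "exp (2 * b * \<bar>f z\<bar>) \<le> exp (1/4) * exp (z\<^sup>2 / 4)" for z
  proof -
    have "2 * b * \<bar>f z\<bar> \<le> 2 * b * (A' * (1 + z\<^sup>2))"
      using fA'[of z] \<open>b > 0\<close> by (intro mult_left_mono) auto
    also have "\<dots> = 1/4 + z\<^sup>2 / 4" using \<open>A' > 0\<close> by (simp add: b_def field_simps)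
    finally show ?thesis by (simp flip: exp_add)
  qed
  have gi: "integrable std_normal_distribution (\<lambda>z. exp (1/4) * exp (z\<^sup>2 / 4))"
    using integrable_std_gauss_exp_square by simp
  have ei: "integrable std_normal_distribution (\<lambda>z. exp (2 * b * \<bar>f z\<bar>))"
    by (rule Bochner_Integration.integrable_bound[OF gi]) (use bnd in auto)
  define C where "C = (\<integral>z. exp (2 * b * \<bar>f z\<bar>) \<partial>std_normal_distribution)"
  have "C \<ge> (\<integral>z. 1 \<partial>std_normal_distribution)"
    unfolding C_def using \<open>b > 0\<close> by (intro integral_mono ei) auto
  then have "C \<ge> 1" using std_gauss.prob_space by simp
  define \<theta> where "\<theta> = min 1 (b * e / (4 * C))"
  have th: "0 < \<theta>" "\<theta> \<le> 1" "\<theta> \<le> b * e / (4 * C)"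
    using \<open>b > 0\<close> \<open>e > 0\<close> \<open>C \<ge> 1\<close> by (auto simp: \<theta>_def)
  have si: "integrable std_normal_distribution (\<lambda>z. exp (\<theta> * b * f z))"
  proof (rule Bochner_Integration.integrable_bound[OF ei])
    have "\<theta> * b * f z \<le> 2 * b * \<bar>f z\<bar>" for z
    proof -
      have "\<theta> * b * f z \<le> \<theta> * b * \<bar>f z\<bar>"
        using th \<open>b > 0\<close> by (intro mult_left_mono) auto
      also have "\<dots> \<le> 2 * b * \<bar>f z\<bar>"
        using th \<open>b > 0\<close> by (intro mult_right_mono) auto
      finally show ?thesis .
    qed
    then show "AE z in std_normal_distribution. norm (exp (\<theta> * b * f z)) \<le> norm (exp (2 * b * \<bar>f z\<bar>))" by simp
  qed auto
  \<comment> \<open>Taylor expansion to second order; the square and the remainder each cost one factor \<open>exp (b * \<bar>f z\<bar>)\<close>.\<close>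
  have pt: "exp (\<theta> * b * f z) \<le> 1 + \<theta> * b * f z + 2 * \<theta>\<^sup>2 * exp (2 * b * \<bar>f z\<bar>)" for z
  proof -
    define u where "u = b * \<bar>f z\<bar>"
    have "u \<ge> 0" using \<open>b > 0\<close> by (simp add: u_def)
    obtain t where t: "\<bar>t\<bar> \<le> \<bar>\<theta> * b * f z\<bar>"
        "exp (\<theta> * b * f z) = (\<Sum>m<2. (\<theta> * b * f z) ^ m / fact m) + exp t / fact 2 * (\<theta> * b * f z) ^ 2"
      using Maclaurin_exp_le[of "\<theta> * b * f z" 2] by blast
    have "\<bar>\<theta> * b * f z\<bar> = \<theta> * u" using th \<open>b > 0\<close> by (simp add: u_def abs_mult)
    also have "\<dots> \<le> u" using th \<open>u \<ge> 0\<close> by (simp add: mult_left_le_one_le)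
    finally have "t \<le> u" using t(1) by linarith
    have "(\<theta> * b * f z)\<^sup>2 = \<theta>\<^sup>2 * u\<^sup>2" by (simp add: u_def power_mult_distrib)
    moreover have "u\<^sup>2 \<le> 2 * exp u" using exp_lower_Taylor_quadratic[OF \<open>u \<ge> 0\<close>] \<open>u \<ge> 0\<close> by simp
    ultimately have "(\<theta> * b * f z)\<^sup>2 \<le> \<theta>\<^sup>2 * (2 * exp u)" by (simp add: mult_left_mono)
    then have "exp t / fact 2 * (\<theta> * b * f z) ^ 2 \<le> exp u / 2 * (\<theta>\<^sup>2 * (2 * exp u))"
      using \<open>t \<le> u\<close> by (intro mult_mono) auto
    also have "\<dots> = \<theta>\<^sup>2 * (exp u * exp u)" by simp
    also have "exp u * exp u = exp (2 * b * \<bar>f z\<bar>)"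
      by (simp add: u_def flip: exp_add)
    also have "\<theta>\<^sup>2 * exp (2 * b * \<bar>f z\<bar>) \<le> 2 * (\<theta>\<^sup>2 * exp (2 * b * \<bar>f z\<bar>))" by simp
    finally have "exp t / fact 2 * (\<theta> * b * f z) ^ 2 \<le> 2 * (\<theta>\<^sup>2 * exp (2 * b * \<bar>f z\<bar>))" .
    moreover have "(\<Sum>m<2. (\<theta> * b * f z) ^ m / fact m) = 1 + \<theta> * b * f z"
      by (simp add: numeral_2_eq_2)
    ultimately show ?thesis using t(2) by simp
  qed
  have "(\<integral>z. exp (\<theta> * b * f z) \<partial>std_normal_distribution)
      \<le> (\<integral>z. 1 + \<theta> * b * f z + 2 * \<theta>\<^sup>2 * exp (2 * b * \<bar>f z\<bar>) \<partial>std_normal_distribution)"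
    using fi ei by (intro integral_mono si pt) auto
  also have "\<dots> = 1 - \<theta> * b * e + 2 * \<theta>\<^sup>2 * C"
    unfolding C_def e_def using fi ei std_gauss.prob_space by simp
  also have "2 * \<theta>\<^sup>2 * C \<le> \<theta> * b * e / 2"
  proof -
    have "\<theta> * C \<le> b * e / 4" using th(3) \<open>C \<ge> 1\<close> by (simp add: field_simps)
    then have "2 * \<theta> * (\<theta> * C) \<le> 2 * \<theta> * (b * e / 4)" using th by (intro mult_left_mono) auto
    then show ?thesis by (simp add: power2_eq_square algebra_simps)
  qed
  also have "1 - \<theta> * b * e + \<theta> * b * e / 2 = 1 + (- (\<theta> * b * e / 2))" by simp
  also have "\<dots> \<le> exp (- (\<theta> * b * e / 2))" by (rule exp_ge_add_one_self)
  finally show ?thesis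
    using that[of "\<theta> * b" "\<theta> * b * e / 2"] th \<open>b > 0\<close> \<open>e > 0\<close> si by auto
qed

abbreviation gauss_field :: "'i set \<Rightarrow> ('i \<Rightarrow> real) measure" where
  "gauss_field K \<equiv> PiM K (\<lambda>_. std_normal_distribution)"

interpretation gauss_prod: product_sigma_finite "\<lambda>_::'i. std_normal_distribution"
  by standard

lemma prob_space_gauss_field: "prob_space (gauss_field K)"
  by (rule prob_space_PiM) (rule std_gauss.prob_space_axioms)

text \<open>
  Markov's inequality for the product of exponential moments.  The rate depends on \<open>f\<close> and \<open>r\<close> only, so
  that the bound may be used along a sequence of growing index sets \<open>J\<close>.
\<close>

lemma cramer_upper_tail:
  fixes f :: "real \<Rightarrow> real"
  assumes [measurable]: "f \<in> borel_measurable borel" and f: "\<And>z. \<bar>f z\<bar> \<le> A * (1 + z\<^sup>2)"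
    and less: "(\<integral>z. f z \<partial>std_normal_distribution) < r"
  obtains c where "c > 0"
    "\<And>K J :: 'i set. finite K \<Longrightarrow> J \<subseteq> K \<Longrightarrow>
       measure (gauss_field K) {z \<in> space (gauss_field K). (\<Sum>i\<in>J. f (z i)) \<ge> r * real (card J)}
         \<le> exp (- c * real (card J))"
proof -
  have i: "integrable std_normal_distribution f"
    by (rule integrable_std_gauss_quadratic[OF _ f]) auto
  have "\<bar>f z - r\<bar> \<le> (A + \<bar>r\<bar>) * (1 + z\<^sup>2)" for z
  proof -
    have "\<bar>f z - r\<bar> \<le> A * (1 + z\<^sup>2) + \<bar>r\<bar>" using f[of z] by linarith
    also have "\<dots> \<le> (A + \<bar>r\<bar>) * (1 + z\<^sup>2)" by (simp add: algebra_simps)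
    finally show ?thesis .
  qed
  moreover have "(\<integral>z. f z - r \<partial>std_normal_distribution) < 0"
    using less i std_gauss.prob_space by simp
  ultimately obtain s c where sc: "s > 0" "c > 0" "integrable std_normal_distribution (\<lambda>z. exp (s * (f z - r)))"
    "(\<integral>z. exp (s * (f z - r)) \<partial>std_normal_distribution) \<le> exp (- c)"
    by (rule exponential_moment_decay[of "\<lambda>z. f z - r", rotated]) auto
  show ?thesis
  proof (rule that[OF sc(2)])
    fix K J :: "'i set" assume K: "finite K" "J \<subseteq> K"
    then have "finite J" by (simp add: finite_subset)
    interpret P: prob_space "gauss_field K" by (rule prob_space_gauss_field)
    let ?g = "\<lambda>i z. if i \<in> J then exp (s * (f z - r)) else 1"
    have gi: "integrable std_normal_distribution (?g i)" for i using sc(3) by (cases "i \<in> J") auto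
    have prod: "(\<Prod>i\<in>K. ?g i (z i)) = exp (s * ((\<Sum>i\<in>J. f (z i)) - r * real (card J)))" for z
    proof -
      have "(\<Prod>i\<in>K. ?g i (z i)) = (\<Prod>i\<in>J. exp (s * (f (z i) - r)))"
        using K by (intro prod.mono_neutral_cong_right) auto
      also have "\<dots> = exp (\<Sum>i\<in>J. s * (f (z i) - r))" using \<open>finite J\<close> by (simp add: exp_sum)
      also have "(\<Sum>i\<in>J. s * (f (z i) - r)) = s * ((\<Sum>i\<in>J. f (z i)) - r * real (card J))"
        by (simp add: sum_subtractf mult.commute flip: sum_distrib_left)
      finally show ?thesis .
    qed
    have int: "integrable (gauss_field K) (\<lambda>z. \<Prod>i\<in>K. ?g i (z i))"
      by (rule gauss_prod.product_integrable_prod[OF K(1) gi])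
    have "measure (gauss_field K) {z \<in> space (gauss_field K). (\<Sum>i\<in>J. f (z i)) \<ge> r * real (card J)}
        = measure (gauss_field K) {z \<in> space (gauss_field K). (\<Prod>i\<in>K. ?g i (z i)) \<ge> 1}"
      using sc(1) by (intro arg_cong[of _ _ "measure _"]) (auto simp: prod zero_le_mult_iff)
    also have "\<dots> \<le> (\<integral>z. (\<Prod>i\<in>K. ?g i (z i)) \<partial>gauss_field K) / 1"
      by (rule integral_Markov_inequality_measure[OF int]) (auto simp: prod)
    also have "\<dots> = (\<Prod>i\<in>K. (\<integral>z. ?g i z \<partial>std_normal_distribution))"
      using gauss_prod.product_integral_prod[OF K(1) gi] by simp
    also have "\<dots> = (\<Prod>i\<in>J. (\<integral>z. exp (s * (f z - r)) \<partial>std_normal_distribution))"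
      using K std_gauss.prob_space by (intro prod.mono_neutral_cong_right) auto
    also have "\<dots> \<le> exp (- c) ^ card J"
      using sc(4) by (simp add: power_mono)
    also have "\<dots> = exp (- c * real (card J))" by (simp add: exp_of_nat_mult[symmetric] mult.commute)
    finally show "measure (gauss_field K) {z \<in> space (gauss_field K). (\<Sum>i\<in>J. f (z i)) \<ge> r * real (card J)}
         \<le> exp (- c * real (card J))" .
  qed
qed

lemma cramer_lower_tail:
  fixes f :: "real \<Rightarrow> real"
  assumes [measurable]: "f \<in> borel_measurable borel" and f: "\<And>z. \<bar>f z\<bar> \<le> A * (1 + z\<^sup>2)"
    and less: "r < (\<integral>z. f z \<partial>std_normal_distribution)"
  obtains c where "c > 0"
    "\<And>K J :: 'i set. finite K \<Longrightarrow> J \<subseteq> K \<Longrightarrow>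
       measure (gauss_field K) {z \<in> space (gauss_field K). (\<Sum>i\<in>J. f (z i)) \<le> r * real (card J)}
         \<le> exp (- c * real (card J))"
proof -
  show ?thesis
  proof (rule cramer_upper_tail[of "\<lambda>z. - f z" A "- r", where 'i = 'i])
    fix c :: real
    assume "c > 0" and c: "\<And>K J :: 'i set. finite K \<Longrightarrow> J \<subseteq> K \<Longrightarrow>
       measure (gauss_field K) {z \<in> space (gauss_field K). - r * real (card J) \<le> (\<Sum>i\<in>J. - f (z i))}
         \<le> exp (- c * real (card J))"
    show ?thesis by (rule that[OF \<open>c > 0\<close>]) (use c in \<open>simp add: sum_negf\<close>)
  qed (use less f in auto)
qed

section \<open>Gaussian integration by parts\<close>

text \<open>
  The integral over the line of the derivative of \<open>\<phi> * g\<close>, where \<open>\<phi>\<close> is the density, vanishes.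
\<close>

lemma std_gauss_by_parts:
  fixes g g' :: "real \<Rightarrow> real"
  assumes g: "\<And>s. (g has_real_derivative g' s) (at s)" and c: "\<And>s. isCont g' s"
    and B: "\<And>s. \<bar>g s\<bar> \<le> B" "\<And>s. \<bar>g' s\<bar> \<le> B"
  shows "(\<integral>s. s * g s \<partial>std_normal_distribution) = (\<integral>s. g' s \<partial>std_normal_distribution)"
proof -
  have [measurable]: "g \<in> borel_measurable borel" "g' \<in> borel_measurable borel"
    using DERIV_isCont[OF g] c by (auto intro!: borel_measurable_continuous_onI continuous_at_imp_continuous_on)
  have "B \<ge> 0" using B(1)[of 0] by linarith
  have b1: "\<bar>s * g s\<bar> \<le> B * (1 + s\<^sup>2)" for s
  proof -
    have "\<bar>s\<bar> \<le> 1 + s\<^sup>2"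
    proof -
      have "0 \<le> (\<bar>s\<bar> - 1)\<^sup>2" by simp
      then have "2 * \<bar>s\<bar> \<le> 1 + s\<^sup>2" by (simp add: power2_diff)
      then show ?thesis using abs_ge_zero[of s] by linarith
    qed
    then have "\<bar>s\<bar> * \<bar>g s\<bar> \<le> (1 + s\<^sup>2) * B" using B(1)[of s] by (intro mult_mono) auto
    then show ?thesis by (simp add: abs_mult mult.commute)
  qed
  have b2: "\<bar>g' s\<bar> \<le> B * (1 + s\<^sup>2)" for s
  proof -
    have "B * 1 \<le> B * (1 + s\<^sup>2)" using \<open>B \<ge> 0\<close> by (intro mult_left_mono) auto
    then show ?thesis using B(2)[of s] by linarith
  qed
  have i: "integrable std_normal_distribution (\<lambda>s. s * g s)" "integrable std_normal_distribution g'"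
    by (rule integrable_std_gauss_quadratic[OF _ b1], simp) (rule integrable_std_gauss_quadratic[OF _ b2], simp)
  have "0 = (\<integral>s. std_normal_density s * (g' s - s * g s) \<partial>lborel)"
  proof (rule lborel_integral_derivative_line[symmetric])
    show "integrable lborel (\<lambda>s. std_normal_density s * (g' s - s * g s))"
      using i by (subst integrable_std_gauss_iff[symmetric]) auto
    show "((\<lambda>s. std_normal_density s * g s) has_real_derivative std_normal_density x * (g' x - x * g x)) (at x)" for x
      by (rule DERIV_cong[OF DERIV_mult[OF DERIV_std_normal_density g]]) (simp add: algebra_simps)
    show "isCont (\<lambda>s. std_normal_density s * (g' s - s * g s)) x" for x
      by (intro continuous_intros c DERIV_isCont[OF DERIV_std_normal_density] DERIV_isCont[OF g])
    have bd: "norm (std_normal_density s * g s) \<le> std_normal_density s * B" for s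
      using B(1)[of s] by (simp add: abs_mult mult_left_mono)
    have t: "((\<lambda>s. std_normal_density s * B) \<longlongrightarrow> 0) at_top" "((\<lambda>s. std_normal_density s * B) \<longlongrightarrow> 0) at_bot"
      using tendsto_mult_left_zero[OF std_normal_density_tendsto_0_at_bot, of B]
        tendsto_mult_left_zero[OF std_normal_density_tendsto_0[of 0], of B] by auto
    show "((\<lambda>s. std_normal_density s * g s) \<longlongrightarrow> 0) at_top" "((\<lambda>s. std_normal_density s * g s) \<longlongrightarrow> 0) at_bot"
      by (rule Lim_null_comparison[OF _ t(1)], simp only: bd eventually_True)
         (rule Lim_null_comparison[OF _ t(2)], simp only: bd eventually_True)
  qed
  also have "\<dots> = (\<integral>s. g' s - s * g s \<partial>std_normal_distribution)"
    by (rule integral_std_gauss[symmetric]) auto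
  finally show ?thesis using i by simp
qed

lemma gauss_field_component:
  fixes f :: "real \<Rightarrow> real"
  assumes K: "finite K" "k \<in> K" and f: "integrable std_normal_distribution f"
  shows "integrable (gauss_field K) (\<lambda>z. f (z k))"
    "(\<integral>z. f (z k) \<partial>gauss_field K) = (\<integral>s. f s \<partial>std_normal_distribution)"
proof -
  let ?g = "\<lambda>i. if i = k then f else (\<lambda>_. 1)"
  have g: "integrable std_normal_distribution (?g i)" for i using f by auto
  have eq: "(\<Prod>i\<in>K. ?g i (z i)) = f (z k)" for z
  proof -
    have "(\<Prod>i\<in>K. ?g i (z i)) = (\<Prod>i\<in>K. if i = k then f (z k) else 1)"
      by (intro prod.cong) auto
    then show ?thesis using K by (simp add: prod.delta)
  qed
  show "integrable (gauss_field K) (\<lambda>z. f (z k))"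
    using gauss_prod.product_integrable_prod[of K ?g, OF K(1) g] unfolding eq .
  have "(\<integral>z. f (z k) \<partial>gauss_field K) = (\<Prod>i\<in>K. (\<integral>s. ?g i s \<partial>std_normal_distribution))"
    using gauss_prod.product_integral_prod[of K ?g, OF K(1) g] unfolding eq .
  also have "\<dots> = (\<Prod>i\<in>K. if i = k then (\<integral>s. f s \<partial>std_normal_distribution) else 1)"
    using std_gauss.prob_space by (intro prod.cong) auto
  finally show "(\<integral>z. f (z k) \<partial>gauss_field K) = (\<integral>s. f s \<partial>std_normal_distribution)"
    using K by (simp add: prod.delta)
qed

lemma gauss_field_by_parts:
  fixes G G' :: "('i \<Rightarrow> real) \<Rightarrow> real"
  assumes K: "finite K" "k \<in> K"
    and [measurable]: "G \<in> borel_measurable (gauss_field K)" "G' \<in> borel_measurable (gauss_field K)"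
    and d: "\<And>z s. ((\<lambda>s. G (z(k := s))) has_real_derivative G' (z(k := s))) (at s)"
    and c: "\<And>z s. isCont (\<lambda>s. G' (z(k := s))) s"
    and B: "\<And>z. \<bar>G z\<bar> \<le> B" "\<And>z. \<bar>G' z\<bar> \<le> B"
  shows "integrable (gauss_field K) (\<lambda>z. z k * G z)" "integrable (gauss_field K) G'"
    "(\<integral>z. z k * G z \<partial>gauss_field K) = (\<integral>z. G' z \<partial>gauss_field K)"
proof -
  interpret P: prob_space "gauss_field K" by (rule prob_space_gauss_field)
  have [measurable]: "(\<lambda>z. z k) \<in> borel_measurable (gauss_field K)"
    using measurable_component_singleton[OF K(2), of "\<lambda>_. std_normal_distribution"] by simp
  have "integrable std_normal_distribution (\<lambda>s. \<bar>s\<bar> * B)"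
    using integrable_mult_left[OF integrable_std_normal_moment_abs[of 1], of B]
    by (subst integrable_std_gauss_iff) (auto simp: mult.assoc)
  then have wi: "integrable (gauss_field K) (\<lambda>z. \<bar>z k\<bar> * B)"
    by (rule gauss_field_component(1)[OF K])
  show i1: "integrable (gauss_field K) (\<lambda>z. z k * G z)"
  proof (rule Bochner_Integration.integrable_bound[OF wi])
    have "\<bar>z k\<bar> * \<bar>G z\<bar> \<le> \<bar>z k\<bar> * B" for z using B(1)[of z] by (intro mult_left_mono) auto
    then show "AE z in gauss_field K. norm (z k * G z) \<le> norm (\<bar>z k\<bar> * B)"
      by (intro AE_I2) (metis abs_mult abs_ge_self order_trans real_norm_def)
  qed auto
  show i2: "integrable (gauss_field K) G'"
    by (rule P.integrable_const_bound[of _ B]) (use B in auto)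
  have K': "insert k (K - {k}) = K" "finite (K - {k})" "k \<notin> K - {k}" using K by auto
  have "(\<integral>z. z k * G z \<partial>gauss_field K) = (\<integral>x. (\<integral>y. (x(k := y)) k * G (x(k := y)) \<partial>std_normal_distribution) \<partial>gauss_field (K - {k}))"
    using gauss_prod.product_integral_insert[OF K'(2,3), of "\<lambda>z. z k * G z"] i1 K'(1) by simp
  also have "\<dots> = (\<integral>x. (\<integral>y. G' (x(k := y)) \<partial>std_normal_distribution) \<partial>gauss_field (K - {k}))"
    using std_gauss_by_parts[OF d c B] by simp
  also have "\<dots> = (\<integral>z. G' z \<partial>gauss_field K)"
    using gauss_prod.product_integral_insert[OF K'(2,3), of G'] i2 K'(1) by simp
  finally show "(\<integral>z. z k * G z \<partial>gauss_field K) = (\<integral>z. G' z \<partial>gauss_field K)" .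
qed

text \<open>
  This includes indices outside \<open>K\<close>, where every point of the space takes the value \<open>undefined\<close>; so
  no index conditions arise when expressions in the entries are shown measurable.
\<close>

lemma gauss_field_entry_measurable:
  "(\<lambda>z. z k) \<in> borel_measurable (gauss_field K)"
proof (cases "k \<in> K")
  case True
  then show ?thesis using measurable_component_singleton[of k K "\<lambda>_. std_normal_distribution"] by simp
next
  case False
  then have "z k = undefined" if "z \<in> space (gauss_field K)" for z
    using that False by (intro PiE_arb[of z K "\<lambda>_. UNIV"]) (auto simp: space_PiM)
  then show ?thesis by (subst measurable_cong[where g="\<lambda>_. undefined"]) auto
qed

lemma has_real_derivative_integral:
  fixes f f' :: "real \<Rightarrow> 'a \<Rightarrow> real"
  assumes d: "\<And>t z. ((\<lambda>t. f t z) has_real_derivative f' t z) (at t)"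
    and f: "\<And>t. integrable M (f t)" and f'[measurable]: "\<And>t. f' t \<in> borel_measurable M"
    and w: "integrable M w" "\<And>t z. \<bar>f' t z\<bar> \<le> w z"
  shows "((\<lambda>t. \<integral>z. f t z \<partial>M) has_real_derivative (\<integral>z. f' t z \<partial>M)) (at t)"
  unfolding DERIV_def tendsto_at_iff_sequentially comp_def
proof (intro allI impI)
  fix h :: "nat \<Rightarrow> real" assume h: "\<forall>i. h i \<in> UNIV - {0}" "h \<longlonglongrightarrow> 0"
  have [measurable]: "f t \<in> borel_measurable M" for t using f by auto
  have "(\<lambda>i. \<integral>z. (f (t + h i) z - f t z) / h i \<partial>M) \<longlonglongrightarrow> (\<integral>z. f' t z \<partial>M)"
  proof (rule integral_dominated_convergence[OF _ _ w(1)])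
    show "AE z in M. (\<lambda>i. (f (t + h i) z - f t z) / h i) \<longlonglongrightarrow> f' t z"
      using d[of _ t] h unfolding DERIV_def tendsto_at_iff_sequentially comp_def by auto
    fix i
    show "AE z in M. norm ((f (t + h i) z - f t z) / h i) \<le> w z"
    proof (rule AE_I2)
      fix z
      have "norm (f (t + h i) z - f t z) \<le> w z * norm (t + h i - t)"
        by (rule field_differentiable_bound[of UNIV _ "\<lambda>t. f' t z"]) (use d w in auto)
      then show "norm ((f (t + h i) z - f t z) / h i) \<le> w z"
        using h(1) by (simp add: divide_simps)
    qed
  qed auto
  then show "(\<lambda>i. ((\<integral>z. f (t + h i) z \<partial>M) - (\<integral>z. f t z \<partial>M)) / h i) \<longlonglongrightarrow> (\<integral>z. f' t z \<partial>M)"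
    using f by simp
qed

section \<open>Gaussian interpolation\<close>

text \<open>
  The functions \<open>U\<close> to which the comparison applies, of \<open>m + 1\<close> real coordinates; \<open>U1 i\<close> and \<open>U2 i\<close> are
  the first and the pure second partial derivative in coordinate \<open>i\<close>.  In the interpolation, one entry of the
  Gaussian array influences one coordinate only, which is why no mixed derivatives occur.  The condition
  \<open>gordon_sign\<close> encodes the Lipschitz property: it holds if \<open>U v = \<psi> (N v + v m)\<close> with \<open>\<psi>\<close> increasing and
  \<open>N\<close> a 1-Lipschitz function of the first \<open>m\<close> coordinates.
\<close>

locale gordon_profile =
  fixes m :: nat and U :: "(nat \<Rightarrow> real) \<Rightarrow> real" and U1 U2 :: "nat \<Rightarrow> (nat \<Rightarrow> real) \<Rightarrow> real"
    and B :: real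
  assumes chain: "\<And>v v' r. (\<And>i. i \<le> m \<Longrightarrow> ((\<lambda>r. v r i) has_real_derivative v' i) (at r)) \<Longrightarrow>
      ((\<lambda>r. U (v r)) has_real_derivative (\<Sum>i\<le>m. U1 i (v r) * v' i)) (at r)"
    and second: "\<And>i w s. i \<le> m \<Longrightarrow> ((\<lambda>s. U1 i (w(i := s))) has_real_derivative U2 i (w(i := s))) (at s)"
    and second_cont: "\<And>i w s. i \<le> m \<Longrightarrow> isCont (\<lambda>s. U2 i (w(i := s))) s"
    and U_nonneg: "\<And>v. 0 \<le> U v" and U_le_1: "\<And>v. U v \<le> 1"
    and U1_bound: "\<And>i v. i \<le> m \<Longrightarrow> \<bar>U1 i v\<bar> \<le> B" and U2_bound: "\<And>i v. i \<le> m \<Longrightarrow> \<bar>U2 i v\<bar> \<le> B"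
    and gordon_sign: "\<And>v w. (\<Sum>i<m. U1 i v * U1 i w) \<le> U1 m v * U1 m w"
    and U_meas [measurable]: "U \<in> borel_measurable borel"
    and U1_meas [measurable]: "\<And>i. i \<le> m \<Longrightarrow> U1 i \<in> borel_measurable borel"
    and U2_meas [measurable]: "\<And>i. i \<le> m \<Longrightarrow> U2 i \<in> borel_measurable borel"

text \<open>
  For \<open>i < m\<close>, row \<open>i\<close> of the array is paired with the vector \<open>(cos \<theta> x, sin \<theta>)\<close> and interpolates from
  \<open>(H x) i\<close> at \<open>\<theta> = 0\<close> to \<open>a i\<close> at \<open>\<theta> = pi/2\<close>.  Row \<open>m\<close> is paired with \<open>(sin \<theta> x, cos \<theta>)\<close> and interpolates from
  \<open>g\<close> to \<open>h \<bullet> x\<close>.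
\<close>

definition interp_coeff :: "nat \<Rightarrow> nat \<Rightarrow> real \<Rightarrow> (nat \<Rightarrow> real) \<Rightarrow> nat \<Rightarrow> nat \<Rightarrow> real" where
  "interp_coeff m n \<theta> x i j =
     (if i < m then (if j < n then cos \<theta> * x j else sin \<theta>) else (if j < n then sin \<theta> * x j else cos \<theta>))"

definition interp_coeff' :: "nat \<Rightarrow> nat \<Rightarrow> real \<Rightarrow> (nat \<Rightarrow> real) \<Rightarrow> nat \<Rightarrow> nat \<Rightarrow> real" where
  "interp_coeff' m n \<theta> x i j =
     (if i < m then (if j < n then - sin \<theta> * x j else cos \<theta>) else (if j < n then cos \<theta> * x j else - sin \<theta>))"

definition interp :: "nat \<Rightarrow> nat \<Rightarrow> real \<Rightarrow> (nat \<Rightarrow> real) \<Rightarrow> (nat \<times> nat \<Rightarrow> real) \<Rightarrow> nat \<Rightarrow> real" where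
  "interp m n \<theta> x z i = (\<Sum>j\<le>n. z (i, j) * interp_coeff m n \<theta> x i j)"

lemma interp_coeff_deriv:
  "((\<lambda>\<theta>. interp_coeff m n \<theta> x i j) has_real_derivative interp_coeff' m n \<theta> x i j) (at \<theta>)"
  unfolding interp_coeff_def interp_coeff'_def by (auto intro!: derivative_eq_intros)

lemma interp_coeff_bound: "\<bar>interp_coeff m n \<theta> x i j\<bar> \<le> \<bar>x j\<bar> + 1" "\<bar>interp_coeff' m n \<theta> x i j\<bar> \<le> \<bar>x j\<bar> + 1"
proof -
  have *: "\<bar>cos \<theta>\<bar> * \<bar>x j\<bar> \<le> \<bar>x j\<bar>" "\<bar>sin \<theta>\<bar> * \<bar>x j\<bar> \<le> \<bar>x j\<bar>"
    by (auto intro: mult_left_le_one_le)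
  have **: "\<bar>cos \<theta>\<bar> \<le> \<bar>x j\<bar> + 1" "\<bar>sin \<theta>\<bar> \<le> \<bar>x j\<bar> + 1"
    using abs_cos_le_one[of \<theta>] abs_sin_le_one[of \<theta>] abs_ge_zero[of "x j"] by linarith+
  show "\<bar>interp_coeff m n \<theta> x i j\<bar> \<le> \<bar>x j\<bar> + 1" "\<bar>interp_coeff' m n \<theta> x i j\<bar> \<le> \<bar>x j\<bar> + 1"
    unfolding interp_coeff_def interp_coeff'_def using * **
    by (auto simp: abs_mult intro: order_trans)
qed

text \<open>
  Half the derivative of the covariance of coordinate \<open>i\<close> at the points \<open>x\<close> and \<open>y\<close>.  The two covariances \<open>x \<bullet> y\<close>
  and 1 are exchanged along the path, in opposite directions for \<open>i < m\<close> and \<open>i = m\<close>.  For \<open>x = y\<close> on the unit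
  sphere it vanishes.
\<close>

lemma interp_coeff_inner:
  "(\<Sum>j\<le>n. interp_coeff' m n \<theta> x i j * interp_coeff m n \<theta> y i j) =
     (if i < m then 1 else - 1) * (sin \<theta> * cos \<theta> * (1 - (\<Sum>j<n. x j * y j)))"
proof -
  have "(\<Sum>j\<le>n. interp_coeff' m n \<theta> x i j * interp_coeff m n \<theta> y i j) =
      (\<Sum>j<n. interp_coeff' m n \<theta> x i j * interp_coeff m n \<theta> y i j) + interp_coeff' m n \<theta> x i n * interp_coeff m n \<theta> y i n"
    by (simp flip: lessThan_Suc_atMost)
  also have "(\<Sum>j<n. interp_coeff' m n \<theta> x i j * interp_coeff m n \<theta> y i j)
      = (\<Sum>j<n. (if i < m then - 1 else 1) * (sin \<theta> * cos \<theta>) * (x j * y j))"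
    by (intro sum.cong) (auto simp: interp_coeff_def interp_coeff'_def)
  also have "\<dots> = (if i < m then - 1 else 1) * (sin \<theta> * cos \<theta>) * (\<Sum>j<n. x j * y j)"
    by (simp only: sum_distrib_left)
  finally show ?thesis by (simp add: interp_coeff_def interp_coeff'_def algebra_simps)
qed

lemma interp_upd:
  assumes "j \<le> n"
  shows "interp m n \<theta> x (z((i, j) := s)) =
     (interp m n \<theta> x z)(i := interp m n \<theta> x z i - z (i, j) * interp_coeff m n \<theta> x i j + s * interp_coeff m n \<theta> x i j)"
proof
  fix k
  show "interp m n \<theta> x (z((i, j) := s)) k =
     ((interp m n \<theta> x z)(i := interp m n \<theta> x z i - z (i, j) * interp_coeff m n \<theta> x i j + s * interp_coeff m n \<theta> x i j)) k"
  proof (cases "k = i")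
    case True
    have "interp m n \<theta> x y i = y (i, j) * interp_coeff m n \<theta> x i j + (\<Sum>l\<in>{..n} - {j}. y (i, l) * interp_coeff m n \<theta> x i l)" for y
      unfolding interp_def using assms by (subst sum.remove[of _ j]) auto
    from this[of z] this[of "z((i, j) := s)"] True show ?thesis
      by (auto intro!: sum.cong)
  qed (simp add: interp_def)
qed

lemma interp_measurable [measurable]:
  "interp m n \<theta> x \<in> borel_measurable (gauss_field K)"
proof (rule measurable_coordinatewise_then_product)
  fix i
  note gauss_field_entry_measurable [measurable]
  show "(\<lambda>z. interp m n \<theta> x z i) \<in> borel_measurable (gauss_field K)"
    unfolding interp_def by measurable
qed

context gordon_profile
begin

definition prodU :: "nat \<Rightarrow> (nat \<Rightarrow> real) set \<Rightarrow> real \<Rightarrow> (nat \<times> nat \<Rightarrow> real) \<Rightarrow> real" where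
  "prodU n X \<theta> z = (\<Prod>x\<in>X. U (interp m n \<theta> x z))"

definition prodU' :: "nat \<Rightarrow> (nat \<Rightarrow> real) set \<Rightarrow> real \<Rightarrow> (nat \<times> nat \<Rightarrow> real) \<Rightarrow> real" where
  "prodU' n X \<theta> z = (\<Sum>x\<in>X. (\<Sum>i\<le>m. U1 i (interp m n \<theta> x z) * (\<Sum>j\<le>n. z (i, j) * interp_coeff' m n \<theta> x i j))
      * prodU n (X - {x}) \<theta> z)"

lemma prodU_nonneg: "0 \<le> prodU n X \<theta> z" and prodU_le_1: "prodU n X \<theta> z \<le> 1"
  unfolding prodU_def by (auto intro!: prod_nonneg prod_le_1 U_nonneg U_le_1)

lemma prodU_abs_le_1: "\<bar>prodU n X \<theta> z\<bar> \<le> 1"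
  using prodU_nonneg prodU_le_1 by (simp add: abs_of_nonneg)

lemma B_nonneg: "0 \<le> B"
  using U1_bound[of 0 undefined] by linarith

lemma deriv_prodU: "((\<lambda>\<theta>. prodU n X \<theta> z) has_real_derivative prodU' n X \<theta> z) (at \<theta>)"
  unfolding prodU_def[abs_def] prodU'_def
  by (intro has_field_derivative_prod chain)
     (unfold interp_def, auto intro!: derivative_eq_intros interp_coeff_deriv simp: mult.commute)

lemma deriv_U_entry:
  assumes "i \<le> m" "j \<le> n"
  shows "((\<lambda>s. U (interp m n \<theta> x (z((i, j) := s)))) has_real_derivative
      U1 i (interp m n \<theta> x (z((i, j) := s))) * interp_coeff m n \<theta> x i j) (at s)"
proof -
  have "((\<lambda>s. U (interp m n \<theta> x (z((i, j) := s)))) has_real_derivative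
      (\<Sum>k\<le>m. U1 k (interp m n \<theta> x (z((i, j) := s))) * (if k = i then interp_coeff m n \<theta> x i j else 0))) (at s)"
    unfolding interp_upd[OF assms(2)]
    by (rule chain) (auto intro!: derivative_eq_intros)
  also have "(\<Sum>k\<le>m. U1 k (interp m n \<theta> x (z((i, j) := s))) * (if k = i then interp_coeff m n \<theta> x i j else 0))
      = U1 i (interp m n \<theta> x (z((i, j) := s))) * interp_coeff m n \<theta> x i j"
    using assms(1) by (simp add: if_distrib sum.delta cong: if_cong)
  finally show ?thesis .
qed

lemma deriv_U1_entry:
  assumes "i \<le> m" "j \<le> n"
  shows "((\<lambda>s. U1 i (interp m n \<theta> x (z((i, j) := s)))) has_real_derivative
      U2 i (interp m n \<theta> x (z((i, j) := s))) * interp_coeff m n \<theta> x i j) (at s)"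
  unfolding interp_upd[OF assms(2)]
  by (rule DERIV_chain2[where f="\<lambda>s. U1 i ((interp m n \<theta> x z)(i := s))"])
     (auto intro!: derivative_eq_intros second assms)

lemma cont_U2_entry:
  assumes "i \<le> m" "j \<le> n"
  shows "isCont (\<lambda>s. U2 i (interp m n \<theta> x (z((i, j) := s)))) s"
  unfolding interp_upd[OF assms(2)]
  by (rule isCont_o2[where g="\<lambda>s. U2 i ((interp m n \<theta> x z)(i := s))"])
     (auto intro!: continuous_intros second_cont assms)

text \<open>
  The factor of \<open>z (i, j)\<close> that the point \<open>x\<close> contributes to \<open>prodU'\<close>, up to a coefficient; Gaussian
  integration by parts in \<open>z (i, j)\<close> is applied to it and produces \<open>partialU'\<close>.
\<close>

definition partialU :: "nat \<Rightarrow> (nat \<Rightarrow> real) set \<Rightarrow> real \<Rightarrow> (nat \<Rightarrow> real) \<Rightarrow> nat \<Rightarrow> (nat \<times> nat \<Rightarrow> real) \<Rightarrow> real" where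
  "partialU n X \<theta> x i z = U1 i (interp m n \<theta> x z) * prodU n (X - {x}) \<theta> z"

definition partialU' :: "nat \<Rightarrow> (nat \<Rightarrow> real) set \<Rightarrow> real \<Rightarrow> (nat \<Rightarrow> real) \<Rightarrow> nat \<Rightarrow> nat \<Rightarrow> (nat \<times> nat \<Rightarrow> real) \<Rightarrow> real" where
  "partialU' n X \<theta> x i j z =
     U2 i (interp m n \<theta> x z) * interp_coeff m n \<theta> x i j * prodU n (X - {x}) \<theta> z
     + U1 i (interp m n \<theta> x z) *
       (\<Sum>y\<in>X - {x}. U1 i (interp m n \<theta> y z) * interp_coeff m n \<theta> y i j * prodU n (X - {x} - {y}) \<theta> z)"

lemma deriv_prodU_entry:
  assumes "i \<le> m" "j \<le> n"
  shows "((\<lambda>s. prodU n Y \<theta> (z((i, j) := s))) has_real_derivative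
     (\<Sum>y\<in>Y. U1 i (interp m n \<theta> y (z((i, j) := s))) * interp_coeff m n \<theta> y i j * prodU n (Y - {y}) \<theta> (z((i, j) := s)))) (at s)"
  unfolding prodU_def by (intro has_field_derivative_prod deriv_U_entry assms)

lemma deriv_partialU:
  assumes "i \<le> m" "j \<le> n"
  shows "((\<lambda>s. partialU n X \<theta> x i (z((i, j) := s))) has_real_derivative partialU' n X \<theta> x i j (z((i, j) := s))) (at s)"
  unfolding partialU_def partialU'_def
  by (rule DERIV_cong[OF DERIV_mult[OF deriv_U1_entry[OF assms] deriv_prodU_entry[OF assms]]])
     (simp add: mult.commute)

lemma cont_partialU':
  assumes "i \<le> m" "j \<le> n"
  shows "isCont (\<lambda>s. partialU' n X \<theta> x i j (z((i, j) := s))) s"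
  unfolding partialU'_def
  by (intro continuous_intros cont_U2_entry[OF assms] DERIV_isCont[OF deriv_U1_entry[OF assms]]
      DERIV_isCont[OF deriv_prodU_entry[OF assms]])

lemma partialU_bound:
  assumes "i \<le> m"
  shows "\<bar>partialU n X \<theta> x i z\<bar> \<le> B"
proof -
  have "\<bar>U1 i (interp m n \<theta> x z)\<bar> * \<bar>prodU n (X - {x}) \<theta> z\<bar> \<le> B * 1"
    using assms by (intro mult_mono U1_bound prodU_abs_le_1 B_nonneg) auto
  then show ?thesis by (simp add: partialU_def abs_mult)
qed

lemma partialU'_bound:
  assumes "i \<le> m"
  shows "\<bar>partialU' n X \<theta> x i j z\<bar> \<le> B * (\<bar>x j\<bar> + 1) + B * (\<Sum>y\<in>X - {x}. B * (\<bar>y j\<bar> + 1))"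
proof -
  have "\<bar>U2 i (interp m n \<theta> x z) * interp_coeff m n \<theta> x i j * prodU n (X - {x}) \<theta> z\<bar> \<le> B * (\<bar>x j\<bar> + 1) * 1"
    unfolding abs_mult using assms
    by (intro mult_mono U2_bound prodU_abs_le_1 B_nonneg interp_coeff_bound mult_nonneg_nonneg) auto
  moreover have "\<bar>\<Sum>y\<in>X - {x}. U1 i (interp m n \<theta> y z) * interp_coeff m n \<theta> y i j * prodU n (X - {x} - {y}) \<theta> z\<bar>
      \<le> (\<Sum>y\<in>X - {x}. B * (\<bar>y j\<bar> + 1) * 1)"
    unfolding abs_mult using assms
    by (intro order_trans[OF sum_abs] sum_mono, unfold abs_mult)
       (intro mult_mono U1_bound prodU_abs_le_1 B_nonneg interp_coeff_bound mult_nonneg_nonneg; simp)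
  then have "\<bar>U1 i (interp m n \<theta> x z) * (\<Sum>y\<in>X - {x}. U1 i (interp m n \<theta> y z) * interp_coeff m n \<theta> y i j * prodU n (X - {x} - {y}) \<theta> z)\<bar>
      \<le> B * (\<Sum>y\<in>X - {x}. B * (\<bar>y j\<bar> + 1) * 1)"
    unfolding abs_mult using assms by (intro mult_mono U1_bound B_nonneg) auto
  ultimately show ?thesis unfolding partialU'_def by (simp only: mult_1_right)
qed

lemma measurable_U_interp [measurable]:
  "(\<lambda>z. U (interp m n \<theta> x z)) \<in> borel_measurable (gauss_field ({..m} \<times> {..n}))"
  "i \<le> m \<Longrightarrow> (\<lambda>z. U1 i (interp m n \<theta> x z)) \<in> borel_measurable (gauss_field ({..m} \<times> {..n}))"
  "i \<le> m \<Longrightarrow> (\<lambda>z. U2 i (interp m n \<theta> x z)) \<in> borel_measurable (gauss_field ({..m} \<times> {..n}))"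
  "prodU n X \<theta> \<in> borel_measurable (gauss_field ({..m} \<times> {..n}))"
  unfolding prodU_def[abs_def]
  by (intro borel_measurable_prod measurable_compose[OF interp_measurable] U_meas U1_meas U2_meas; assumption)+

text \<open>
  The derivative in \<open>\<theta>\<close> is nonpositive.  After integration by parts its contributions from a single point \<open>x\<close>,
  among them all second derivatives of \<open>U\<close>, cancel by \<open>interp_coeff_inner\<close>.  A pair \<open>x \<noteq> y\<close> contributes \<open>1 - x \<bullet> y \<ge> 0\<close>
  times a quantity that \<open>gordon_sign\<close> makes nonpositive.
\<close>

theorem gordon_smooth:
  assumes X: "finite X" "\<And>x. x \<in> X \<Longrightarrow> (\<Sum>j<n. (x j)\<^sup>2) = 1"
  shows "(\<integral>z. prodU n X (pi/2) z \<partial>gauss_field ({..m} \<times> {..n}))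
       \<le> (\<integral>z. prodU n X 0 z \<partial>gauss_field ({..m} \<times> {..n}))"
proof -
  let ?K = "{..m} \<times> {..n}" and ?P = "gauss_field ({..m} \<times> {..n})"
  interpret P: prob_space ?P by (rule prob_space_gauss_field)
  have K: "finite ?K" by simp
  have [measurable]: "(\<lambda>z. z (i, j)) \<in> borel_measurable ?P" if "i \<le> m" "j \<le> n" for i j
    using measurable_component_singleton[of "(i, j)" ?K "\<lambda>_. std_normal_distribution"] that by simp
  let ?w = "\<lambda>z :: nat \<times> nat \<Rightarrow> real. \<Sum>x\<in>X. \<Sum>i\<le>m. \<Sum>j\<le>n. B * (\<bar>x j\<bar> + 1) * \<bar>z (i, j)\<bar>"
  have iabs: "integrable ?P (\<lambda>z. \<bar>z (i, j)\<bar>)" if "i \<le> m" "j \<le> n" for i j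
    using integrable_std_normal_moment_abs[of 1] that
    by (intro gauss_field_component(1)[of ?K "(i, j)" abs]) (auto simp: integrable_std_gauss_iff)
  have w: "integrable ?P ?w"
    by (intro Bochner_Integration.integrable_sum integrable_mult_right iabs) auto
  have bound: "\<bar>prodU' n X \<theta> z\<bar> \<le> ?w z" for \<theta> z
    unfolding prodU'_def
  proof (intro order_trans[OF sum_abs] sum_mono)
    fix x assume "x \<in> X"
    have 1: "\<bar>\<Sum>j\<le>n. z (i, j) * interp_coeff' m n \<theta> x i j\<bar> \<le> (\<Sum>j\<le>n. \<bar>z (i, j)\<bar> * (\<bar>x j\<bar> + 1))" for i
      by (intro order_trans[OF sum_abs] sum_mono) (simp add: abs_mult mult_left_mono interp_coeff_bound)
    have "\<bar>\<Sum>i\<le>m. U1 i (interp m n \<theta> x z) * (\<Sum>j\<le>n. z (i, j) * interp_coeff' m n \<theta> x i j)\<bar>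
        \<le> (\<Sum>i\<le>m. B * (\<Sum>j\<le>n. \<bar>z (i, j)\<bar> * (\<bar>x j\<bar> + 1)))"
      by (intro order_trans[OF sum_abs] sum_mono) (unfold abs_mult, intro mult_mono U1_bound 1 B_nonneg; simp)
    then have "\<bar>(\<Sum>i\<le>m. U1 i (interp m n \<theta> x z) * (\<Sum>j\<le>n. z (i, j) * interp_coeff' m n \<theta> x i j)) * prodU n (X - {x}) \<theta> z\<bar>
        \<le> (\<Sum>i\<le>m. B * (\<Sum>j\<le>n. \<bar>z (i, j)\<bar> * (\<bar>x j\<bar> + 1))) * 1"
      unfolding abs_mult by (intro mult_mono prodU_abs_le_1) (auto intro!: sum_nonneg mult_nonneg_nonneg B_nonneg)
    then show "\<bar>(\<Sum>i\<le>m. U1 i (interp m n \<theta> x z) * (\<Sum>j\<le>n. z (i, j) * interp_coeff' m n \<theta> x i j)) * prodU n (X - {x}) \<theta> z\<bar>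
        \<le> (\<Sum>i\<le>m. \<Sum>j\<le>n. B * (\<bar>x j\<bar> + 1) * \<bar>z (i, j)\<bar>)"
      by (simp add: sum_distrib_left mult_ac)
  qed
  have m': "prodU' n X \<theta> \<in> borel_measurable ?P" for \<theta>
    unfolding prodU'_def by measurable
  have "((\<lambda>\<theta>. \<integral>z. prodU n X \<theta> z \<partial>?P) has_real_derivative (\<integral>z. prodU' n X \<theta> z \<partial>?P)) (at \<theta>)" for \<theta>
    by (rule has_real_derivative_integral[OF deriv_prodU _ m' w bound])
       (rule P.integrable_const_bound[of _ 1]; simp add: prodU_abs_le_1)
  moreover have "(\<integral>z. prodU' n X \<theta> z \<partial>?P) \<le> 0" if th: "0 \<le> \<theta>" "\<theta> \<le> pi/2" for \<theta>
  proof -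
    let ?S = "sin \<theta> * cos \<theta>"
    have S: "0 \<le> ?S" using th by (intro mult_nonneg_nonneg sin_ge_zero cos_ge_zero) auto
    have IBP: "integrable ?P (\<lambda>z. z (i, j) * partialU n X \<theta> x i z)" "integrable ?P (partialU' n X \<theta> x i j)"
      "(\<integral>z. z (i, j) * partialU n X \<theta> x i z \<partial>?P) = (\<integral>z. partialU' n X \<theta> x i j z \<partial>?P)"
      if "i \<le> m" "j \<le> n" for i j x
    proof -
      let ?B = "B + (B * (\<bar>x j\<bar> + 1) + B * (\<Sum>y\<in>X - {x}. B * (\<bar>y j\<bar> + 1)))"
      have nn: "0 \<le> B * (\<bar>x j\<bar> + 1) + B * (\<Sum>y\<in>X - {x}. B * (\<bar>y j\<bar> + 1))"
        by (intro add_nonneg_nonneg mult_nonneg_nonneg B_nonneg sum_nonneg) auto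
      have b: "\<bar>partialU n X \<theta> x i z\<bar> \<le> ?B" "\<bar>partialU' n X \<theta> x i j z\<bar> \<le> ?B" for z
        using nn B_nonneg partialU_bound[OF that(1), of n X \<theta> x z] partialU'_bound[OF that(1), of n X \<theta> x j z] by linarith+
      have k: "(i, j) \<in> ?K" using that by auto
      have m1: "partialU n X \<theta> x i \<in> borel_measurable ?P" "partialU' n X \<theta> x i j \<in> borel_measurable ?P"
        unfolding partialU_def[abs_def] partialU'_def[abs_def] using that(1) by measurable
      note * = gauss_field_by_parts[OF K k m1 deriv_partialU[OF that] cont_partialU'[OF that] b]
      show "integrable ?P (\<lambda>z. z (i, j) * partialU n X \<theta> x i z)" "integrable ?P (partialU' n X \<theta> x i j)"
      "(\<integral>z. z (i, j) * partialU n X \<theta> x i z \<partial>?P) = (\<integral>z. partialU' n X \<theta> x i j z \<partial>?P)" by (fact *)+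
    qed
    have "(\<integral>z. prodU' n X \<theta> z \<partial>?P) =
        (\<integral>z. (\<Sum>x\<in>X. \<Sum>i\<le>m. \<Sum>j\<le>n. interp_coeff' m n \<theta> x i j * (z (i, j) * partialU n X \<theta> x i z)) \<partial>?P)"
      unfolding prodU'_def partialU_def
      by (intro Bochner_Integration.integral_cong) (auto simp: sum_distrib_left sum_distrib_right mult_ac)
    also have "\<dots> = (\<Sum>x\<in>X. \<Sum>i\<le>m. \<Sum>j\<le>n. interp_coeff' m n \<theta> x i j * (\<integral>z. z (i, j) * partialU n X \<theta> x i z \<partial>?P))"
      by (subst Bochner_Integration.integral_sum; (intro Bochner_Integration.integrable_sum integrable_mult_right IBP sum.cong refl; simp)?)+

    also have "\<dots> = (\<Sum>x\<in>X. \<Sum>i\<le>m. \<Sum>j\<le>n. interp_coeff' m n \<theta> x i j * (\<integral>z. partialU' n X \<theta> x i j z \<partial>?P))"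
      by (intro sum.cong refl) (simp add: IBP)
    also have "\<dots> = (\<integral>z. (\<Sum>x\<in>X. \<Sum>i\<le>m. \<Sum>j\<le>n. interp_coeff' m n \<theta> x i j * partialU' n X \<theta> x i j z) \<partial>?P)"
      by (subst Bochner_Integration.integral_sum; (intro Bochner_Integration.integrable_sum integrable_mult_right IBP sum.cong refl; simp)?)+

    also have "\<dots> \<le> (\<integral>z. 0 \<partial>?P)"
    proof (rule integral_mono)
      show "integrable ?P (\<lambda>z. \<Sum>x\<in>X. \<Sum>i\<le>m. \<Sum>j\<le>n. interp_coeff' m n \<theta> x i j * partialU' n X \<theta> x i j z)"
        by (intro Bochner_Integration.integrable_sum integrable_mult_right IBP) auto
      fix z
      show "(\<Sum>x\<in>X. \<Sum>i\<le>m. \<Sum>j\<le>n. interp_coeff' m n \<theta> x i j * partialU' n X \<theta> x i j z) \<le> 0"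
      proof (rule sum_nonpos)
        fix x assume x: "x \<in> X"
        let ?V = "\<lambda>x. interp m n \<theta> x z"
        let ?R = "\<lambda>y. prodU n (X - {x} - {y}) \<theta> z"
        let ?in = "\<lambda>y. \<Sum>j<n. x j * y j"
        let ?\<kappa> = "\<lambda>i. if i < m then 1 else - 1 :: real"
        have self: "?in x = 1" using X(2)[OF x] by (simp add: power2_eq_square)
        have row: "(\<Sum>j\<le>n. interp_coeff' m n \<theta> x i j * partialU' n X \<theta> x i j z)
            = (\<Sum>y\<in>X - {x}. ?S * (1 - ?in y) * ?R y * (?\<kappa> i * (U1 i (?V x) * U1 i (?V y))))" for i
        proof -
          have "(\<Sum>j\<le>n. interp_coeff' m n \<theta> x i j * partialU' n X \<theta> x i j z)
            = U2 i (?V x) * prodU n (X - {x}) \<theta> z * (\<Sum>j\<le>n. interp_coeff' m n \<theta> x i j * interp_coeff m n \<theta> x i j)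
             + (\<Sum>j\<le>n. \<Sum>y\<in>X - {x}. U1 i (?V x) * U1 i (?V y) * ?R y * (interp_coeff' m n \<theta> x i j * interp_coeff m n \<theta> y i j))"
            unfolding partialU'_def by (simp add: sum.distrib sum_distrib_left algebra_simps)
          also have "(\<Sum>j\<le>n. interp_coeff' m n \<theta> x i j * interp_coeff m n \<theta> x i j) = 0"
            unfolding interp_coeff_inner self by simp
          also have "(\<Sum>j\<le>n. \<Sum>y\<in>X - {x}. U1 i (?V x) * U1 i (?V y) * ?R y * (interp_coeff' m n \<theta> x i j * interp_coeff m n \<theta> y i j))
             = (\<Sum>y\<in>X - {x}. U1 i (?V x) * U1 i (?V y) * ?R y * (\<Sum>j\<le>n. interp_coeff' m n \<theta> x i j * interp_coeff m n \<theta> y i j))"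
            unfolding sum_distrib_left by (rule sum.swap)
          finally show ?thesis unfolding interp_coeff_inner by (simp add: mult_ac)
        qed
        have "(\<Sum>i\<le>m. \<Sum>j\<le>n. interp_coeff' m n \<theta> x i j * partialU' n X \<theta> x i j z)
            = (\<Sum>y\<in>X - {x}. ?S * (1 - ?in y) * ?R y * (\<Sum>i\<le>m. ?\<kappa> i * (U1 i (?V x) * U1 i (?V y))))"
          unfolding row sum_distrib_left by (rule sum.swap)
        also have "\<dots> \<le> 0"
        proof (rule sum_nonpos)
          fix y assume y: "y \<in> X - {x}"
          have "(\<Sum>i\<le>m. ?\<kappa> i * (U1 i (?V x) * U1 i (?V y))) = (\<Sum>i<m. U1 i (?V x) * U1 i (?V y)) - U1 m (?V x) * U1 m (?V y)"
            by (simp flip: lessThan_Suc_atMost)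
          then have neg: "(\<Sum>i\<le>m. ?\<kappa> i * (U1 i (?V x) * U1 i (?V y))) \<le> 0"
            using gordon_sign[of "?V x" "?V y"] by simp
          have "0 \<le> (\<Sum>j<n. (x j - y j)\<^sup>2)" by (intro sum_nonneg) auto
          also have "\<dots> = (\<Sum>j<n. (x j)\<^sup>2) + (\<Sum>j<n. (y j)\<^sup>2) - 2 * ?in y"
            by (simp add: power2_diff sum.distrib sum_subtractf sum_distrib_left mult.assoc)
          finally have "0 \<le> 1 - ?in y" using X(2) x y by simp
          then show "?S * (1 - ?in y) * ?R y * (\<Sum>i\<le>m. ?\<kappa> i * (U1 i (?V x) * U1 i (?V y))) \<le> 0"
            by (intro mult_nonneg_nonpos[OF mult_nonneg_nonneg[OF mult_nonneg_nonneg[OF S] prodU_nonneg] neg])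
        qed
        finally show "(\<Sum>i\<le>m. \<Sum>j\<le>n. interp_coeff' m n \<theta> x i j * partialU' n X \<theta> x i j z) \<le> 0" .
      qed
    qed auto
    finally show ?thesis by simp
  qed
  ultimately show ?thesis
    by (intro DERIV_nonpos_imp_nonincreasing[of 0 "pi/2" "\<lambda>\<theta>. \<integral>z. prodU n X \<theta> z \<partial>?P"]) (auto intro: exI)
qed

end

section \<open>A smooth approximation of the length of the positive part\<close>

text \<open>
  A smooth upper approximation of \<open>max 0 x\<close> with derivative between 0 and 1.
\<close>

definition soft_pos :: "real \<Rightarrow> real \<Rightarrow> real" where
  "soft_pos \<delta> x = (x + sqrt (x\<^sup>2 + \<delta>\<^sup>2)) / 2"

definition soft_pos' :: "real \<Rightarrow> real \<Rightarrow> real" where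
  "soft_pos' \<delta> x = (1 + x / sqrt (x\<^sup>2 + \<delta>\<^sup>2)) / 2"

definition soft_pos'' :: "real \<Rightarrow> real \<Rightarrow> real" where
  "soft_pos'' \<delta> x = \<delta>\<^sup>2 / (2 * (x\<^sup>2 + \<delta>\<^sup>2) * sqrt (x\<^sup>2 + \<delta>\<^sup>2))"

lemma sqrt_add_square_bounds:
  assumes "\<delta> > 0"
  shows "0 < x\<^sup>2 + \<delta>\<^sup>2" "\<bar>x\<bar> \<le> sqrt (x\<^sup>2 + \<delta>\<^sup>2)" "\<delta> \<le> sqrt (x\<^sup>2 + \<delta>\<^sup>2)" "sqrt (x\<^sup>2 + \<delta>\<^sup>2) \<le> \<bar>x\<bar> + \<delta>"
proof -
  show "0 < x\<^sup>2 + \<delta>\<^sup>2" using assms by (simp add: sum_power2_gt_zero_iff)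
  show "\<bar>x\<bar> \<le> sqrt (x\<^sup>2 + \<delta>\<^sup>2)" by (rule real_le_rsqrt) simp
  show "\<delta> \<le> sqrt (x\<^sup>2 + \<delta>\<^sup>2)" by (rule real_le_rsqrt) simp
  show "sqrt (x\<^sup>2 + \<delta>\<^sup>2) \<le> \<bar>x\<bar> + \<delta>"
    using assms by (intro real_le_lsqrt) (auto simp: power2_sum)
qed

lemma soft_pos_deriv:
  assumes "\<delta> > 0"
  shows "(soft_pos \<delta> has_real_derivative soft_pos' \<delta> x) (at x)"
    and "(soft_pos' \<delta> has_real_derivative soft_pos'' \<delta> x) (at x)"
proof -
  have q: "x\<^sup>2 + \<delta>\<^sup>2 > 0" and q0: "sqrt (x\<^sup>2 + \<delta>\<^sup>2) \<noteq> 0" using sqrt_add_square_bounds(1)[OF assms, of x] by auto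
  have r: "((\<lambda>x. sqrt (x\<^sup>2 + \<delta>\<^sup>2)) has_real_derivative x / sqrt (x\<^sup>2 + \<delta>\<^sup>2)) (at x)"
    using q by (auto intro!: derivative_eq_intros simp: field_simps)
  show "(soft_pos \<delta> has_real_derivative soft_pos' \<delta> x) (at x)"
    unfolding soft_pos_def[abs_def] soft_pos'_def
    by (rule DERIV_cdivide[OF DERIV_add[OF DERIV_ident r]])
  have "((\<lambda>x. (1 + x / sqrt (x\<^sup>2 + \<delta>\<^sup>2)) / 2) has_real_derivative
      (1 * sqrt (x\<^sup>2 + \<delta>\<^sup>2) - x * (x / sqrt (x\<^sup>2 + \<delta>\<^sup>2))) / (sqrt (x\<^sup>2 + \<delta>\<^sup>2) * sqrt (x\<^sup>2 + \<delta>\<^sup>2)) / 2) (at x)"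
    using DERIV_cdivide[OF DERIV_add[OF DERIV_const[of 1] DERIV_divide[OF DERIV_ident r q0]], of 2]
    by (simp only: add_0_left)
  also have "(1 * sqrt (x\<^sup>2 + \<delta>\<^sup>2) - x * (x / sqrt (x\<^sup>2 + \<delta>\<^sup>2))) / (sqrt (x\<^sup>2 + \<delta>\<^sup>2) * sqrt (x\<^sup>2 + \<delta>\<^sup>2)) / 2 = soft_pos'' \<delta> x"
  proof -
    define R where "R = sqrt (x\<^sup>2 + \<delta>\<^sup>2)"
    have R: "R > 0" "R * R = x\<^sup>2 + \<delta>\<^sup>2" using q by (auto simp: R_def)
    then have "R - x * (x / R) = \<delta>\<^sup>2 / R" by (simp add: field_simps power2_eq_square)
    then have "(1 * R - x * (x / R)) / (R * R) / 2 = \<delta>\<^sup>2 / (2 * (R * R) * R)" by simp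
    then show ?thesis unfolding soft_pos''_def R_def[symmetric] R(2) .
  qed
  finally show "(soft_pos' \<delta> has_real_derivative soft_pos'' \<delta> x) (at x)"
    unfolding soft_pos'_def[abs_def] .
qed

lemma soft_pos_bounds:
  assumes "\<delta> > 0"
  shows "max 0 x \<le> soft_pos \<delta> x" "soft_pos \<delta> x \<le> max 0 x + \<delta>"
    "0 \<le> soft_pos' \<delta> x" "soft_pos' \<delta> x \<le> 1" "0 \<le> soft_pos'' \<delta> x" "soft_pos'' \<delta> x \<le> 1 / \<delta>"
proof -
  define R where "R = sqrt (x\<^sup>2 + \<delta>\<^sup>2)"
  have a: "0 < x\<^sup>2 + \<delta>\<^sup>2" "\<bar>x\<bar> \<le> R" "\<delta> \<le> R" "R \<le> \<bar>x\<bar> + \<delta>"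
    using sqrt_add_square_bounds[OF assms, of x] by (simp_all only: R_def)
  have R: "R > 0" using a(3) assms by linarith
  have "soft_pos \<delta> x = (x + R) / 2" by (simp only: soft_pos_def R_def)
  then show "max 0 x \<le> soft_pos \<delta> x" "soft_pos \<delta> x \<le> max 0 x + \<delta>"
    using a(2,4) assms by (auto simp: max_def abs_if split: if_splits)
  have d1: "soft_pos' \<delta> x = (1 + x / R) / 2" by (simp only: soft_pos'_def R_def)
  have "x / R \<le> 1" "- 1 \<le> x / R"
    using a(2) R by (auto simp: pos_divide_le_eq pos_le_divide_eq)
  then show "0 \<le> soft_pos' \<delta> x" "soft_pos' \<delta> x \<le> 1" by (simp_all add: d1)
  have d2: "soft_pos'' \<delta> x = \<delta>\<^sup>2 / (2 * (x\<^sup>2 + \<delta>\<^sup>2) * R)" by (simp only: soft_pos''_def R_def)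
  have pos: "0 < 2 * (x\<^sup>2 + \<delta>\<^sup>2) * R" using a(1) R by (intro mult_pos_pos) auto
  then show "0 \<le> soft_pos'' \<delta> x" unfolding d2 by (intro divide_nonneg_pos) auto
  have "\<delta>\<^sup>2 \<le> 2 * (x\<^sup>2 + \<delta>\<^sup>2)" by (smt (verit) zero_le_power2)
  then have "\<delta>\<^sup>2 * \<delta> \<le> 2 * (x\<^sup>2 + \<delta>\<^sup>2) * R"
    using a(1,3) assms by (intro mult_mono) auto
  then have "\<delta>\<^sup>2 \<le> 2 * (x\<^sup>2 + \<delta>\<^sup>2) * R / \<delta>"
    using assms by (subst pos_le_divide_eq) auto
  then show "soft_pos'' \<delta> x \<le> 1 / \<delta>"
    unfolding d2 by (subst pos_divide_le_eq[OF pos]) simp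
qed

lemma soft_pos_measurable [measurable]:
  "soft_pos \<delta> \<in> borel_measurable borel" "soft_pos' \<delta> \<in> borel_measurable borel" "soft_pos'' \<delta> \<in> borel_measurable borel"
  unfolding soft_pos_def[abs_def] soft_pos'_def[abs_def] soft_pos''_def[abs_def] by measurable

text \<open>
  Approximates the length of the positive part of \<open>c - v\<close>.  The summand \<open>\<delta>\<^sup>2\<close> keeps the root away from 0,
  so that all derivatives are bounded.
\<close>

definition soft_norm :: "nat \<Rightarrow> real \<Rightarrow> real \<Rightarrow> (nat \<Rightarrow> real) \<Rightarrow> real" where
  "soft_norm m \<delta> c v = sqrt (\<delta>\<^sup>2 + (\<Sum>i<m. (soft_pos \<delta> (c - v i))\<^sup>2))"

definition soft_norm' :: "nat \<Rightarrow> real \<Rightarrow> real \<Rightarrow> nat \<Rightarrow> (nat \<Rightarrow> real) \<Rightarrow> real" where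
  "soft_norm' m \<delta> c i v = - (soft_pos \<delta> (c - v i) * soft_pos' \<delta> (c - v i)) / soft_norm m \<delta> c v"

definition soft_norm'' :: "nat \<Rightarrow> real \<Rightarrow> real \<Rightarrow> nat \<Rightarrow> (nat \<Rightarrow> real) \<Rightarrow> real" where
  "soft_norm'' m \<delta> c i v =
     ((soft_pos' \<delta> (c - v i))\<^sup>2 + soft_pos \<delta> (c - v i) * soft_pos'' \<delta> (c - v i)) / soft_norm m \<delta> c v
     - (soft_norm' m \<delta> c i v)\<^sup>2 / soft_norm m \<delta> c v"

context
  fixes m :: nat and \<delta> c :: real
  assumes \<delta>: "\<delta> > 0"
begin

lemma soft_norm_pos: "\<delta> \<le> soft_norm m \<delta> c v" "0 < soft_norm m \<delta> c v"
    "0 < \<delta>\<^sup>2 + (\<Sum>i<m. (soft_pos \<delta> (c - v i))\<^sup>2)"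
proof -
  have "0 \<le> (\<Sum>i<m. (soft_pos \<delta> (c - v i))\<^sup>2)" by (intro sum_nonneg) auto
  then show "\<delta> \<le> soft_norm m \<delta> c v" "0 < \<delta>\<^sup>2 + (\<Sum>i<m. (soft_pos \<delta> (c - v i))\<^sup>2)"
    unfolding soft_norm_def using \<delta> by (auto intro!: real_le_rsqrt add_pos_nonneg)
  then show "0 < soft_norm m \<delta> c v" using \<delta> by simp
qed

lemma soft_norm_sq: "(soft_norm m \<delta> c v)\<^sup>2 = \<delta>\<^sup>2 + (\<Sum>i<m. (soft_pos \<delta> (c - v i))\<^sup>2)"
  unfolding soft_norm_def by (rule real_sqrt_pow2) (rule less_imp_le[OF soft_norm_pos(3)])

lemma soft_pos_le_soft_norm:
  assumes "i < m" shows "soft_pos \<delta> (c - v i) \<le> soft_norm m \<delta> c v"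
proof -
  have "(soft_pos \<delta> (c - v i))\<^sup>2 \<le> (\<Sum>i<m. (soft_pos \<delta> (c - v i))\<^sup>2)"
    using assms by (intro member_le_sum) auto
  then show ?thesis unfolding soft_norm_def by (intro real_le_rsqrt) (auto intro: order_trans)
qed

lemma soft_norm_chain:
  assumes "\<And>i. i < m \<Longrightarrow> ((\<lambda>r. v r i) has_real_derivative v' i) (at r)"
  shows "((\<lambda>r. soft_norm m \<delta> c (v r)) has_real_derivative (\<Sum>i<m. soft_norm' m \<delta> c i (v r) * v' i)) (at r)"
proof -
  have "((\<lambda>r. \<delta>\<^sup>2 + (\<Sum>i<m. (soft_pos \<delta> (c - v r i))\<^sup>2)) has_real_derivative
      0 + (\<Sum>i<m. 2 * soft_pos \<delta> (c - v r i) * (soft_pos' \<delta> (c - v r i) * (0 - v' i)))) (at r)"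
  proof (intro DERIV_add DERIV_const DERIV_sum)
    fix i assume "i \<in> {..<m}"
    then have "((\<lambda>r. soft_pos \<delta> (c - v r i)) has_real_derivative soft_pos' \<delta> (c - v r i) * (0 - v' i)) (at r)"
      by (intro DERIV_chain2[OF soft_pos_deriv(1)[OF \<delta>]] DERIV_diff DERIV_const assms) auto
    from DERIV_power[OF this, of 2]
    show "((\<lambda>r. (soft_pos \<delta> (c - v r i))\<^sup>2) has_real_derivative 2 * soft_pos \<delta> (c - v r i) * (soft_pos' \<delta> (c - v r i) * (0 - v' i))) (at r)"
      by (simp add: algebra_simps)
  qed
  from DERIV_chain2[OF DERIV_real_sqrt[OF soft_norm_pos(3)] this]
  have "((\<lambda>r. soft_norm m \<delta> c (v r)) has_real_derivative inverse (soft_norm m \<delta> c (v r)) / 2 *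
     (0 + (\<Sum>i<m. 2 * soft_pos \<delta> (c - v r i) * (soft_pos' \<delta> (c - v r i) * (0 - v' i))))) (at r)"
    unfolding soft_norm_def .
  moreover have t: "inverse N / 2 * (2 * a * (b * (0 - w))) = - (a * b) / N * w" for N a b w :: real
    by (cases "N = 0") (simp_all add: field_simps)
  have "inverse (soft_norm m \<delta> c (v r)) / 2 *
     (0 + (\<Sum>i<m. 2 * soft_pos \<delta> (c - v r i) * (soft_pos' \<delta> (c - v r i) * (0 - v' i))))
     = (\<Sum>i<m. soft_norm' m \<delta> c i (v r) * v' i)"
    unfolding soft_norm'_def add_0_left sum_distrib_left
    by (intro sum.cong refl t)
  ultimately show ?thesis by (simp only:)
qed

lemma soft_norm_entry:
  "((\<lambda>s. soft_norm m \<delta> c (w(i := s))) has_real_derivative (if i < m then soft_norm' m \<delta> c i (w(i := s)) else 0)) (at s)"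
proof -
  have "((\<lambda>s. soft_norm m \<delta> c (w(i := s))) has_real_derivative
      (\<Sum>k<m. soft_norm' m \<delta> c k (w(i := s)) * (if k = i then 1 else 0))) (at s)"
    by (rule soft_norm_chain) auto
  then show ?thesis by (auto simp: if_distrib cong: if_cong)
qed

lemma soft_norm'_entry:
  assumes "i < m"
  shows "((\<lambda>s. soft_norm' m \<delta> c i (w(i := s))) has_real_derivative soft_norm'' m \<delta> c i (w(i := s))) (at s)"
proof -
  let ?N = "\<lambda>s. soft_norm m \<delta> c (w(i := s))" and ?p = "soft_pos \<delta> (c - s)" and ?p' = "soft_pos' \<delta> (c - s)" and ?p'' = "soft_pos'' \<delta> (c - s)"
  have N: "(?N has_real_derivative soft_norm' m \<delta> c i (w(i := s))) (at s)" using soft_norm_entry[of w i s] assms by simp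
  have d: "((\<lambda>s. c - s) has_real_derivative -1) (at s)" by (auto intro!: derivative_eq_intros)
  have "((\<lambda>s. - (soft_pos \<delta> (c - s) * soft_pos' \<delta> (c - s))) has_real_derivative - (?p' * -1 * ?p' + ?p'' * -1 * ?p)) (at s)"
    by (intro DERIV_minus DERIV_mult DERIV_chain2[OF soft_pos_deriv(1)[OF \<delta>] d] DERIV_chain2[OF soft_pos_deriv(2)[OF \<delta>] d])
  from DERIV_divide[OF this N] soft_norm_pos(2)[of "w(i := s)"]
  have "((\<lambda>s. - (soft_pos \<delta> (c - s) * soft_pos' \<delta> (c - s)) / ?N s) has_real_derivative
     ((- (?p' * -1 * ?p' + ?p'' * -1 * ?p)) * ?N s - - (?p * ?p') * soft_norm' m \<delta> c i (w(i := s))) / (?N s * ?N s)) (at s)"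
    by simp
  moreover have "((- (?p' * -1 * ?p' + ?p'' * -1 * ?p)) * ?N s - - (?p * ?p') * soft_norm' m \<delta> c i (w(i := s))) / (?N s * ?N s)
     = soft_norm'' m \<delta> c i (w(i := s))"
    using soft_norm_pos(2)[of "w(i := s)"]
    unfolding soft_norm''_def soft_norm'_def by (simp add: field_simps power2_eq_square)
  ultimately show ?thesis unfolding soft_norm'_def[abs_def] by simp
qed

lemma soft_norm''_cont:
  assumes "i < m"
  shows "isCont (\<lambda>s. soft_norm'' m \<delta> c i (w(i := s))) s"
proof -
  have c1: "isCont (\<lambda>s. soft_pos \<delta> (c - s)) s" "isCont (\<lambda>s. soft_pos' \<delta> (c - s)) s"
    by (rule isCont_o2[OF _ DERIV_isCont[OF soft_pos_deriv(1)[OF \<delta>]]], simp)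
       (rule isCont_o2[OF _ DERIV_isCont[OF soft_pos_deriv(2)[OF \<delta>]]], simp)
  have c2: "isCont (\<lambda>s. soft_pos'' \<delta> (c - s)) s"
    unfolding soft_pos''_def using sqrt_add_square_bounds(1)[OF \<delta>, of "c - s"] by (intro continuous_intros) auto
  show ?thesis unfolding soft_norm''_def fun_upd_same
    by (intro continuous_intros c1 c2 DERIV_isCont[OF soft_norm_entry] DERIV_isCont[OF soft_norm'_entry] assms)
       (use soft_norm_pos(2)[of "w(i := s)"] in auto)
qed

lemma soft_norm'_bound:
  assumes "i < m" shows "\<bar>soft_norm' m \<delta> c i v\<bar> \<le> 1"
proof -
  have "soft_pos \<delta> (c - v i) * soft_pos' \<delta> (c - v i) \<le> soft_norm m \<delta> c v * 1"
    using soft_pos_bounds[OF \<delta>, of "c - v i"] soft_pos_le_soft_norm[OF assms] soft_norm_pos(2)[of v] by (intro mult_mono) auto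
  moreover have "0 \<le> soft_pos \<delta> (c - v i) * soft_pos' \<delta> (c - v i)"
    using soft_pos_bounds[OF \<delta>, of "c - v i"] by (intro mult_nonneg_nonneg) auto
  ultimately show ?thesis
    using soft_norm_pos(2)[of v] by (simp add: soft_norm'_def abs_div_pos)
qed

lemma soft_norm''_bound:
  assumes "i < m" shows "\<bar>soft_norm'' m \<delta> c i v\<bar> \<le> 3 / \<delta>"
proof -
  let ?x = "c - v i" and ?N = "soft_norm m \<delta> c v"
  note b = soft_pos_bounds[OF \<delta>, of ?x] and N = soft_norm_pos[of v] and l = soft_pos_le_soft_norm[OF assms, of v]
  have "(soft_pos' \<delta> ?x)\<^sup>2 / ?N \<le> 1 / \<delta>"
    using b N \<delta> by (intro frac_le) (auto simp: power_le_one)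
  moreover have "soft_pos \<delta> ?x * soft_pos'' \<delta> ?x / ?N \<le> 1 / \<delta>"
  proof -
    have "soft_pos \<delta> ?x * soft_pos'' \<delta> ?x \<le> ?N * (1 / \<delta>)" using b l N by (intro mult_mono) auto
    then show ?thesis using N(2) by (simp add: divide_le_eq mult.commute)
  qed
  moreover have "(soft_norm' m \<delta> c i v)\<^sup>2 / ?N \<le> 1 / \<delta>"
    using soft_norm'_bound[OF assms, of v] N \<delta> by (intro frac_le) (auto simp: abs_square_le_1)
  moreover have "0 \<le> (soft_pos' \<delta> ?x)\<^sup>2 / ?N" "0 \<le> soft_pos \<delta> ?x * soft_pos'' \<delta> ?x / ?N" "0 \<le> (soft_norm' m \<delta> c i v)\<^sup>2 / ?N"
    using b N by auto
  ultimately show ?thesis unfolding soft_norm''_def add_divide_distrib by (simp add: abs_le_iff)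
qed

text \<open>
  The gradient has norm at most 1 since \<open>soft_pos\<close> and the Euclidean norm are 1-Lipschitz.
\<close>

lemma soft_norm'_sum_sq: "(\<Sum>i<m. (soft_norm' m \<delta> c i v)\<^sup>2) \<le> 1"
proof -
  have "(\<Sum>i<m. (soft_norm' m \<delta> c i v)\<^sup>2) \<le> (\<Sum>i<m. (soft_pos \<delta> (c - v i))\<^sup>2 / (soft_norm m \<delta> c v)\<^sup>2)"
  proof (rule sum_mono)
    fix i
    have "(soft_pos \<delta> (c - v i) * soft_pos' \<delta> (c - v i))\<^sup>2 \<le> (soft_pos \<delta> (c - v i))\<^sup>2 * 1"
      unfolding power_mult_distrib using soft_pos_bounds[OF \<delta>, of "c - v i"] by (intro mult_left_mono) (auto simp: power_le_one)
    then show "(soft_norm' m \<delta> c i v)\<^sup>2 \<le> (soft_pos \<delta> (c - v i))\<^sup>2 / (soft_norm m \<delta> c v)\<^sup>2"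
      unfolding soft_norm'_def power_divide by (intro divide_right_mono) auto
  qed
  also have "\<dots> = (\<Sum>i<m. (soft_pos \<delta> (c - v i))\<^sup>2) / (soft_norm m \<delta> c v)\<^sup>2" by (simp add: sum_divide_distrib)
  also have "\<dots> \<le> 1" using soft_norm_pos(3)[of v] unfolding soft_norm_sq by simp
  finally show ?thesis .
qed

lemma soft_norm'_inner: "(\<Sum>i<m. soft_norm' m \<delta> c i v * soft_norm' m \<delta> c i w) \<le> 1"
proof -
  have "(\<Sum>i<m. soft_norm' m \<delta> c i v * soft_norm' m \<delta> c i w)
      \<le> (\<Sum>i<m. ((soft_norm' m \<delta> c i v)\<^sup>2 + (soft_norm' m \<delta> c i w)\<^sup>2) / 2)"
  proof (rule sum_mono)
    fix i
    have "0 \<le> (soft_norm' m \<delta> c i v - soft_norm' m \<delta> c i w)\<^sup>2" by simp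
    then show "soft_norm' m \<delta> c i v * soft_norm' m \<delta> c i w \<le> ((soft_norm' m \<delta> c i v)\<^sup>2 + (soft_norm' m \<delta> c i w)\<^sup>2) / 2"
      by (simp add: power2_diff)
  qed
  also have "\<dots> = ((\<Sum>i<m. (soft_norm' m \<delta> c i v)\<^sup>2) + (\<Sum>i<m. (soft_norm' m \<delta> c i w)\<^sup>2)) / 2"
    by (simp add: sum.distrib flip: sum_divide_distrib)
  also have "\<dots> \<le> 1" using soft_norm'_sum_sq[of v] soft_norm'_sum_sq[of w] by simp
  finally show ?thesis .
qed

lemma soft_norm_approx:
  shows "sqrt (\<Sum>i<m. (max 0 (c - v i))\<^sup>2) \<le> soft_norm m \<delta> c v"
    and "soft_norm m \<delta> c v \<le> sqrt (\<Sum>i<m. (max 0 (c - v i))\<^sup>2) + \<delta> * (1 + real m)"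
proof -
  have "(max 0 (c - v i))\<^sup>2 \<le> (soft_pos \<delta> (c - v i))\<^sup>2" for i
    using soft_pos_bounds(1)[OF \<delta>, of "c - v i"] by (intro power_mono) auto
  then have "(\<Sum>i<m. (max 0 (c - v i))\<^sup>2) \<le> (\<Sum>i<m. (soft_pos \<delta> (c - v i))\<^sup>2)" by (rule sum_mono)
  then show "sqrt (\<Sum>i<m. (max 0 (c - v i))\<^sup>2) \<le> soft_norm m \<delta> c v"
    unfolding soft_norm_def by (intro real_sqrt_le_mono) (auto intro: order_trans)
  have "soft_norm m \<delta> c v \<le> \<delta> + L2_set (\<lambda>i. soft_pos \<delta> (c - v i)) {..<m}"
    unfolding soft_norm_def L2_set_def
    using \<delta> sqrt_add_le_add_sqrt[of "\<delta>\<^sup>2" "\<Sum>i<m. (soft_pos \<delta> (c - v i))\<^sup>2"] by (simp add: sum_nonneg)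
  also have "L2_set (\<lambda>i. soft_pos \<delta> (c - v i)) {..<m} \<le> L2_set (\<lambda>i. max 0 (c - v i) + \<delta>) {..<m}"
  proof (rule L2_set_mono)
    show "0 \<le> soft_pos \<delta> (c - v i)" for i using soft_pos_bounds(1)[OF \<delta>, of "c - v i"] by simp
  qed (rule soft_pos_bounds(2)[OF \<delta>])
  also have "\<dots> \<le> L2_set (\<lambda>i. max 0 (c - v i)) {..<m} + L2_set (\<lambda>i. \<delta>) {..<m}"
    by (rule L2_set_triangle_ineq)
  also have "L2_set (\<lambda>i. \<delta>) {..<m} \<le> (\<Sum>i<m. \<delta>)"
    using \<delta> by (intro L2_set_le_sum) auto
  finally show "soft_norm m \<delta> c v \<le> sqrt (\<Sum>i<m. (max 0 (c - v i))\<^sup>2) + \<delta> * (1 + real m)"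
    by (simp add: L2_set_def algebra_simps)
qed

end

lemma soft_norm_measurable [measurable]:
  "soft_norm m \<delta> c \<in> borel_measurable borel" "soft_norm' m \<delta> c i \<in> borel_measurable borel"
  "soft_norm'' m \<delta> c i \<in> borel_measurable borel"
  unfolding soft_norm_def[abs_def] soft_norm'_def[abs_def] soft_norm''_def[abs_def]
  by measurable

text \<open>
  A smooth increasing step function; \<open>soft_step (p * u)\<close> tends to the indicator of \<open>u > 0\<close> as \<open>p\<close> grows,
  except at \<open>u = 0\<close>.
\<close>

definition soft_step :: "real \<Rightarrow> real" where
  "soft_step u = 1 / 2 + arctan u / pi"

lemma soft_step_deriv: "(soft_step has_real_derivative 1 / (pi * (1 + u\<^sup>2))) (at u)"
  unfolding soft_step_def[abs_def]
  by (rule DERIV_cong[OF DERIV_add[OF DERIV_const DERIV_cdivide[OF DERIV_arctan]]])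
     (simp add: inverse_eq_divide)

lemma soft_step_deriv2: "((\<lambda>u. 1 / (pi * (1 + u\<^sup>2))) has_real_derivative - (2 * u) / (pi * (1 + u\<^sup>2)\<^sup>2)) (at u)"
proof -
  have q: "1 + u\<^sup>2 \<noteq> 0" using zero_le_power2[of u] by linarith
  have d: "((\<lambda>u. pi * (1 + u\<^sup>2)) has_real_derivative pi * (2 * u)) (at u)"
    by (auto intro!: derivative_eq_intros)
  have "(0 * (pi * (1 + u\<^sup>2)) - 1 * (pi * (2 * u))) / (pi * (1 + u\<^sup>2) * (pi * (1 + u\<^sup>2))) = - (2 * u) / (pi * (1 + u\<^sup>2)\<^sup>2)"
    by (simp add: power2_eq_square[of "1 + u\<^sup>2"])
  from DERIV_cong[OF DERIV_divide[OF DERIV_const d] this] show ?thesis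
    using q by simp
qed

lemma soft_step_bounds:
  "0 \<le> soft_step u" "soft_step u \<le> 1" "0 \<le> 1 / (pi * (1 + u\<^sup>2))" "1 / (pi * (1 + u\<^sup>2)) \<le> 1"
  "\<bar>- (2 * u) / (pi * (1 + u\<^sup>2)\<^sup>2)\<bar> \<le> 1"
proof -
  have "- (1 / 2) \<le> arctan u / pi" "arctan u / pi \<le> 1 / 2"
    using arctan_bounded[of u] by (auto simp: pos_divide_le_eq pos_le_divide_eq)
  then have "0 \<le> 1 / 2 + arctan u / pi" "1 / 2 + arctan u / pi \<le> 1" by linarith+
  then show "0 \<le> soft_step u" "soft_step u \<le> 1" unfolding soft_step_def .
  have q: "1 \<le> 1 + u\<^sup>2" by simp
  have "1 \<le> pi" using pi_ge_two by linarith
  then have p: "1 * 1 \<le> pi * (1 + u\<^sup>2)" using q by (intro mult_mono) auto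
  then show "0 \<le> 1 / (pi * (1 + u\<^sup>2))" "1 / (pi * (1 + u\<^sup>2)) \<le> 1"
    by (auto simp: divide_le_eq)
  have "0 \<le> (\<bar>u\<bar> - 1)\<^sup>2" by simp
  then have "2 * \<bar>u\<bar> \<le> 1 * (1 + u\<^sup>2)" by (simp add: power2_diff)
  also have "\<dots> \<le> pi * (1 + u\<^sup>2) * (1 + u\<^sup>2)" using p q by (intro mult_right_mono) auto
  finally show "\<bar>- (2 * u) / (pi * (1 + u\<^sup>2)\<^sup>2)\<bar> \<le> 1"
    by (simp add: abs_mult power2_eq_square divide_le_eq mult.assoc)
qed

text \<open>
  For large \<open>p\<close> and small \<open>\<delta>\<close> this is close to the indicator of the event that the length of the positive part of \<open>c - v\<close>,
  plus the last coordinate, exceeds \<open>t\<close>.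
\<close>

definition soft_event :: "nat \<Rightarrow> real \<Rightarrow> real \<Rightarrow> real \<Rightarrow> real \<Rightarrow> (nat \<Rightarrow> real) \<Rightarrow> real" where
  "soft_event m \<delta> c p t v = soft_step (p * (soft_norm m \<delta> c v + v m - t))"

text \<open>
  The sign condition is \<open>soft_norm'_inner\<close>: all first derivatives carry the same nonnegative factor, and
  the derivative in the last coordinate is that factor alone.
\<close>

lemma gordon_profile_soft_event:
  fixes m :: nat and \<delta> c p t :: real
  assumes \<delta>: "\<delta> > 0" and p: "p > 0"
  defines "L \<equiv> \<lambda>v. p * (soft_norm m \<delta> c v + v m - t)"
    and "D \<equiv> \<lambda>i v. if i < m then soft_norm' m \<delta> c i v else 1"
  shows "gordon_profile m (soft_event m \<delta> c p t)
     (\<lambda>i v. 1 / (pi * (1 + (L v)\<^sup>2)) * (p * D i v))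
     (\<lambda>i v. - (2 * L v) / (pi * (1 + (L v)\<^sup>2)\<^sup>2) * (p * D i v) * (p * D i v)
        + 1 / (pi * (1 + (L v)\<^sup>2)) * (p * (if i < m then soft_norm'' m \<delta> c i v else 0)))
     (p * p + p * (1 + 3 / \<delta>))"
proof
  have D_bound: "\<bar>D i v\<bar> \<le> 1" for i v using soft_norm'_bound[OF \<delta>, of i m c v] by (auto simp: D_def)
  have L_meas [measurable]: "L \<in> borel_measurable borel" unfolding L_def by measurable
  have D_meas [measurable]: "D i \<in> borel_measurable borel" for i unfolding D_def by measurable
  have D_entry: "((\<lambda>s. D i (w(i := s))) has_real_derivative (if i < m then soft_norm'' m \<delta> c i (w(i := s)) else 0)) (at s)" for i w s
    using soft_norm'_entry[OF \<delta>, of i m c w s] by (auto simp: D_def)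
  have L_entry: "((\<lambda>s. L (w(i := s))) has_real_derivative p * D i (w(i := s))) (at s)" if "i \<le> m" for i w s
  proof (cases "i = m")
    case True
    then show ?thesis using soft_norm_entry[OF \<delta>, of m c w i s]
      unfolding L_def D_def by (auto intro!: derivative_eq_intros)
  next
    case False
    then show ?thesis using soft_norm_entry[OF \<delta>, of m c w i s] that
      unfolding L_def D_def by (auto intro!: derivative_eq_intros)
  qed
  show "((\<lambda>r. soft_event m \<delta> c p t (v r)) has_real_derivative (\<Sum>i\<le>m. 1 / (pi * (1 + (L (v r))\<^sup>2)) * (p * D i (v r)) * v' i)) (at r)"
    if "\<And>i. i \<le> m \<Longrightarrow> ((\<lambda>r. v r i) has_real_derivative v' i) (at r)" for v v' r
  proof -
    have "((\<lambda>r. L (v r)) has_real_derivative p * ((\<Sum>i<m. soft_norm' m \<delta> c i (v r) * v' i) + v' m - 0)) (at r)"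
      unfolding L_def by (intro DERIV_cmult DERIV_diff DERIV_add DERIV_const soft_norm_chain[OF \<delta>] that) auto
    from DERIV_chain2[OF soft_step_deriv this]
    have "((\<lambda>r. soft_event m \<delta> c p t (v r)) has_real_derivative
       1 / (pi * (1 + (L (v r))\<^sup>2)) * (p * ((\<Sum>i<m. soft_norm' m \<delta> c i (v r) * v' i) + v' m - 0))) (at r)"
      unfolding soft_event_def L_def .
    also have "(\<Sum>i<m. soft_norm' m \<delta> c i (v r) * v' i) + v' m - 0 = (\<Sum>i\<le>m. D i (v r) * v' i)"
      by (simp add: D_def flip: lessThan_Suc_atMost)
    finally show ?thesis by (simp add: sum_distrib_left mult.assoc)
  qed
  show "((\<lambda>s. 1 / (pi * (1 + (L (w(i := s)))\<^sup>2)) * (p * D i (w(i := s)))) has_real_derivative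
      - (2 * L (w(i := s))) / (pi * (1 + (L (w(i := s)))\<^sup>2)\<^sup>2) * (p * D i (w(i := s))) * (p * D i (w(i := s)))
        + 1 / (pi * (1 + (L (w(i := s)))\<^sup>2)) * (p * (if i < m then soft_norm'' m \<delta> c i (w(i := s)) else 0))) (at s)"
    if "i \<le> m" for i w s
    by (rule DERIV_cong[OF DERIV_mult[OF DERIV_chain2[OF soft_step_deriv2 L_entry[OF that]] DERIV_cmult[OF D_entry]]])
       (simp add: algebra_simps)
  show "isCont (\<lambda>s. - (2 * L (w(i := s))) / (pi * (1 + (L (w(i := s)))\<^sup>2)\<^sup>2) * (p * D i (w(i := s))) * (p * D i (w(i := s)))
        + 1 / (pi * (1 + (L (w(i := s)))\<^sup>2)) * (p * (if i < m then soft_norm'' m \<delta> c i (w(i := s)) else 0))) s"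
    if "i \<le> m" for i w s
  proof -
    have "isCont (\<lambda>s. if i < m then soft_norm'' m \<delta> c i (w(i := s)) else 0) s"
      using soft_norm''_cont[OF \<delta>, of i m s c w] by (cases "i < m") auto
    moreover have "1 + (L (w(i := s)))\<^sup>2 \<noteq> 0" using zero_le_power2[of "L (w(i := s))"] by linarith
    ultimately show ?thesis
      by (intro continuous_intros DERIV_isCont[OF L_entry[OF that]] DERIV_isCont[OF D_entry]) auto
  qed
  show "0 \<le> soft_event m \<delta> c p t v" "soft_event m \<delta> c p t v \<le> 1" for v
    unfolding soft_event_def by (rule soft_step_bounds)+
  have P1: "\<bar>p * D i v\<bar> \<le> p" for i v using D_bound[of i v] p by (simp add: abs_mult)
  have pd: "0 \<le> p * (3 / \<delta>)" "0 \<le> p * p" using p \<delta> by auto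
  show "\<bar>1 / (pi * (1 + (L v)\<^sup>2)) * (p * D i v)\<bar> \<le> p * p + p * (1 + 3 / \<delta>)" for i v
  proof -
    have "\<bar>1 / (pi * (1 + (L v)\<^sup>2))\<bar> * \<bar>p * D i v\<bar> \<le> 1 * p"
      using soft_step_bounds(3,4)[of "L v"] P1[of i v] p by (intro mult_mono) auto
    then show ?thesis using pd by (simp only: abs_mult distrib_left)
  qed
  show "\<bar>- (2 * L v) / (pi * (1 + (L v)\<^sup>2)\<^sup>2) * (p * D i v) * (p * D i v)
        + 1 / (pi * (1 + (L v)\<^sup>2)) * (p * (if i < m then soft_norm'' m \<delta> c i v else 0))\<bar> \<le> p * p + p * (1 + 3 / \<delta>)" for i v
  proof -
    have "\<bar>- (2 * L v) / (pi * (1 + (L v)\<^sup>2)\<^sup>2)\<bar> * \<bar>p * D i v\<bar> * \<bar>p * D i v\<bar> \<le> 1 * p * p"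
      using soft_step_bounds(5)[of "L v"] P1[of i v] p by (intro mult_mono) auto
    then have a: "\<bar>- (2 * L v) / (pi * (1 + (L v)\<^sup>2)\<^sup>2) * (p * D i v) * (p * D i v)\<bar> \<le> p * p"
      by (simp only: abs_mult mult_1_left)
    have "\<bar>if i < m then soft_norm'' m \<delta> c i v else 0\<bar> \<le> 3 / \<delta>"
      using soft_norm''_bound[OF \<delta>, of i m c v] \<delta> by auto
    then have "\<bar>p * (if i < m then soft_norm'' m \<delta> c i v else 0)\<bar> \<le> p * (3 / \<delta>)"
      unfolding abs_mult abs_of_pos[OF p] using p by (intro mult_left_mono) auto
    then have "\<bar>1 / (pi * (1 + (L v)\<^sup>2))\<bar> * \<bar>p * (if i < m then soft_norm'' m \<delta> c i v else 0)\<bar> \<le> 1 * (p * (3 / \<delta>))"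
      using soft_step_bounds(3,4)[of "L v"] by (intro mult_mono) auto
    then have b: "\<bar>1 / (pi * (1 + (L v)\<^sup>2)) * (p * (if i < m then soft_norm'' m \<delta> c i v else 0))\<bar> \<le> p * (3 / \<delta>)"
      by (simp only: abs_mult mult_1_left)
    have "p * p + p * (3 / \<delta>) \<le> p * p + p * (1 + 3 / \<delta>)" using p by (simp add: distrib_left)
    then show ?thesis by (rule order_trans[OF order_trans[OF abs_triangle_ineq add_mono[OF a b]]])
  qed
  show "(\<Sum>i<m. 1 / (pi * (1 + (L v)\<^sup>2)) * (p * D i v) * (1 / (pi * (1 + (L w)\<^sup>2)) * (p * D i w)))
      \<le> 1 / (pi * (1 + (L v)\<^sup>2)) * (p * D m v) * (1 / (pi * (1 + (L w)\<^sup>2)) * (p * D m w))" for v w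
  proof -
    let ?a = "1 / (pi * (1 + (L v)\<^sup>2)) * p * (1 / (pi * (1 + (L w)\<^sup>2)) * p)"
    have a: "0 \<le> ?a" using soft_step_bounds(3)[of "L v"] soft_step_bounds(3)[of "L w"] p
      by (intro mult_nonneg_nonneg) auto
    have "(\<Sum>i<m. 1 / (pi * (1 + (L v)\<^sup>2)) * (p * D i v) * (1 / (pi * (1 + (L w)\<^sup>2)) * (p * D i w)))
        = (\<Sum>i<m. ?a * (soft_norm' m \<delta> c i v * soft_norm' m \<delta> c i w))"
      by (intro sum.cong) (auto simp: D_def)
    also have "\<dots> = ?a * (\<Sum>i<m. soft_norm' m \<delta> c i v * soft_norm' m \<delta> c i w)" by (rule sum_distrib_left[symmetric])
    also have "\<dots> \<le> ?a * 1" by (rule mult_left_mono[OF soft_norm'_inner[OF \<delta>] a])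
    also have "\<dots> = 1 / (pi * (1 + (L v)\<^sup>2)) * (p * D m v) * (1 / (pi * (1 + (L w)\<^sup>2)) * (p * D m w))"
      by (simp add: D_def)
    finally show ?thesis .
  qed
  show "soft_event m \<delta> c p t \<in> borel_measurable borel"
    unfolding soft_event_def[abs_def] soft_step_def by measurable
  show "(\<lambda>v. 1 / (pi * (1 + (L v)\<^sup>2)) * (p * D i v)) \<in> borel_measurable borel" for i by measurable
  show "(\<lambda>v. - (2 * L v) / (pi * (1 + (L v)\<^sup>2)\<^sup>2) * (p * D i v) * (p * D i v)
        + 1 / (pi * (1 + (L v)\<^sup>2)) * (p * (if i < m then soft_norm'' m \<delta> c i v else 0))) \<in> borel_measurable borel" for i
    by measurable
qed

section \<open>Gordon comparison of probabilities\<close>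

lemma soft_step_mono: "u \<le> w \<Longrightarrow> soft_step u \<le> soft_step w"
  unfolding soft_step_def by (simp add: arctan_le_iff divide_right_mono)

lemma soft_step_limits:
  assumes "a > 0"
  shows "((\<lambda>p. soft_step (p * a)) \<longlongrightarrow> 1) at_top" "((\<lambda>p. soft_step (p * (- a))) \<longlongrightarrow> 0) at_top"
proof -
  have f: "filterlim (\<lambda>p::real. p * a) at_top at_top"
    using assms filterlim_tendsto_pos_mult_at_top[OF tendsto_const assms filterlim_ident] by (simp add: mult.commute)
  have "((\<lambda>p. 1 / 2 + arctan (p * a) / pi) \<longlongrightarrow> 1 / 2 + (pi / 2) / pi) at_top"
    by (intro tendsto_intros filterlim_compose[OF tendsto_arctan_at_top f]) simp
  then show "((\<lambda>p. soft_step (p * a)) \<longlongrightarrow> 1) at_top" by (simp add: soft_step_def)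
  have "((\<lambda>p. 1 / 2 - arctan (p * a) / pi) \<longlongrightarrow> 1 / 2 - (pi / 2) / pi) at_top"
    by (intro tendsto_intros filterlim_compose[OF tendsto_arctan_at_top f]) simp
  then show "((\<lambda>p. soft_step (p * (- a))) \<longlongrightarrow> 0) at_top" by (simp add: soft_step_def arctan_minus)
qed

lemma interp_0:
  "i < m \<Longrightarrow> interp m n 0 x z i = (\<Sum>j<n. z (i, j) * x j)" "interp m n 0 x z m = z (m, n)"
  unfolding interp_def interp_coeff_def by (simp_all flip: lessThan_Suc_atMost)

lemma interp_pi_half:
  "i < m \<Longrightarrow> interp m n (pi/2) x z i = z (i, n)" "interp m n (pi/2) x z m = (\<Sum>j<n. z (m, j) * x j)"
  unfolding interp_def interp_coeff_def by (simp_all flip: lessThan_Suc_atMost)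

lemma soft_norm_cong:
  assumes "\<And>i. i < m \<Longrightarrow> v i = w i" shows "soft_norm m \<delta> c v = soft_norm m \<delta> c w"
  unfolding soft_norm_def using assms by (auto intro!: sum.cong arg_cong[of _ _ sqrt])

abbreviation pos_part_norm :: "nat \<Rightarrow> real \<Rightarrow> (nat \<Rightarrow> real) \<Rightarrow> real" where
  "pos_part_norm m c v \<equiv> sqrt (\<Sum>i<m. (max 0 (c - v i))\<^sup>2)"

text \<open>
  The margin \<open>\<zeta>\<close> separates the two events, so that a step function placed halfway between the levels is
  nearly 1 on \<open>G\<close> and nearly 0 where the event on the right fails; letting the steepness \<open>p\<close> grow while \<open>X\<close> is kept
  fixed removes the smoothing.  The event \<open>G\<close> stands for any sufficient condition at the end \<open>(a, h \<bullet> x)\<close>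
  of the path.
\<close>

theorem gordon_finite:
  fixes m n :: nat and X :: "(nat \<Rightarrow> real) set" and c t \<zeta> :: real
  assumes X: "finite X" "\<And>x. x \<in> X \<Longrightarrow> (\<Sum>j<n. (x j)\<^sup>2) = 1" and \<zeta>: "\<zeta> > 0"
    and G: "G \<in> sets (gauss_field ({..m} \<times> {..n}))"
      "\<And>z x. z \<in> G \<Longrightarrow> x \<in> X \<Longrightarrow> t \<le> pos_part_norm m c (\<lambda>i. z (i, n)) + (\<Sum>j<n. z (m, j) * x j)"
  shows "measure (gauss_field ({..m} \<times> {..n})) G
    \<le> measure (gauss_field ({..m} \<times> {..n})) {z \<in> space (gauss_field ({..m} \<times> {..n})).
        \<forall>x\<in>X. t - \<zeta> \<le> pos_part_norm m c (\<lambda>i. \<Sum>j<n. z (i, j) * x j) + z (m, n)}"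
    (is "_ \<le> measure ?P ?E")
proof -
  interpret P: prob_space ?P by (rule prob_space_gauss_field)
  note gauss_field_entry_measurable [measurable]
  have E [measurable]: "?E \<in> sets ?P" using X(1) by measurable
  \<comment> \<open>This makes the smoothing error of the norm at most a quarter of the margin.\<close>
  define \<delta> where "\<delta> = \<zeta> / (4 * (1 + real m))"
  have \<delta>: "\<delta> > 0" "\<delta> * (1 + real m) = \<zeta> / 4" using \<zeta> by (auto simp: \<delta>_def divide_simps)
  have main: "soft_step (p * (\<zeta> / 2)) ^ card X * measure ?P G \<le> measure ?P ?E + soft_step (p * - (\<zeta> / 4))" if p: "p > 0" for p
  proof -
    obtain U1 U2 B where "gordon_profile m (soft_event m \<delta> c p (t - \<zeta> / 2)) U1 U2 B"
      using gordon_profile_soft_event[OF \<delta>(1) p] by blast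
    then interpret gordon_profile m "soft_event m \<delta> c p (t - \<zeta> / 2)" U1 U2 B .
    have int: "integrable ?P (prodU n X \<theta>)" for \<theta>
      by (rule P.integrable_const_bound[of _ 1]) (use measurable_U_interp prodU_abs_le_1 in auto)
    have "soft_step (p * (\<zeta> / 2)) ^ card X * measure ?P G = (\<integral>z. soft_step (p * (\<zeta> / 2)) ^ card X * indicator G z \<partial>?P)"
      using G(1) by simp
    also have "\<dots> \<le> (\<integral>z. prodU n X (pi/2) z \<partial>?P)"
    proof (rule integral_mono[OF _ int])
      show "integrable ?P (\<lambda>z. soft_step (p * (\<zeta> / 2)) ^ card X * indicator G z)"
        using G(1) by (intro integrable_mult_right integrable_real_indicator) (auto simp: P.emeasure_eq_measure)
      fix z
      show "soft_step (p * (\<zeta> / 2)) ^ card X * indicator G z \<le> prodU n X (pi/2) z"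
      proof (cases "z \<in> G")
        case True
        have "soft_step (p * (\<zeta> / 2)) \<le> soft_event m \<delta> c p (t - \<zeta> / 2) (interp m n (pi/2) x z)" if x: "x \<in> X" for x
        proof -
          have "t \<le> pos_part_norm m c (\<lambda>i. z (i, n)) + (\<Sum>j<n. z (m, j) * x j)" using G(2)[OF True x] .
          also have "pos_part_norm m c (\<lambda>i. z (i, n)) \<le> soft_norm m \<delta> c (\<lambda>i. z (i, n))"
            by (rule soft_norm_approx(1)[OF \<delta>(1)])
          also have "\<dots> = soft_norm m \<delta> c (interp m n (pi/2) x z)"
            by (rule soft_norm_cong) (simp add: interp_pi_half)
          finally show ?thesis unfolding soft_event_def interp_pi_half
            using p by (intro soft_step_mono mult_left_mono) auto
        qed
        then have "(\<Prod>x\<in>X. soft_step (p * (\<zeta> / 2))) \<le> prodU n X (pi/2) z"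
          unfolding prodU_def by (intro prod_mono) (auto simp: soft_step_bounds)
        then show ?thesis using True by simp
      qed (simp add: prodU_nonneg)
    qed
    also have "\<dots> \<le> (\<integral>z. prodU n X 0 z \<partial>?P)" by (rule gordon_smooth[OF X])
    also have "\<dots> \<le> (\<integral>z. indicator ?E z + soft_step (p * - (\<zeta> / 4)) \<partial>?P)"
    proof (rule integral_mono[OF int])
      show "integrable ?P (\<lambda>z. indicator ?E z + soft_step (p * - (\<zeta> / 4)))"
        using E by (intro Bochner_Integration.integrable_add integrable_real_indicator P.integrable_const) (auto simp: P.emeasure_eq_measure)
      fix z assume z: "z \<in> space ?P"
      show "prodU n X 0 z \<le> indicator ?E z + soft_step (p * - (\<zeta> / 4))"
      proof (cases "z \<in> ?E")
        case True
        then show ?thesis using prodU_le_1[of n X 0 z] soft_step_bounds(1)[of "p * - (\<zeta> / 4)"] by simp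
      next
        case False
        then obtain x where x: "x \<in> X" "pos_part_norm m c (\<lambda>i. \<Sum>j<n. z (i, j) * x j) + z (m, n) < t - \<zeta>"
          using z by (auto simp: not_le)
        have "soft_norm m \<delta> c (interp m n 0 x z) = soft_norm m \<delta> c (\<lambda>i. \<Sum>j<n. z (i, j) * x j)"
          by (rule soft_norm_cong) (simp add: interp_0)
        also have "\<dots> \<le> pos_part_norm m c (\<lambda>i. \<Sum>j<n. z (i, j) * x j) + \<zeta> / 4"
          using soft_norm_approx(2)[OF \<delta>(1), of m c "\<lambda>i. \<Sum>j<n. z (i, j) * x j"] \<delta>(2) by simp
        finally have "soft_norm m \<delta> c (interp m n 0 x z) + interp m n 0 x z m - (t - \<zeta> / 2) \<le> - (\<zeta> / 4)"
          using x(2) by (simp add: interp_0)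
        then have "soft_event m \<delta> c p (t - \<zeta> / 2) (interp m n 0 x z) \<le> soft_step (p * - (\<zeta> / 4))"
          unfolding soft_event_def using p by (intro soft_step_mono mult_left_mono) auto
        moreover have "prodU n X 0 z = soft_event m \<delta> c p (t - \<zeta> / 2) (interp m n 0 x z) * prodU n (X - {x}) 0 z"
          unfolding prodU_def by (rule prod.remove[OF X(1) x(1)])
        moreover have "\<dots> \<le> soft_event m \<delta> c p (t - \<zeta> / 2) (interp m n 0 x z) * 1"
          by (intro mult_left_mono prodU_le_1 U_nonneg)
        ultimately show ?thesis by (simp add: indicator_def) 
      qed
    qed
    also have "\<dots> = measure ?P ?E + soft_step (p * - (\<zeta> / 4))"
      using E P.prob_space by (subst Bochner_Integration.integral_add) (auto simp: P.emeasure_eq_measure intro!: integrable_real_indicator)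
    finally show ?thesis .
  qed
  have l: "((\<lambda>p. soft_step (p * (\<zeta> / 2)) ^ card X * measure ?P G) \<longlongrightarrow> 1 ^ card X * measure ?P G) at_top"
    using \<zeta> by (intro tendsto_intros soft_step_limits) auto
  have r: "((\<lambda>p. measure ?P ?E + soft_step (p * - (\<zeta> / 4))) \<longlongrightarrow> measure ?P ?E + 0) at_top"
    using \<zeta> by (intro tendsto_intros soft_step_limits) auto
  have "\<forall>\<^sub>F p in at_top. soft_step (p * (\<zeta> / 2)) ^ card X * measure ?P G \<le> measure ?P ?E + soft_step (p * - (\<zeta> / 4))"
    using eventually_gt_at_top[of 0] by eventually_elim (rule main)
  from tendsto_le[OF trivial_limit_at_top_linorder r l this] show ?thesis by simp
qed

lemma continuous_on_entry [continuous_intros]: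
  "continuous_on S (\<lambda>x. x j)" for S :: "('i \<Rightarrow> real) set"
  using continuous_on_product_coordinates by (rule continuous_on_subset) simp

text \<open>
  One countable set serves for all continuous functions at once, hence for all outcomes of a random
  continuous function.
\<close>

lemma countable_dense_subset_ge:
  fixes T :: "'b::{metric_space, second_countable_topology} set"
  obtains D where "countable D" "D \<subseteq> T"
    "\<And>(g :: 'b \<Rightarrow> real) r. continuous_on T g \<Longrightarrow> (\<forall>t\<in>D. r \<le> g t) \<longleftrightarrow> (\<forall>t\<in>T. r \<le> g t)"
proof -
  obtain D where D: "countable D" "D \<subseteq> T" "T \<subseteq> closure D" by (rule separable)
  have "(\<forall>t\<in>D. r \<le> g t) \<longleftrightarrow> (\<forall>t\<in>T. r \<le> g t)" if g: "continuous_on T g" for g :: "'b \<Rightarrow> real" and r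
  proof
    assume ge: "\<forall>t\<in>D. r \<le> g t"
    show "\<forall>t\<in>T. r \<le> g t"
    proof
      fix t assume t: "t \<in> T"
      then obtain s where s: "\<And>k. s k \<in> D" "s \<longlonglongrightarrow> t"
        using D(3) closure_sequential by blast
      have "(\<lambda>k. g (s k)) \<longlonglongrightarrow> g t"
        using s D(2) t by (intro continuous_on_tendsto_compose[OF g] always_eventually) auto
      then show "r \<le> g t" by (rule LIMSEQ_le_const) (use ge s in auto)
    qed
  qed (use D in auto)
  then show ?thesis using that D by blast
qed

lemma sets_Collect_ball_ge:
  fixes T :: "'b::{metric_space, second_countable_topology} set" and f :: "'b \<Rightarrow> 'a \<Rightarrow> real"
  assumes f: "\<And>t. t \<in> T \<Longrightarrow> f t \<in> borel_measurable M"
    and c: "\<And>\<omega>. \<omega> \<in> space M \<Longrightarrow> continuous_on T (\<lambda>t. f t \<omega>)"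
  shows "{\<omega> \<in> space M. \<forall>t\<in>T. r \<le> f t \<omega>} \<in> sets M"
proof -
  obtain D where D: "countable D" "D \<subseteq> T"
    "\<And>(g :: 'b \<Rightarrow> real) r. continuous_on T g \<Longrightarrow> (\<forall>t\<in>D. r \<le> g t) \<longleftrightarrow> (\<forall>t\<in>T. r \<le> g t)"
    by (rule countable_dense_subset_ge) blast
  have "{\<omega> \<in> space M. \<forall>t\<in>T. r \<le> f t \<omega>} = {\<omega> \<in> space M. \<forall>t\<in>D. r \<le> f t \<omega>}"
    using D(3)[OF c] by blast
  also have "\<dots> \<in> sets M"
  proof (rule sets.sets_Collect_countable_All'[OF _ D(1)])
    fix t assume "t \<in> D"
    then have [measurable]: "f t \<in> borel_measurable M" using f D(2) by blast
    show "{\<omega> \<in> space M. r \<le> f t \<omega>} \<in> sets M" by measurable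
  qed
  finally show ?thesis .
qed

text \<open>
  The lower bound for finite sets does not depend on the set, hence survives the decreasing limit along an
  enumeration of a countable dense subset of \<open>S\<close>.
\<close>

theorem gordon_infinite:
  fixes m n :: nat and S :: "(nat \<Rightarrow> real) set" and c t \<zeta> :: real
  assumes S: "\<And>x. x \<in> S \<Longrightarrow> (\<Sum>j<n. (x j)\<^sup>2) = 1" and \<zeta>: "\<zeta> > 0"
    and G: "G \<in> sets (gauss_field ({..m} \<times> {..n}))"
      "\<And>z x. z \<in> G \<Longrightarrow> x \<in> S \<Longrightarrow> t \<le> pos_part_norm m c (\<lambda>i. z (i, n)) + (\<Sum>j<n. z (m, j) * x j)"
  shows "measure (gauss_field ({..m} \<times> {..n})) G
    \<le> measure (gauss_field ({..m} \<times> {..n})) {z \<in> space (gauss_field ({..m} \<times> {..n})).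
        \<forall>x\<in>S. t - \<zeta> \<le> pos_part_norm m c (\<lambda>i. \<Sum>j<n. z (i, j) * x j) + z (m, n)}"
    (is "_ \<le> measure ?P {z \<in> space ?P. \<forall>x\<in>S. t - \<zeta> \<le> ?g z x}")
proof -
  interpret P: prob_space ?P by (rule prob_space_gauss_field)
  note gauss_field_entry_measurable [measurable]
  obtain D where D: "countable D" "D \<subseteq> S"
    "\<And>(g :: (nat \<Rightarrow> real) \<Rightarrow> real) r. continuous_on S g \<Longrightarrow> (\<forall>t\<in>D. r \<le> g t) \<longleftrightarrow> (\<forall>t\<in>S. r \<le> g t)"
    by (rule countable_dense_subset_ge) blast
  have cont: "continuous_on S (?g z)" for z by (intro continuous_intros)
  have eq: "{z \<in> space ?P. \<forall>x\<in>S. t - \<zeta> \<le> ?g z x} = {z \<in> space ?P. \<forall>x\<in>D. t - \<zeta> \<le> ?g z x}"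
    using D(3)[OF cont] by blast
  show ?thesis
  proof (cases "D = {}")
    case True
    then show ?thesis unfolding eq using P.prob_space by simp
  next
    case False
    define d where "d = from_nat_into D"
    have d: "range d = D" unfolding d_def by (rule range_from_nat_into[OF False D(1)])
    define A where "A k = {z \<in> space ?P. \<forall>x\<in>d ` {..<k}. t - \<zeta> \<le> ?g z x}" for k
    have A: "A k \<in> sets ?P" for k unfolding A_def by measurable
    have "decseq A" unfolding decseq_def A_def by auto
    then have "(\<lambda>k. measure ?P (A k)) \<longlonglongrightarrow> measure ?P (\<Inter>k. A k)"
      using A by (intro P.finite_Lim_measure_decseq) auto
    moreover have "(\<Inter>k. A k) = {z \<in> space ?P. \<forall>x\<in>D. t - \<zeta> \<le> ?g z x}"
      unfolding A_def d[symmetric] by auto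
    moreover have "measure ?P G \<le> measure ?P (A k)" for k
      unfolding A_def
    proof (rule gordon_finite[OF _ _ \<zeta> G(1)])
      show "(\<Sum>j<n. (x j)\<^sup>2) = 1" if "x \<in> d ` {..<k}" for x using that d D(2) S by blast
      show "t \<le> pos_part_norm m c (\<lambda>i. z (i, n)) + (\<Sum>j<n. z (m, j) * x j)" if "z \<in> G" "x \<in> d ` {..<k}" for z x
        using that d D(2) G(2) by blast
    qed simp
    ultimately show ?thesis unfolding eq by (intro LIMSEQ_le_const) auto
  qed
qed

text \<open>
  Weak duality: \<open>y = sqrt (\<beta> n) x\<close> has coordinates in \<open>[- 1, 1]\<close> and squared norm \<open>\<beta> n\<close>, and the constraint on
  the norm is relaxed with multiplier \<open>\<gamma>\<close>.
\<close>

lemma box_sphere_linear_form_ge: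
  assumes x: "x \<in> box_sphere \<beta> n" and "\<beta> > 0" "n > 0" "\<gamma> \<ge> 0"
  shows "((\<Sum>j<n. box_lagrangian_min \<gamma> (h j)) - \<gamma> * \<beta> * real n) / sqrt (\<beta> * real n) \<le> (\<Sum>j<n. h j * x j)"
proof -
  define R where "R = sqrt (\<beta> * real n)"
  have R: "R > 0" "R\<^sup>2 = \<beta> * real n" using assms by (auto simp: R_def)
  have "(\<Sum>j<n. box_lagrangian_min \<gamma> (h j)) \<le> (\<Sum>j<n. h j * (R * x j) + \<gamma> * (R * x j)\<^sup>2)"
  proof (intro sum_mono box_lagrangian_min_le)
    fix j assume "j \<in> {..<n}"
    then have "- 1 / R \<le> x j" "x j \<le> 1 / R" using x by (simp_all add: box_sphere_def R_def)
    then have "- 1 \<le> x j * R" "x j * R \<le> 1"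
      using pos_divide_le_eq[OF R(1), of "- 1" "x j"] pos_le_divide_eq[OF R(1), of "x j" 1] by blast+
    then show "\<bar>R * x j\<bar> \<le> 1" by (simp add: abs_le_iff mult.commute)
  qed (rule \<open>\<gamma> \<ge> 0\<close>)
  also have "\<dots> = R * (\<Sum>j<n. h j * x j) + \<gamma> * R\<^sup>2 * (\<Sum>j<n. (x j)\<^sup>2)"
    by (simp add: sum.distrib sum_distrib_left power_mult_distrib mult_ac)
  also have "(\<Sum>j<n. (x j)\<^sup>2) = 1" using x by (simp add: box_sphere_def)
  finally have "(\<Sum>j<n. box_lagrangian_min \<gamma> (h j)) - \<gamma> * \<beta> * real n \<le> (\<Sum>j<n. h j * x j) * R"
    by (simp add: R(2) mult_ac)
  then show ?thesis using R(1) by (simp add: pos_divide_le_eq flip: R_def)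
qed

section \<open>Exponentially small sequences of probabilities\<close>

definition negligible_seq :: "(nat \<Rightarrow> real) \<Rightarrow> bool" where
  "negligible_seq q \<longleftrightarrow> (\<exists>C>0. \<exists>c>0. \<forall>\<^sub>F n in sequentially. q n \<le> C * exp (- c * real n))"

lemma overwhelming_iff: "overwhelming p \<longleftrightarrow> negligible_seq (\<lambda>n. 1 - p n)"
  unfolding overwhelming_def negligible_seq_def by (simp add: algebra_simps)

lemma negligible_seq_mono:
  assumes "negligible_seq q" "\<forall>\<^sub>F n in sequentially. p n \<le> q n"
  shows "negligible_seq p"
proof -
  obtain C c where C: "C > 0" "c > 0" "\<forall>\<^sub>F n in sequentially. q n \<le> C * exp (- c * real n)"
    using assms(1) unfolding negligible_seq_def by blast
  have "\<forall>\<^sub>F n in sequentially. p n \<le> C * exp (- c * real n)"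
    using C(3) assms(2) by eventually_elim linarith
  then show ?thesis unfolding negligible_seq_def using C by blast
qed

lemma negligible_seq_add:
  assumes "negligible_seq p" "negligible_seq q"
  shows "negligible_seq (\<lambda>n. p n + q n)"
proof -
  obtain C c where C: "C > 0" "c > 0" "\<forall>\<^sub>F n in sequentially. p n \<le> C * exp (- c * real n)"
    using assms(1) unfolding negligible_seq_def by blast
  obtain D d where D: "D > 0" "d > 0" "\<forall>\<^sub>F n in sequentially. q n \<le> D * exp (- d * real n)"
    using assms(2) unfolding negligible_seq_def by blast
  have "\<forall>\<^sub>F n in sequentially. p n + q n \<le> (C + D) * exp (- min c d * real n)"
    using C(3) D(3)
  proof eventually_elim
    case (elim n)
    have "C * exp (- c * real n) \<le> C * exp (- min c d * real n)"
      using C by (intro mult_left_mono) (auto intro: mult_right_mono)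
    moreover have "D * exp (- d * real n) \<le> D * exp (- min c d * real n)"
      using D by (intro mult_left_mono) (auto intro: mult_right_mono)
    ultimately show ?case using elim by (simp add: distrib_right)
  qed
  moreover have "C + D > 0" "min c d > 0" using C D by auto
  ultimately show ?thesis unfolding negligible_seq_def by blast
qed

lemma negligible_seq_sum:
  assumes "finite A" "\<And>a. a \<in> A \<Longrightarrow> negligible_seq (p a)"
  shows "negligible_seq (\<lambda>n. \<Sum>a\<in>A. p a n)"
  using assms
proof (induction A rule: finite_induct)
  case empty
  have "negligible_seq (\<lambda>n. exp (- 1 * real n))"
    unfolding negligible_seq_def by (intro exI[of _ 1] conjI) auto
  then show ?case by (rule negligible_seq_mono) auto
qed (auto intro: negligible_seq_add)

lemma negligible_seq_exp: "c > 0 \<Longrightarrow> C > 0 \<Longrightarrow> negligible_seq (\<lambda>n. C * exp (- c * real n))"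
  unfolding negligible_seq_def by (intro exI[of _ C] conjI exI[of _ c]) auto

lemma negligible_seq_tendsto_1:
  assumes "negligible_seq (\<lambda>n. 1 - p n)" "\<And>n. p n \<le> 1"
  shows "p \<longlonglongrightarrow> 1"
proof -
  obtain C c where C: "C > 0" "c > 0" "\<forall>\<^sub>F n in sequentially. 1 - p n \<le> C * exp (- c * real n)"
    using assms(1) unfolding negligible_seq_def by blast
  have "filterlim (\<lambda>n. c * real n) at_top sequentially"
    using C(2) by (intro filterlim_tendsto_pos_mult_at_top[OF tendsto_const _ filterlim_real_sequentially])
  then have "filterlim (\<lambda>n. - (c * real n)) at_bot sequentially"
    by (simp add: filterlim_uminus_at_top)
  then have "(\<lambda>n. exp (- (c * real n))) \<longlonglongrightarrow> 0" by (rule filterlim_compose[OF exp_at_bot])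
  then have "(\<lambda>n. 1 - C * exp (- (c * real n))) \<longlonglongrightarrow> 1 - C * 0" by (intro tendsto_intros)
  then have l: "(\<lambda>n. 1 - C * exp (- (c * real n))) \<longlonglongrightarrow> 1" by simp
  show ?thesis
  proof (rule tendsto_sandwich[OF _ _ l tendsto_const])
    show "\<forall>\<^sub>F n in sequentially. 1 - C * exp (- (c * real n)) \<le> p n"
      using C(3) by eventually_elim simp
  qed (use assms(2) in auto)
qed

lemma exp_neg_nat_le:
  fixes m :: "nat \<Rightarrow> nat"
  assumes "\<alpha> > 0" "c > 0" "\<And>n. \<bar>real (m n) - \<alpha> * real n\<bar> < 1"
  shows "negligible_seq (\<lambda>n. exp (- c * real (m n)))"
proof (rule negligible_seq_mono[OF negligible_seq_exp[of "c * \<alpha>" "exp c"]])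
  show "\<forall>\<^sub>F n in sequentially. exp (- c * real (m n)) \<le> exp c * exp (- (c * \<alpha>) * real n)"
  proof (intro always_eventually allI)
    fix n
    have "c * (\<alpha> * real n - 1) \<le> c * real (m n)"
      using assms(2) assms(3)[of n] by (intro mult_left_mono) auto
    then show "exp (- c * real (m n)) \<le> exp c * exp (- (c * \<alpha>) * real n)"
      by (simp add: algebra_simps flip: exp_add)
  qed
qed (use assms in auto)

lemma gauss_entry_tail:
  fixes K :: "'i set"
  assumes "finite K" "k \<in> K" "s \<ge> 0"
  shows "measure (gauss_field K) {z \<in> space (gauss_field K). s \<le> z k}
    \<le> (\<integral>z. exp (z\<^sup>2 / 4) \<partial>std_normal_distribution) * exp (- s\<^sup>2 / 4)"
proof -
  note gauss_field_entry_measurable [measurable]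
  interpret P: prob_space "gauss_field K" by (rule prob_space_gauss_field)
  have int: "integrable (gauss_field K) (\<lambda>z. exp ((z k)\<^sup>2 / 4))"
    by (rule gauss_field_component(1)[OF assms(1,2) integrable_std_gauss_exp_square])
  have "measure (gauss_field K) {z \<in> space (gauss_field K). s \<le> z k}
      \<le> measure (gauss_field K) {z \<in> space (gauss_field K). exp (s\<^sup>2 / 4) \<le> exp ((z k)\<^sup>2 / 4)}"
    using assms(3) by (intro P.finite_measure_mono) (auto intro: power_mono)
  also have "\<dots> \<le> (\<integral>z. exp ((z k)\<^sup>2 / 4) \<partial>gauss_field K) / exp (s\<^sup>2 / 4)"
    by (rule integral_Markov_inequality_measure[OF int]) auto
  also have "(\<integral>z. exp ((z k)\<^sup>2 / 4) \<partial>gauss_field K) = (\<integral>z. exp (z\<^sup>2 / 4) \<partial>std_normal_distribution)"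
    by (rule gauss_field_component(2)[OF assms(1,2) integrable_std_gauss_exp_square])
  also have "(\<integral>z. exp (z\<^sup>2 / 4) \<partial>std_normal_distribution) / exp (s\<^sup>2 / 4)
      = (\<integral>z. exp (z\<^sup>2 / 4) \<partial>std_normal_distribution) * exp (- s\<^sup>2 / 4)"
    unfolding minus_divide_left[symmetric] exp_minus by (rule divide_inverse)
  finally show ?thesis .
qed

text \<open>
  Events that depend on the entries of \<open>H\<close> only may be evaluated in any larger product space, where the
  additional Gaussians of the comparison are available.
\<close>

lemma std_normal_matrix_transfer:
  assumes H: "std_normal_matrix M m n H" and "m > 0" "n > 0"
    and K: "finite K" "{..<m} \<times> {..<n} \<subseteq> K"
    and Q: "\<And>z w. (\<And>i j. i < m \<Longrightarrow> j < n \<Longrightarrow> z (i, j) = w (i, j)) \<Longrightarrow> Q z = Q w"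
    and S: "\<And>I. {z \<in> space (gauss_field I). Q z} \<in> sets (gauss_field I)"
  shows "measure M {\<omega> \<in> space M. Q (\<lambda>(i, j). H \<omega> i j)} = measure (gauss_field K) {z \<in> space (gauss_field K). Q z}"
    and "{\<omega> \<in> space M. Q (\<lambda>(i, j). H \<omega> i j)} \<in> sets M"
proof -
  let ?I = "{..<m} \<times> {..<n}"
  interpret M: prob_space M using H by (simp add: std_normal_matrix_def)
  let ?X = "\<lambda>(i, j) \<omega>. H \<omega> i j"
  let ?r = "\<lambda>\<omega>. \<lambda>k\<in>?I. ?X k \<omega>"
  have d: "distributed M lborel (?X k) (\<lambda>x. ennreal (std_normal_density x))" if "k \<in> ?I" for k
    using H that by (auto simp: std_normal_matrix_def)
  have rv: "?X k \<in> borel_measurable M" if "k \<in> ?I" for k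
    using distributed_measurable[OF d[OF that]] by simp
  have sb: "sets (PiM ?I (\<lambda>_. borel)) = sets (gauss_field ?I)" by (intro sets_PiM_cong) auto
  have "distr M (PiM ?I (\<lambda>_. borel)) ?r = PiM ?I (\<lambda>k. distr M borel (?X k))"
    using H assms(2,3) rv by (subst M.indep_vars_iff_distr_eq_PiM'[symmetric]) (auto simp: std_normal_matrix_def)
  also have "\<dots> = gauss_field ?I"
  proof (rule PiM_cong[OF refl])
    fix k assume k: "k \<in> ?I"
    have "distr M borel (?X k) = distr M lborel (?X k)" by (rule distr_cong) auto
    also have "\<dots> = std_normal_distribution" by (rule distributed_distr_eq_density[OF d[OF k]])
    finally show "distr M borel (?X k) = std_normal_distribution" .
  qed
  finally have D: "distr M (PiM ?I (\<lambda>_. borel)) ?r = gauss_field ?I" .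
  have r: "?r \<in> measurable M (PiM ?I (\<lambda>_. borel))" using rv by (intro measurable_restrict) auto
  let ?A = "{z \<in> space (gauss_field ?I). Q z}"
  have A: "?A \<in> sets (PiM ?I (\<lambda>_. borel))" unfolding sb by (rule S)
  have e1: "?r -` ?A \<inter> space M = {\<omega> \<in> space M. Q (\<lambda>(i, j). H \<omega> i j)}"
  proof -
    have "Q (?r \<omega>) = Q (\<lambda>(i, j). H \<omega> i j)" for \<omega> by (rule Q) auto
    moreover have "?r \<omega> \<in> space (gauss_field ?I)" for \<omega> by (simp add: space_PiM)
    ultimately show ?thesis by auto
  qed
  show "{\<omega> \<in> space M. Q (\<lambda>(i, j). H \<omega> i j)} \<in> sets M"
    unfolding e1[symmetric] by (rule measurable_sets[OF r A])
  have "measure M {\<omega> \<in> space M. Q (\<lambda>(i, j). H \<omega> i j)} = measure (distr M (PiM ?I (\<lambda>_. borel)) ?r) ?A"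
    unfolding e1[symmetric] by (rule measure_distr[OF r A, symmetric])
  also have "\<dots> = measure (gauss_field ?I) ?A" unfolding D ..
  also have "\<dots> = measure (distr (gauss_field K) (gauss_field ?I) (\<lambda>f. restrict f ?I)) ?A"
  proof -
    interpret P: product_prob_space "\<lambda>_. std_normal_distribution" K by standard
    show ?thesis using P.distr_restrict[OF K(2,1)] by simp
  qed
  also have "\<dots> = measure (gauss_field K) ((\<lambda>f. restrict f ?I) -` ?A \<inter> space (gauss_field K))"
    by (rule measure_distr[OF measurable_restrict_subset[OF K(2)] S])
  also have "(\<lambda>f. restrict f ?I) -` ?A \<inter> space (gauss_field K) = {z \<in> space (gauss_field K). Q z}"
  proof -
    have "Q (restrict z ?I) = Q z" for z by (rule Q) auto
    moreover have "restrict z ?I \<in> space (gauss_field ?I)" for z :: "nat \<times> nat \<Rightarrow> real" by (simp add: space_PiM)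
    ultimately show ?thesis by auto
  qed
  finally show "measure M {\<omega> \<in> space M. Q (\<lambda>(i, j). H \<omega> i j)} = measure (gauss_field K) {z \<in> space (gauss_field K). Q z}" .
qed

section \<open>Lower bounds over the box sphere and the unit sphere\<close>

text \<open>
  Gordon's inequality with the two bad events at the end \<open>(a, h \<bullet> x)\<close> and the bad event for \<open>g\<close> subtracted.
  The linear form \<open>h \<bullet> x\<close> enters through a dual bound with separable \<open>q\<close>; this covers the box (by
  \<open>box_sphere_linear_form_ge\<close>) as well as the whole sphere.  The summand \<open>- 1\<close> of \<open>r\<close> is the margin of \<open>gordon_infinite\<close>,
  negligible on the scale \<open>sqrt n\<close>.
\<close>

lemma pos_part_norm_lower_probability:
  fixes m n :: nat and S :: "(nat \<Rightarrow> real) set" and q :: "real \<Rightarrow> real" and c \<mu> \<rho> a b e :: real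
  assumes S: "\<And>x. x \<in> S \<Longrightarrow> (\<Sum>j<n. (x j)\<^sup>2) = 1"
    and dual: "\<And>x h. x \<in> S \<Longrightarrow> ((\<Sum>j<n. q (h j)) - \<mu>) / \<rho> \<le> (\<Sum>j<n. h j * x j)"
    and \<rho>: "\<rho> > 0" and q [measurable]: "q \<in> borel_measurable borel"
  defines "P \<equiv> gauss_field ({..m} \<times> {..n})"
  defines "r \<equiv> a + (b - \<mu>) / \<rho> - 1 - e"
  shows "1 - measure P {z \<in> space P. pos_part_norm m c (\<lambda>i. z (i, n)) \<le> a}
       - measure P {z \<in> space P. (\<Sum>j<n. q (z (m, j))) \<le> b}
       - measure P {z \<in> space P. e \<le> z (m, n)}
    \<le> measure P {z \<in> space P. \<forall>x\<in>S. r \<le> pos_part_norm m c (\<lambda>i. \<Sum>j<n. z (i, j) * x j)}"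
proof -
  interpret P: prob_space P unfolding P_def by (rule prob_space_gauss_field)
  have [measurable]: "(\<lambda>z. z k) \<in> borel_measurable P" for k unfolding P_def by (rule gauss_field_entry_measurable)
  let ?A = "{z \<in> space P. pos_part_norm m c (\<lambda>i. z (i, n)) \<le> a}"
  let ?B = "{z \<in> space P. (\<Sum>j<n. q (z (m, j))) \<le> b}"
  let ?C = "{z \<in> space P. e \<le> z (m, n)}"
  let ?g = "\<lambda>z x. pos_part_norm m c (\<lambda>i. \<Sum>j<n. z (i, j) * x j)"
  let ?t = "a + (b - \<mu>) / \<rho>"
  let ?L = "{z \<in> space P. \<forall>x\<in>S. ?t - 1 \<le> ?g z x + z (m, n)}"
  have sets: "?A \<in> sets P" "?B \<in> sets P" "?C \<in> sets P" by measurable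
  have L: "?L \<in> sets P"
    by (intro sets_Collect_ball_ge borel_measurable_add borel_measurable_sqrt borel_measurable_sum
        borel_measurable_power borel_measurable_max continuous_intros) measurable
  have R: "{z \<in> space P. \<forall>x\<in>S. r \<le> ?g z x} \<in> sets P"
    by (intro sets_Collect_ball_ge borel_measurable_add borel_measurable_sqrt borel_measurable_sum
        borel_measurable_power borel_measurable_max continuous_intros) measurable
  have "measure P (space P - (?A \<union> ?B)) \<le> measure P ?L"
  proof (rule gordon_infinite[where m=m and n=n, folded P_def])
    show "space P - (?A \<union> ?B) \<in> sets P" using sets by (intro sets.compl_sets sets.Un)
    fix x assume x: "x \<in> S"
    then show "(\<Sum>j<n. (x j)\<^sup>2) = 1" by (rule S)
    fix z assume z: "z \<in> space P - (?A \<union> ?B)"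
    then have 1: "a < pos_part_norm m c (\<lambda>i. z (i, n))" "b < (\<Sum>j<n. q (z (m, j)))" by auto
    have "(b - \<mu>) / \<rho> \<le> ((\<Sum>j<n. q (z (m, j))) - \<mu>) / \<rho>"
      using 1(2) \<rho> by (intro divide_right_mono) auto
    also have "\<dots> \<le> (\<Sum>j<n. z (m, j) * x j)"
      by (rule dual[OF x])
    finally show "?t \<le> pos_part_norm m c (\<lambda>i. z (i, n)) + (\<Sum>j<n. z (m, j) * x j)"
      using 1(1) by linarith
  qed simp
  moreover have "measure P (space P - (?A \<union> ?B)) = 1 - measure P (?A \<union> ?B)"
    using sets by (intro P.prob_compl sets.Un)
  moreover have "measure P (?A \<union> ?B) \<le> measure P ?A + measure P ?B"
    using sets by (intro measure_Un_le)
  moreover have "measure P ?L \<le> measure P ({z \<in> space P. \<forall>x\<in>S. r \<le> ?g z x} \<union> ?C)"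
  proof (rule P.finite_measure_mono)
    show "?L \<subseteq> {z \<in> space P. \<forall>x\<in>S. r \<le> ?g z x} \<union> ?C"
    proof
      fix z assume z: "z \<in> ?L"
      show "z \<in> {z \<in> space P. \<forall>x\<in>S. r \<le> ?g z x} \<union> ?C"
      proof (cases "e \<le> z (m, n)")
        case False
        have "r \<le> ?g z x" if "x \<in> S" for x
          using z that False unfolding r_def by (fastforce simp: not_le)
        then show ?thesis using z by blast
      qed (use z in auto)
    qed
  qed (use R sets in auto)
  moreover have "measure P ({z \<in> space P. \<forall>x\<in>S. r \<le> ?g z x} \<union> ?C) \<le> measure P {z \<in> space P. \<forall>x\<in>S. r \<le> ?g z x} + measure P ?C"
    using R sets by (intro measure_Un_le)
  ultimately show ?thesis by linarith
qed


definition norm_event :: "nat \<Rightarrow> nat \<Rightarrow> (nat \<Rightarrow> real) set \<Rightarrow> real \<Rightarrow> real \<Rightarrow> (nat \<Rightarrow> nat \<Rightarrow> real) \<Rightarrow> bool" where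
  "norm_event m n S c r H \<longleftrightarrow> (\<forall>x\<in>S. r \<le> pos_part_norm m c (mat_vec n H x))"

lemma norm_event_transfer:
  assumes H: "std_normal_matrix M m n H" and pos: "m > 0" "n > 0"
  defines "P \<equiv> gauss_field ({..m} \<times> {..n})"
  shows "measure M {\<omega> \<in> space M. norm_event m n S c r (H \<omega>)} =
      measure P {z \<in> space P. \<forall>x\<in>S. r \<le> pos_part_norm m c (\<lambda>i. \<Sum>j<n. z (i, j) * x j)}" (is ?eq)
    and sets_norm_event: "{\<omega> \<in> space M. norm_event m n S c r (H \<omega>)} \<in> sets M" (is ?sets)
proof -
  let ?Q = "\<lambda>z :: nat \<times> nat \<Rightarrow> real. \<forall>x\<in>S. r \<le> pos_part_norm m c (\<lambda>i. \<Sum>j<n. z (i, j) * x j)"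
  note gauss_field_entry_measurable [measurable]
  have Q: "?Q z = ?Q w" if "\<And>i j. i < m \<Longrightarrow> j < n \<Longrightarrow> z (i, j) = w (i, j)" for z w
    using that by simp
  have sets: "{z \<in> space (gauss_field I). ?Q z} \<in> sets (gauss_field I)" for I
    by (intro sets_Collect_ball_ge borel_measurable_add borel_measurable_sqrt borel_measurable_sum
        borel_measurable_power borel_measurable_max continuous_intros) measurable
  have K: "finite ({..m} \<times> {..n})" "{..<m} \<times> {..<n} \<subseteq> {..m} \<times> {..n}" by auto
  have "{\<omega> \<in> space M. ?Q (\<lambda>(i, j). H \<omega> i j)} = {\<omega> \<in> space M. norm_event m n S c r (H \<omega>)}"
    by (simp add: norm_event_def mat_vec_def[abs_def])
  then show ?eq ?sets
    using std_normal_matrix_transfer[OF H pos K Q sets] unfolding P_def by simp_all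
qed

lemma norm_event_probability:
  fixes m n :: nat and S :: "(nat \<Rightarrow> real) set" and q :: "real \<Rightarrow> real" and c \<mu> \<rho> a b e :: real
  assumes H: "std_normal_matrix M m n H" and pos: "m > 0" "n > 0"
    and S: "\<And>x. x \<in> S \<Longrightarrow> (\<Sum>j<n. (x j)\<^sup>2) = 1"
    and dual: "\<And>x h. x \<in> S \<Longrightarrow> ((\<Sum>j<n. q (h j)) - \<mu>) / \<rho> \<le> (\<Sum>j<n. h j * x j)"
    and \<rho>: "\<rho> > 0" and q: "q \<in> borel_measurable borel"
  defines "P \<equiv> gauss_field ({..m} \<times> {..n})"
  shows "1 - measure M {\<omega> \<in> space M. norm_event m n S c (a + (b - \<mu>) / \<rho> - 1 - e) (H \<omega>)}
    \<le> measure P {z \<in> space P. pos_part_norm m c (\<lambda>i. z (i, n)) \<le> a}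
       + measure P {z \<in> space P. (\<Sum>j<n. q (z (m, j))) \<le> b}
       + measure P {z \<in> space P. e \<le> z (m, n)}"
  unfolding norm_event_transfer(1)[OF H pos]
  using pos_part_norm_lower_probability[where S=S and m=m and n=n and c=c and a=a and b=b and e=e
      and q=q and \<mu>=\<mu> and \<rho>=\<rho>, OF S dual \<rho> q]
  unfolding P_def by simp

lemma norm_event_mono:
  assumes "norm_event m n S c r H" "r' \<le> r" shows "norm_event m n S c r' H"
  using assms unfolding norm_event_def by (blast intro: order_trans)

lemma norm_event_measure_mono:
  assumes H: "std_normal_matrix M m n H" and pos: "m > 0" "n > 0" and "r' \<le> r"
  shows "measure M {\<omega> \<in> space M. norm_event m n S c r (H \<omega>)} \<le> measure M {\<omega> \<in> space M. norm_event m n S c r' (H \<omega>)}"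
  using H sets_norm_event[OF H pos] assms(4)
  by (intro finite_measure.finite_measure_mono prob_space.finite_measure)
     (auto simp: std_normal_matrix_def intro: norm_event_mono)

lemma eventually_m_pos:
  fixes m :: "nat \<Rightarrow> nat"
  assumes \<alpha>: "\<alpha> > 0" and m: "\<And>n. \<bar>real (m n) - \<alpha> * real n\<bar> < 1"
  shows "\<forall>\<^sub>F n in sequentially. m n > 0"
proof -
  obtain N :: nat where N: "1 / \<alpha> \<le> real N" using real_arch_simple by blast
  show ?thesis using eventually_ge_at_top[of N]
  proof eventually_elim
    case (elim n)
    then have "1 / \<alpha> \<le> real n" using N by linarith
    then have "1 \<le> \<alpha> * real n" using \<alpha> by (simp add: pos_divide_le_eq mult.commute)
    then have "real (m n) > 0" using m[of n] by linarith
    then show ?case by simp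
  qed
qed

text \<open>
  Jensen's inequality for the positive part of \<open>c - Z\<close>, whose mean is at least \<open>c\<close>.
\<close>

lemma f_gar_ge_sq:
  assumes "c \<ge> 0" shows "c\<^sup>2 \<le> f_gar c"
proof -
  let ?X = "\<lambda>z. max 0 (c - z)"
  have i2: "integrable std_normal_distribution (\<lambda>z. (?X z)\<^sup>2)"
    by (rule integrable_std_gauss_quadratic[OF _ max_0_sq_quadratic_bound]) auto
  have i1: "integrable std_normal_distribution ?X"
    by (rule std_gauss.square_integrable_imp_integrable[OF _ i2]) auto
  have iz: "integrable std_normal_distribution (\<lambda>z. z)"
    using integrable_std_normal_moment[of 1] by (subst integrable_std_gauss_iff) auto
  have z0: "(\<integral>z. z \<partial>std_normal_distribution) = 0"
    using integral_std_normal_moment_odd[of 0] by (subst integral_std_gauss) auto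
  have "c = (\<integral>z. c - z \<partial>std_normal_distribution)"
    using iz z0 std_gauss.prob_space by simp
  also have "\<dots> \<le> (\<integral>z. ?X z \<partial>std_normal_distribution)"
    using iz i1 by (intro integral_mono) auto
  finally have "c\<^sup>2 \<le> (\<integral>z. ?X z \<partial>std_normal_distribution)\<^sup>2"
    using assms by (intro power_mono)
  moreover have "0 \<le> (\<integral>z. (?X z - (\<integral>z. ?X z \<partial>std_normal_distribution))\<^sup>2 \<partial>std_normal_distribution)"
    by (rule Bochner_Integration.integral_nonneg) auto
  ultimately show ?thesis
    unfolding f_gar_eq_expectation std_gauss.variance_eq[OF i1 i2] by linarith
qed

text \<open>
  At levels of order \<open>sqrt n\<close> each of the three bad events has exponentially small probability: the squared
  length of the positive part of \<open>c - a\<close> and the dual sum are sums of independent terms of quadratic growth, and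
  \<open>g\<close> has a Gaussian tail.
\<close>

theorem norm_event_overwhelming:
  fixes \<alpha> c \<mu> \<rho> A \<epsilon> :: real and m :: "nat \<Rightarrow> nat" and S :: "nat \<Rightarrow> (nat \<Rightarrow> real) set" and q :: "real \<Rightarrow> real"
  assumes \<alpha>: "\<alpha> > 0" and m: "\<And>n. \<bar>real (m n) - \<alpha> * real n\<bar> < 1"
    and H: "\<And>n. std_normal_matrix (M n) (m n) n (H n)"
    and S: "\<And>n x. x \<in> S n \<Longrightarrow> (\<Sum>j<n. (x j)\<^sup>2) = 1"
    and dual: "\<And>n x h. n > 0 \<Longrightarrow> x \<in> S n \<Longrightarrow>
      ((\<Sum>j<n. q (h j)) - \<mu> * real n) / (\<rho> * sqrt (real n)) \<le> (\<Sum>j<n. h j * x j)"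
    and \<rho>: "\<rho> > 0" and q [measurable]: "q \<in> borel_measurable borel" and q_bound: "\<And>h. \<bar>q h\<bar> \<le> A * (1 + h\<^sup>2)"
    and \<epsilon>: "\<epsilon> > 0"
  shows "negligible_seq (\<lambda>n. 1 - measure (M n) {\<omega> \<in> space (M n).
     norm_event (m n) n (S n) c (sqrt (real n) * (sqrt (\<alpha> * f_gar c) + ((\<integral>h. q h \<partial>std_normal_distribution) - \<mu>) / \<rho> - \<epsilon>)) (H n \<omega>)})"
proof -
  define L where "L = sqrt (\<alpha> * f_gar c)"
  have L: "L \<ge> 0" "L\<^sup>2 = \<alpha> * f_gar c" using \<alpha> f_gar_nonneg[of c] by (auto simp: L_def)
  define P where "P n = gauss_field ({..m n} \<times> {..n})" for n
  define d where "d = \<epsilon> / 4"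
  have d: "d > 0" using \<epsilon> by (simp add: d_def)
  define E where "E = (\<integral>h. q h \<partial>std_normal_distribution)"
  \<comment> \<open>The level of the dual sum has to lie strictly below its mean.\<close>
  define b where "b = E - \<rho> * d"
  have b: "b < E" using \<rho> d by (simp add: b_def)
  define a where "a n = sqrt (real n) * (L - d)" for n
  have N1: "negligible_seq (\<lambda>n. measure (P n) {z \<in> space (P n). pos_part_norm (m n) c (\<lambda>i. z (i, n)) \<le> a n})"
  proof (cases "L < d")
    \<comment> \<open>The level is negative, so the event is empty.\<close>
    case True
    have z: "{z \<in> space (P n). pos_part_norm (m n) c (\<lambda>i. z (i, n)) \<le> a n} = {}" if "n > 0" for n
    proof -
      have "a n < 0" using True that unfolding a_def by (intro mult_pos_neg) auto
      moreover have "0 \<le> pos_part_norm (m n) c v" for v by (simp add: sum_nonneg)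
      ultimately have "a n < pos_part_norm (m n) c v" for v by (rule less_le_trans)
      then show ?thesis by (simp add: not_le)
    qed
    show ?thesis
      by (rule negligible_seq_mono[OF negligible_seq_exp[of 1 1]])
         (auto simp: eventually_sequentially z intro!: exI[of _ 1])
  next
    case False
    \<comment> \<open>Strictly between the level and the mean, which leaves room for \<open>m n\<close> being \<open>\<alpha> * n\<close> up to rounding only.\<close>
    define r where "r = ((L - d)\<^sup>2 / \<alpha> + f_gar c) / 2"
    have lt: "(L - d)\<^sup>2 < L\<^sup>2" using False d by (intro power_strict_mono) auto
    then have "(L - d)\<^sup>2 / \<alpha> < f_gar c" using L(2) \<alpha> by (simp add: pos_divide_less_eq mult.commute)
    then have r: "r < f_gar c" "0 \<le> r" using f_gar_nonneg[of c] \<alpha> unfolding r_def by auto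
    obtain k where k: "k > 0" "\<And>K J :: (nat \<times> nat) set. finite K \<Longrightarrow> J \<subseteq> K \<Longrightarrow>
       measure (gauss_field K) {z \<in> space (gauss_field K). (\<Sum>i\<in>J. (max 0 (c - z i))\<^sup>2) \<le> r * real (card J)}
         \<le> exp (- k * real (card J))"
      using r(1) unfolding f_gar_eq_expectation
      by (rule cramer_lower_tail[OF _ max_0_sq_quadratic_bound, rotated, where 'i = "nat \<times> nat"]) auto
    have ev: "\<forall>\<^sub>F n in sequentially. real n * (L - d)\<^sup>2 \<le> r * real (m n)"
    proof -
      have pos: "\<alpha> * r - (L - d)\<^sup>2 > 0" using lt L(2) \<alpha> unfolding r_def by (simp add: field_simps)
      obtain N :: nat where N: "r / (\<alpha> * r - (L - d)\<^sup>2) \<le> real N" using real_arch_simple by blast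
      show ?thesis using eventually_ge_at_top[of N]
      proof eventually_elim
        case (elim n)
        have "r / (\<alpha> * r - (L - d)\<^sup>2) \<le> real n" using N elim by linarith
        then have "r \<le> real n * (\<alpha> * r - (L - d)\<^sup>2)" using pos by (simp add: pos_divide_le_eq)
        moreover have "r * (\<alpha> * real n - 1) \<le> r * real (m n)"
          using r(2) m[of n] by (intro mult_left_mono) auto
        ultimately show ?case by (simp add: algebra_simps)
      qed
    qed
    show ?thesis
    proof (rule negligible_seq_mono[OF exp_neg_nat_le[OF \<alpha> k(1) m]])
      show "\<forall>\<^sub>F n in sequentially. measure (P n) {z \<in> space (P n). pos_part_norm (m n) c (\<lambda>i. z (i, n)) \<le> a n}
          \<le> exp (- k * real (m n))"
        using ev
      proof eventually_elim
        case (elim n)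
        interpret P: prob_space "P n" unfolding P_def by (rule prob_space_gauss_field)
        have [measurable]: "(\<lambda>z. z k) \<in> borel_measurable (P n)" for k
          unfolding P_def by (rule gauss_field_entry_measurable)
        let ?J = "(\<lambda>i. (i, n)) ` {..<m n}"
        have J: "card ?J = m n" "?J \<subseteq> {..m n} \<times> {..n}" by (auto simp: card_image inj_on_def)
        have s: "(\<Sum>k\<in>?J. (max 0 (c - z k))\<^sup>2) = (\<Sum>i<m n. (max 0 (c - z (i, n)))\<^sup>2)" for z
          by (subst sum.reindex) (auto simp: inj_on_def)
        have "measure (P n) {z \<in> space (P n). pos_part_norm (m n) c (\<lambda>i. z (i, n)) \<le> a n}
            \<le> measure (P n) {z \<in> space (P n). (\<Sum>k\<in>?J. (max 0 (c - z k))\<^sup>2) \<le> r * real (card ?J)}"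
        proof (rule P.finite_measure_mono)
          show "{z \<in> space (P n). pos_part_norm (m n) c (\<lambda>i. z (i, n)) \<le> a n}
              \<subseteq> {z \<in> space (P n). (\<Sum>k\<in>?J. (max 0 (c - z k))\<^sup>2) \<le> r * real (card ?J)}"
          proof safe
            fix z assume "pos_part_norm (m n) c (\<lambda>i. z (i, n)) \<le> a n"
            then have "(\<Sum>i<m n. (max 0 (c - z (i, n)))\<^sup>2) \<le> (a n)\<^sup>2"
              by (rule sqrt_le_D)
            also have "\<dots> = real n * (L - d)\<^sup>2" by (simp add: a_def power_mult_distrib)
            finally show "(\<Sum>k\<in>?J. (max 0 (c - z k))\<^sup>2) \<le> r * real (card ?J)"
              using elim unfolding s J(1) by linarith
          qed
          show "{z \<in> space (P n). (\<Sum>k\<in>?J. (max 0 (c - z k))\<^sup>2) \<le> r * real (card ?J)} \<in> P.events"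
            by measurable
        qed
        also have "\<dots> \<le> exp (- k * real (card ?J))"
          unfolding P_def using k(2)[OF _ J(2)] by simp
        finally show ?case unfolding J(1) .
      qed
    qed
  qed
  have N2: "negligible_seq (\<lambda>n. measure (P n) {z \<in> space (P n). (\<Sum>j<n. q (z (m n, j))) \<le> b * real n})"
  proof -
    obtain k where k: "k > 0" "\<And>K J :: (nat \<times> nat) set. finite K \<Longrightarrow> J \<subseteq> K \<Longrightarrow>
       measure (gauss_field K) {z \<in> space (gauss_field K). (\<Sum>i\<in>J. q (z i)) \<le> b * real (card J)}
         \<le> exp (- k * real (card J))"
      using b unfolding E_def
      by (rule cramer_lower_tail[OF q q_bound, where 'i = "nat \<times> nat"]) auto
    show ?thesis
    proof (rule negligible_seq_mono[OF negligible_seq_exp[OF k(1), of 1]])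
      show "\<forall>\<^sub>F n in sequentially. measure (P n) {z \<in> space (P n). (\<Sum>j<n. q (z (m n, j))) \<le> b * real n}
          \<le> 1 * exp (- k * real n)"
      proof (intro always_eventually allI)
        fix n
        let ?J = "(\<lambda>j. (m n, j)) ` {..<n}"
        have J: "card ?J = n" "?J \<subseteq> {..m n} \<times> {..n}" by (auto simp: card_image inj_on_def)
        have s: "(\<Sum>k\<in>?J. q (z k)) = (\<Sum>j<n. q (z (m n, j)))" for z
          by (subst sum.reindex) (auto simp: inj_on_def)
        show "measure (P n) {z \<in> space (P n). (\<Sum>j<n. q (z (m n, j))) \<le> b * real n} \<le> 1 * exp (- k * real n)"
          using k(2)[OF _ J(2)] unfolding s J(1) P_def by simp
      qed
    qed simp
  qed
  define I where "I = (\<integral>z. exp (z\<^sup>2 / 4) \<partial>std_normal_distribution)"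
  have "0 \<le> I" unfolding I_def by (intro Bochner_Integration.integral_nonneg) auto
  have N3: "negligible_seq (\<lambda>n. measure (P n) {z \<in> space (P n). d * sqrt (real n) \<le> z (m n, n)})"
  proof (rule negligible_seq_mono[OF negligible_seq_exp[of "d\<^sup>2 / 4" "I + 1"]])
    show "\<forall>\<^sub>F n in sequentially. measure (P n) {z \<in> space (P n). d * sqrt (real n) \<le> z (m n, n)}
        \<le> (I + 1) * exp (- (d\<^sup>2 / 4) * real n)"
    proof (intro always_eventually allI)
      fix n
      have "measure (P n) {z \<in> space (P n). d * sqrt (real n) \<le> z (m n, n)} \<le> I * exp (- (d * sqrt (real n))\<^sup>2 / 4)"
        unfolding P_def I_def using d by (intro gauss_entry_tail) auto
      also have "\<dots> \<le> (I + 1) * exp (- (d * sqrt (real n))\<^sup>2 / 4)" by (intro mult_right_mono) auto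
      finally show "measure (P n) {z \<in> space (P n). d * sqrt (real n) \<le> z (m n, n)} \<le> (I + 1) * exp (- (d\<^sup>2 / 4) * real n)"
        by (simp add: power_mult_distrib)
    qed
  qed (use d \<open>0 \<le> I\<close> in auto)
  obtain N :: nat where N': "1 / d\<^sup>2 \<le> real N" using real_arch_simple by blast
  show ?thesis
  proof (rule negligible_seq_mono[OF negligible_seq_add[OF negligible_seq_add[OF N1 N2] N3]])
    show "\<forall>\<^sub>F n in sequentially. 1 - measure (M n) {\<omega> \<in> space (M n).
         norm_event (m n) n (S n) c (sqrt (real n) * (sqrt (\<alpha> * f_gar c) + ((\<integral>h. q h \<partial>std_normal_distribution) - \<mu>) / \<rho> - \<epsilon>)) (H n \<omega>)}
      \<le> measure (P n) {z \<in> space (P n). pos_part_norm (m n) c (\<lambda>i. z (i, n)) \<le> a n}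
        + measure (P n) {z \<in> space (P n). (\<Sum>j<n. q (z (m n, j))) \<le> b * real n}
        + measure (P n) {z \<in> space (P n). d * sqrt (real n) \<le> z (m n, n)}"
      using eventually_ge_at_top[of N] eventually_m_pos[OF \<alpha> m] eventually_gt_at_top[of 0]
    proof eventually_elim
      case (elim n)
      note mn = elim(2)
      have "1 / d\<^sup>2 \<le> real n" using N' elim(1) by linarith
      then have "1 \<le> (d * sqrt (real n))\<^sup>2" using d by (simp add: pos_divide_le_eq power_mult_distrib mult.commute)
      then have one: "1 \<le> d * sqrt (real n)" using d power2_le_imp_le[of 1 "d * sqrt (real n)"] by simp
      let ?r = "a n + (b * real n - \<mu> * real n) / (\<rho> * sqrt (real n)) - 1 - d * sqrt (real n)"
      have "(b * real n - \<mu> * real n) / (\<rho> * sqrt (real n)) = ((b - \<mu>) / \<rho>) * (real n / sqrt (real n))"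
        by (simp add: left_diff_distrib)
      also have "(b - \<mu>) / \<rho> = (E - \<mu>) / \<rho> - d"
        using \<rho> by (simp add: b_def field_simps)
      also have "real n / sqrt (real n) = sqrt (real n)" by (rule real_div_sqrt) simp
      finally have "sqrt (real n) * (sqrt (\<alpha> * f_gar c) + (E - \<mu>) / \<rho> - \<epsilon>) \<le> ?r"
        using one unfolding a_def L_def[symmetric] by (simp add: d_def algebra_simps)
      note le = norm_event_measure_mono[OF H mn elim(3) this, where S="S n" and c=c]
      have "1 - measure (M n) {\<omega> \<in> space (M n). norm_event (m n) n (S n) c ?r (H n \<omega>)}
         \<le> measure (P n) {z \<in> space (P n). pos_part_norm (m n) c (\<lambda>i. z (i, n)) \<le> a n}
        + measure (P n) {z \<in> space (P n). (\<Sum>j<n. q (z (m n, j))) \<le> b * real n}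
        + measure (P n) {z \<in> space (P n). d * sqrt (real n) \<le> z (m n, n)}"
        unfolding P_def using \<rho> elim(3)
        by (intro norm_event_probability[OF H mn elim(3) S dual _ q]) auto
      with le show ?case unfolding E_def by linarith
    qed
  qed
qed


corollary box_sphere_norm_event:
  fixes \<alpha> c \<beta> \<epsilon> :: real and m :: "nat \<Rightarrow> nat"
  assumes \<alpha>: "\<alpha> > 0" and m: "\<And>n. \<bar>real (m n) - \<alpha> * real n\<bar> < 1"
    and H: "\<And>n. std_normal_matrix (M n) (m n) n (H n)"
    and \<beta>: "\<beta> > 0" and \<epsilon>: "\<epsilon> > 0"
  shows "negligible_seq (\<lambda>n. 1 - measure (M n) {\<omega> \<in> space (M n).
     norm_event (m n) n (box_sphere \<beta> n) c (sqrt (real n) * (sqrt (\<alpha> * f_gar c) + f_box_hat \<beta> - \<epsilon>)) (H n \<omega>)})"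
proof -
  let ?E = "\<lambda>\<gamma>. \<integral>h. box_lagrangian_min \<gamma> h \<partial>std_normal_distribution"
  obtain \<gamma> where \<gamma>: "\<gamma> \<ge> 0" "f_box_hat \<beta> - \<epsilon> / 2 < 1 / sqrt \<beta> * (?E \<gamma> - \<gamma> * \<beta>)"
    using f_box_hat_approx[OF \<beta>, of "\<epsilon> / 2"] \<epsilon> by auto
  show ?thesis
  proof (rule negligible_seq_mono[OF norm_event_overwhelming[OF \<alpha> m H, of "box_sphere \<beta>" "box_lagrangian_min \<gamma>" "\<gamma> * \<beta>" "sqrt \<beta>" 1 "\<epsilon> / 2" c]])
    show "(\<Sum>j<n. (x j)\<^sup>2) = 1" if "x \<in> box_sphere \<beta> n" for n x using that by (simp add: box_sphere_def)
    show "((\<Sum>j<n. box_lagrangian_min \<gamma> (h j)) - \<gamma> * \<beta> * real n) / (sqrt \<beta> * sqrt (real n)) \<le> (\<Sum>j<n. h j * x j)"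
      if "n > 0" "x \<in> box_sphere \<beta> n" for n x h
      using box_sphere_linear_form_ge[OF that(2) \<beta> that(1) \<gamma>(1), of h] by (simp add: real_sqrt_mult)
    show "\<forall>\<^sub>F n in sequentially. 1 - measure (M n) {\<omega> \<in> space (M n). norm_event (m n) n (box_sphere \<beta> n) c
        (sqrt (real n) * (sqrt (\<alpha> * f_gar c) + f_box_hat \<beta> - \<epsilon>)) (H n \<omega>)}
      \<le> 1 - measure (M n) {\<omega> \<in> space (M n). norm_event (m n) n (box_sphere \<beta> n) c
        (sqrt (real n) * (sqrt (\<alpha> * f_gar c) + (?E \<gamma> - \<gamma> * \<beta>) / sqrt \<beta> - \<epsilon> / 2)) (H n \<omega>)}"
      using eventually_m_pos[OF \<alpha> m] eventually_gt_at_top[of 0]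
    proof eventually_elim
      case (elim n)
      have "sqrt (real n) * (sqrt (\<alpha> * f_gar c) + f_box_hat \<beta> - \<epsilon>)
          \<le> sqrt (real n) * (sqrt (\<alpha> * f_gar c) + (?E \<gamma> - \<gamma> * \<beta>) / sqrt \<beta> - \<epsilon> / 2)"
        using \<gamma>(2) by (intro mult_left_mono) auto
      then show ?case using norm_event_measure_mono[OF H elim] by simp
    qed
  qed (use \<beta> \<epsilon> \<gamma>(1) box_lagrangian_min_quadratic_bound[OF \<gamma>(1)] in auto)
qed

text \<open>
  On the whole sphere \<open>h \<bullet> x\<close> is at least \<open>- (\<parallel>h\<parallel>\<^sup>2 + n) / (2 sqrt n)\<close>, which is about \<open>- sqrt n\<close> and is again
  of separable form.
\<close>

corollary sphere_norm_event:
  fixes \<alpha> c \<epsilon> :: real and m :: "nat \<Rightarrow> nat"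
  assumes \<alpha>: "\<alpha> > 0" and m: "\<And>n. \<bar>real (m n) - \<alpha> * real n\<bar> < 1"
    and H: "\<And>n. std_normal_matrix (M n) (m n) n (H n)"
    and c: "c \<ge> 0" and \<epsilon>: "\<epsilon> > 0"
  shows "negligible_seq (\<lambda>n. 1 - measure (M n) {\<omega> \<in> space (M n).
     norm_event (m n) n {x. (\<Sum>j<n. (x j)\<^sup>2) = 1} c (sqrt (real n) * (sqrt \<alpha> * c - 1 - \<epsilon>)) (H n \<omega>)})"
proof -
  let ?q = "\<lambda>h :: real. - (h\<^sup>2 / 2)"
  have E: "(\<integral>h. ?q h \<partial>std_normal_distribution) = - 1 / 2"
  proof -
    have "(\<integral>h. h\<^sup>2 \<partial>std_normal_distribution) = 1"
      using integral_std_normal_moment_even[of 1] by (subst integral_std_gauss) auto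
    then show ?thesis by simp
  qed
  show ?thesis
  proof (rule negligible_seq_mono[OF norm_event_overwhelming[OF \<alpha> m H, of "\<lambda>n. {x. (\<Sum>j<n. (x j)\<^sup>2) = 1}" ?q "1 / 2" 1 1 \<epsilon> c]])
    show "(\<Sum>j<n. (x j)\<^sup>2) = 1" if "x \<in> {x. (\<Sum>j<n. (x j)\<^sup>2) = 1}" for n x using that by simp
    show "((\<Sum>j<n. ?q (h j)) - 1 / 2 * real n) / (1 * sqrt (real n)) \<le> (\<Sum>j<n. h j * x j)"
      if "n > 0" "x \<in> {x. (\<Sum>j<n. (x j)\<^sup>2) = 1}" for n x h
    proof -
      let ?R = "sqrt (real n)"
      have R: "?R > 0" using that by simp
      have "0 \<le> (\<Sum>j<n. (h j + ?R * x j)\<^sup>2)" by (intro sum_nonneg) auto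
      also have "\<dots> = (\<Sum>j<n. (h j)\<^sup>2) + 2 * ?R * (\<Sum>j<n. h j * x j) + ?R\<^sup>2 * (\<Sum>j<n. (x j)\<^sup>2)"
        by (simp add: power2_sum sum.distrib sum_distrib_left power_mult_distrib mult_ac)
      finally have "(\<Sum>j<n. ?q (h j)) - 1 / 2 * real n \<le> (\<Sum>j<n. h j * x j) * ?R"
        using that by (simp add: sum_negf mult_ac flip: sum_divide_distrib)
      then show ?thesis using R by (simp only: mult_1_left pos_divide_le_eq)
    qed
    show "\<bar>?q h\<bar> \<le> 1 * (1 + h\<^sup>2)" for h by (simp add: add_increasing)
    show "\<forall>\<^sub>F n in sequentially. 1 - measure (M n) {\<omega> \<in> space (M n). norm_event (m n) n {x. (\<Sum>j<n. (x j)\<^sup>2) = 1} c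
        (sqrt (real n) * (sqrt \<alpha> * c - 1 - \<epsilon>)) (H n \<omega>)}
      \<le> 1 - measure (M n) {\<omega> \<in> space (M n). norm_event (m n) n {x. (\<Sum>j<n. (x j)\<^sup>2) = 1} c
        (sqrt (real n) * (sqrt (\<alpha> * f_gar c) + ((\<integral>h. ?q h \<partial>std_normal_distribution) - 1 / 2) / 1 - \<epsilon>)) (H n \<omega>)}"
      using eventually_m_pos[OF \<alpha> m] eventually_gt_at_top[of 0]
    proof eventually_elim
      case (elim n)
      have "sqrt \<alpha> * c \<le> sqrt (\<alpha> * f_gar c)"
        using f_gar_ge_sq[OF c] c \<alpha> by (simp add: real_sqrt_mult mult_left_mono real_le_rsqrt)
      then have "sqrt (real n) * (sqrt \<alpha> * c - 1 - \<epsilon>)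
          \<le> sqrt (real n) * (sqrt (\<alpha> * f_gar c) + ((\<integral>h. ?q h \<partial>std_normal_distribution) - 1 / 2) / 1 - \<epsilon>)"
        unfolding E by (intro mult_left_mono) auto
      then show ?case using norm_event_measure_mono[OF H elim] by simp
    qed
  qed (use \<epsilon> in auto)
qed

section \<open>The maximum over the nonnegative sphere and measurability\<close>

definition nonneg_support :: "nat \<Rightarrow> (nat \<Rightarrow> real) \<Rightarrow> real" where
  "nonneg_support m w = (SUP l\<in>nonneg_sphere m. \<Sum>i<m. l i * w i)"

lemma nonneg_sphere_le_1:
  assumes "l \<in> nonneg_sphere m" "i < m" shows "0 \<le> l i" "l i \<le> 1"
proof -
  show "0 \<le> l i" using assms by (simp add: nonneg_sphere_def)
  have "(l i)\<^sup>2 \<le> (\<Sum>i<m. (l i)\<^sup>2)" using assms(2) by (intro member_le_sum) auto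
  then have "(l i)\<^sup>2 \<le> 1\<^sup>2" using assms(1) by (simp add: nonneg_sphere_def)
  then show "l i \<le> 1" by (rule power2_le_imp_le) simp
qed

lemma nonneg_sphere_inner_abs_le:
  assumes "l \<in> nonneg_sphere m" shows "\<bar>\<Sum>i<m. l i * w i\<bar> \<le> (\<Sum>i<m. \<bar>w i\<bar>)"
proof (rule order_trans[OF sum_abs sum_mono])
  fix i assume "i \<in> {..<m}"
  then have "\<bar>l i\<bar> * \<bar>w i\<bar> \<le> 1 * \<bar>w i\<bar>" using nonneg_sphere_le_1[OF assms, of i] by (intro mult_right_mono) auto
  then show "\<bar>l i * w i\<bar> \<le> \<bar>w i\<bar>" by (simp add: abs_mult)
qed

lemma unit_vector_in_nonneg_sphere:
  assumes "k < m" shows "(\<lambda>i. if i = k then 1 else 0) \<in> nonneg_sphere m"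
proof -
  have "(\<Sum>i<m. (if i = k then 1 else 0 :: real)\<^sup>2) = (\<Sum>i<m. if i = k then 1 else 0)" by (intro sum.cong) auto
  then show ?thesis using assms by (simp add: nonneg_sphere_def)
qed

lemma nonneg_support_upper:
  assumes "l \<in> nonneg_sphere m" shows "(\<Sum>i<m. l i * w i) \<le> nonneg_support m w"
  unfolding nonneg_support_def
proof (rule cSUP_upper[OF assms])
  show "bdd_above ((\<lambda>l. \<Sum>i<m. l i * w i) ` nonneg_sphere m)"
    using nonneg_sphere_inner_abs_le[where w=w] by (intro bdd_aboveI2[of _ _ "\<Sum>i<m. \<bar>w i\<bar>"]) (auto simp: abs_le_iff)
qed

lemma nonneg_support_ge_entry:
  assumes "i < m" shows "w i \<le> nonneg_support m w"
  using nonneg_support_upper[OF unit_vector_in_nonneg_sphere[OF assms], of w] assms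
  by (simp add: if_distrib[of "\<lambda>x. x * _"] cong: if_cong)

lemma nonneg_support_ge_pos_part_norm:
  assumes "0 < pos_part_norm m c v"
  shows "pos_part_norm m c v \<le> nonneg_support m (\<lambda>i. c - v i)"
proof -
  let ?p = "\<lambda>i. max 0 (c - v i)"
  define N where "N = pos_part_norm m c v"
  have N: "N > 0" "(\<Sum>i<m. (?p i)\<^sup>2) = N\<^sup>2" using assms by (simp_all add: N_def sum_nonneg)
  have "(\<Sum>i<m. (?p i / N)\<^sup>2) = (\<Sum>i<m. (?p i)\<^sup>2) / N\<^sup>2" by (simp only: power_divide sum_divide_distrib)
  also have "\<dots> = 1" unfolding N(2) using N(1) by simp
  finally have "(\<lambda>i. ?p i / N) \<in> nonneg_sphere m" using N(1) by (simp add: nonneg_sphere_def)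
  then have "(\<Sum>i<m. ?p i / N * (c - v i)) \<le> nonneg_support m (\<lambda>i. c - v i)" by (rule nonneg_support_upper)
  also have "(\<Sum>i<m. ?p i / N * (c - v i)) = (\<Sum>i<m. (?p i)\<^sup>2) / N"
    unfolding sum_divide_distrib by (intro sum.cong) (auto simp: max_def power2_eq_square)
  also have "\<dots> = N" unfolding N(2) using N(1) by (simp add: power2_eq_square)
  finally show ?thesis by (simp only: N_def)
qed

text \<open>
  The only property of the maximum over \<open>\<lambda>\<close> that measurability needs.
\<close>

lemma nonneg_support_lipschitz:
  assumes "m > 0"
  shows "\<bar>nonneg_support m w - nonneg_support m w'\<bar> \<le> (\<Sum>i<m. \<bar>w i - w' i\<bar>)"
proof -
  have *: "nonneg_support m w \<le> nonneg_support m w' + (\<Sum>i<m. \<bar>w i - w' i\<bar>)" for w w'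
    unfolding nonneg_support_def[of m w]
  proof (rule cSUP_least)
    show "nonneg_sphere m \<noteq> {}" using unit_vector_in_nonneg_sphere[OF assms] by blast
    fix l assume l: "l \<in> nonneg_sphere m"
    have "(\<Sum>i<m. l i * w i) = (\<Sum>i<m. l i * w' i) + (\<Sum>i<m. l i * (w i - w' i))"
      by (simp add: right_diff_distrib sum_subtractf)
    also have "\<dots> \<le> nonneg_support m w' + (\<Sum>i<m. \<bar>w i - w' i\<bar>)"
      using nonneg_support_upper[OF l, of w'] nonneg_sphere_inner_abs_le[OF l, of "\<lambda>i. w i - w' i"] by linarith
    finally show "(\<Sum>i<m. l i * w i) \<le> nonneg_support m w' + (\<Sum>i<m. \<bar>w i - w' i\<bar>)" .
  qed
  have "(\<Sum>i<m. \<bar>w' i - w i\<bar>) = (\<Sum>i<m. \<bar>w i - w' i\<bar>)" by (intro sum.cong) auto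
  then show ?thesis using *[of w w'] *[of w' w] by linarith
qed

lemma continuous_on_nonneg_support:
  fixes w :: "'b::topological_space \<Rightarrow> nat \<Rightarrow> real"
  assumes "m > 0" "\<And>i. i < m \<Longrightarrow> continuous_on T (\<lambda>t. w t i)"
  shows "continuous_on T (\<lambda>t. nonneg_support m (w t))"
  unfolding continuous_on_def
proof
  fix t assume t: "t \<in> T"
  have "((\<lambda>s. \<Sum>i<m. \<bar>w s i - w t i\<bar>) \<longlongrightarrow> (\<Sum>i<m. \<bar>w t i - w t i\<bar>)) (at t within T)"
    using assms(2) t unfolding continuous_on_def by (intro tendsto_intros) auto
  then have "((\<lambda>s. \<Sum>i<m. \<bar>w s i - w t i\<bar>) \<longlongrightarrow> 0) (at t within T)" by simp
  then have "((\<lambda>s. nonneg_support m (w s) - nonneg_support m (w t)) \<longlongrightarrow> 0) (at t within T)"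
    by (rule Lim_null_comparison[rotated]) (simp add: nonneg_support_lipschitz[OF assms(1)])
  then show "((\<lambda>s. nonneg_support m (w s)) \<longlongrightarrow> nonneg_support m (w t)) (at t within T)"
    by (rule LIM_zero_cancel)
qed

lemma nonneg_support_measurable:
  assumes "m > 0" "\<And>i. i < m \<Longrightarrow> (\<lambda>\<omega>. w \<omega> i) \<in> borel_measurable M"
  shows "(\<lambda>\<omega>. nonneg_support m (w \<omega>)) \<in> borel_measurable M"
proof -
  have [measurable]: "nonneg_support m \<in> borel_measurable borel"
    by (intro borel_measurable_continuous_onI continuous_on_nonneg_support assms continuous_on_entry)
  have [measurable]: "(\<lambda>\<omega>. \<lambda>i. if i < m then w \<omega> i else 0) \<in> borel_measurable M"
  proof (rule measurable_coordinatewise_then_product)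
    show "(\<lambda>\<omega>. if i < m then w \<omega> i else 0) \<in> borel_measurable M" for i using assms(2)[of i] by (cases "i < m") auto
  qed
  have "nonneg_support m (w \<omega>) = nonneg_support m (\<lambda>i. if i < m then w \<omega> i else 0)" for \<omega>
    using nonneg_support_lipschitz[OF assms(1), of "w \<omega>" "\<lambda>i. if i < m then w \<omega> i else 0"] by simp
  then show ?thesis by simp
qed

text \<open>
  The nonnegative sphere is empty for \<open>m = 0\<close>, where the two suprema differ.
\<close>

lemma SUP_nonneg_sphere_eq:
  assumes "m > 0"
  shows "(SUP l\<in>nonneg_sphere m. ereal (c * (\<Sum>i<m. l i) - (\<Sum>i<m. l i * v i))) = ereal (nonneg_support m (\<lambda>i. c - v i))"
proof -
  let ?w = "\<lambda>i. c - v i"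
  have eq: "c * (\<Sum>i<m. l i) - (\<Sum>i<m. l i * v i) = (\<Sum>i<m. l i * ?w i)" for l :: "nat \<Rightarrow> real"
    by (simp add: right_diff_distrib sum_subtractf sum_distrib_left mult.commute)
  show ?thesis unfolding eq
  proof (rule antisym)
    show "(SUP l\<in>nonneg_sphere m. ereal (\<Sum>i<m. l i * ?w i)) \<le> ereal (nonneg_support m ?w)"
      by (rule SUP_least) (simp only: ereal_less_eq nonneg_support_upper)
    show "ereal (nonneg_support m ?w) \<le> (SUP l\<in>nonneg_sphere m. ereal (\<Sum>i<m. l i * ?w i))"
    proof (rule ereal_le_epsilon2)
      fix e :: real assume "0 < e"
      then have "nonneg_support m ?w - e < nonneg_support m ?w" by simp
      moreover have "nonneg_sphere m \<noteq> {}" using unit_vector_in_nonneg_sphere[OF assms] by blast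
      ultimately obtain l where l: "l \<in> nonneg_sphere m" "nonneg_support m ?w - e < (\<Sum>i<m. l i * ?w i)"
        unfolding nonneg_support_def[of m ?w]
        using less_cSupD[of "(\<lambda>l. \<Sum>i<m. l i * ?w i) ` nonneg_sphere m"] by blast
      have "ereal (nonneg_support m ?w) \<le> ereal (\<Sum>i<m. l i * ?w i) + ereal e" using l(2) by simp
      also have "\<dots> \<le> (SUP l\<in>nonneg_sphere m. ereal (\<Sum>i<m. l i * ?w i)) + ereal e"
        by (intro add_right_mono SUP_upper l(1))
      finally show "ereal (nonneg_support m ?w) \<le> (SUP l\<in>nonneg_sphere m. ereal (\<Sum>i<m. l i * ?w i)) + ereal e" .
    qed
  qed
qed

lemma le_xi_box_at_iff:
  assumes "m > 0"
  shows "ereal r \<le> xi_box_at \<kappa> m n H \<beta> \<longleftrightarrow> (\<forall>x\<in>box_sphere \<beta> n. r \<le> nonneg_support m (\<lambda>i. \<kappa> / sqrt \<beta> - mat_vec n H x i))"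
  unfolding xi_box_at_def SUP_nonneg_sphere_eq[OF assms] by (simp add: le_INF_iff)

lemma le_xi_box_iff:
  assumes "m > 0"
  shows "ereal r \<le> xi_box \<kappa> m n H \<longleftrightarrow>
     (\<forall>\<beta>\<in>{0<..1}. \<forall>x\<in>box_sphere \<beta> n. r \<le> nonneg_support m (\<lambda>i. \<kappa> / sqrt \<beta> - mat_vec n H x i))"
  unfolding xi_box_def le_INF_iff le_xi_box_at_iff[OF assms] ..

lemma std_normal_matrix_entry_measurable:
  assumes "std_normal_matrix M m n H" "i < m" "j < n"
  shows "(\<lambda>\<omega>. H \<omega> i j) \<in> borel_measurable M"
  using assms distributed_measurable[of M lborel "\<lambda>\<omega>. H \<omega> i j"] by (auto simp: std_normal_matrix_def)

lemma mat_vec_measurable: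
  assumes "std_normal_matrix M m n H" "i < m"
  shows "(\<lambda>\<omega>. mat_vec n (H \<omega>) x i) \<in> borel_measurable M"
  unfolding mat_vec_def using assms std_normal_matrix_entry_measurable
  by (intro borel_measurable_sum borel_measurable_times) auto

lemma sets_nonneg_support_ge:
  fixes T :: "'b::{metric_space, second_countable_topology} set" and x :: "'b \<Rightarrow> nat \<Rightarrow> real"
  assumes H: "std_normal_matrix M m n H" and "m > 0"
    and c: "continuous_on T c" and x: "\<And>j. continuous_on T (\<lambda>t. x t j)"
  shows "{\<omega> \<in> space M. \<forall>t\<in>T. r \<le> nonneg_support m (\<lambda>i. c t - mat_vec n (H \<omega>) (x t) i)} \<in> sets M"
proof (rule sets_Collect_ball_ge)
  show "(\<lambda>\<omega>. nonneg_support m (\<lambda>i. c t - mat_vec n (H \<omega>) (x t) i)) \<in> borel_measurable M" for t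
    using assms by (intro nonneg_support_measurable borel_measurable_diff mat_vec_measurable[OF H]) auto
  show "continuous_on T (\<lambda>t. nonneg_support m (\<lambda>i. c t - mat_vec n (H \<omega>) (x t) i))" for \<omega>
    unfolding mat_vec_def using assms by (intro continuous_on_nonneg_support continuous_intros) auto
qed

lemma sets_xi_box_at_ge:
  assumes H: "std_normal_matrix M m n H" and "m > 0"
  shows "{\<omega> \<in> space M. ereal r \<le> xi_box_at \<kappa> m n (H \<omega>) \<beta>} \<in> sets M"
  unfolding le_xi_box_at_iff[OF assms(2)]
  using sets_nonneg_support_ge[OF assms, of "box_sphere \<beta> n" "\<lambda>_. \<kappa> / sqrt \<beta>" "\<lambda>x. x" r]
  by (simp add: continuous_on_entry)

lemma sets_xi_box_ge:
  assumes H: "std_normal_matrix M m n H" and "m > 0"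
  shows "{\<omega> \<in> space M. ereal r \<le> xi_box \<kappa> m n (H \<omega>)} \<in> sets M"
proof -
  define T where "T = Sigma {0<..1::real} (\<lambda>\<beta>. box_sphere \<beta> n)"
  have "{\<omega> \<in> space M. \<forall>t\<in>T. r \<le> nonneg_support m (\<lambda>i. \<kappa> / sqrt (fst t) - mat_vec n (H \<omega>) (snd t) i)} \<in> sets M"
  proof (rule sets_nonneg_support_ge[OF assms])
    show "continuous_on T (\<lambda>t. \<kappa> / sqrt (fst t))"
      by (intro continuous_intros) (auto simp: T_def)
    show "continuous_on T (\<lambda>t. snd t j)" for j
      by (rule continuous_on_compose2[OF continuous_on_entry[of UNIV] continuous_on_snd[OF continuous_on_id]]) auto
  qed
  moreover have "(\<forall>t\<in>T. r \<le> nonneg_support m (\<lambda>i. \<kappa> / sqrt (fst t) - mat_vec n (H \<omega>) (snd t) i))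
     \<longleftrightarrow> ereal r \<le> xi_box \<kappa> m n (H \<omega>)" for \<omega>
    unfolding le_xi_box_iff[OF assms(2)] by (auto simp: T_def)
  ultimately show ?thesis by simp
qed

lemma pos_part_norm_eq_0_iff: "pos_part_norm m c v = 0 \<longleftrightarrow> (\<forall>i<m. c \<le> v i)"
proof -
  have "max 0 (c - x) = 0 \<longleftrightarrow> c \<le> x" for x by (simp add: max_def)
  then show ?thesis by (auto simp: sum_nonneg_eq_0_iff)
qed

text \<open>
  By compactness of the box, infeasibility means that the length of the positive part of \<open>\<kappa> - H x\<close> is bounded
  below by some \<open>1 / (k + 1)\<close> on the box.  Coordinates beyond \<open>n\<close> are set to 0 to make the box compact as a
  set of functions on \<open>nat\<close>.
\<close>

lemma sets_infeasible:
  assumes H: "std_normal_matrix M m n H"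
  shows "{\<omega> \<in> space M. \<not> box_feasible \<kappa> m n (H \<omega>)} \<in> sets M"
proof -
  define B where "B = PiE UNIV (\<lambda>j. if j < n then {- 1 / sqrt (real n) .. 1 / sqrt (real n)} else {0::real})"
  have "compactin (product_topology (\<lambda>_. euclidean) UNIV) B"
    unfolding B_def compactin_PiE by (auto simp: compactin_euclidean_iff)
  then have B: "compact B" by (simp add: euclidean_product_topology compactin_euclidean_iff)
  have "(\<lambda>_. 0) \<in> B" by (auto simp: B_def)
  then have ne: "B \<noteq> {}" by blast
  have cont: "continuous_on B (\<lambda>x. pos_part_norm m \<kappa> (mat_vec n A x))" for A
    unfolding mat_vec_def by (intro continuous_intros)
  have iff: "(\<not> box_feasible \<kappa> m n A) \<longleftrightarrow> (\<exists>k::nat. \<forall>x\<in>B. 1 / real (Suc k) \<le> pos_part_norm m \<kappa> (mat_vec n A x))" for A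
  proof
    assume nf: "\<not> box_feasible \<kappa> m n A"
    obtain x where x: "x \<in> B" "\<And>y. y \<in> B \<Longrightarrow> pos_part_norm m \<kappa> (mat_vec n A x) \<le> pos_part_norm m \<kappa> (mat_vec n A y)"
      using continuous_attains_inf[OF B ne cont] by blast
    have "\<forall>j<n. x j \<in> {- 1 / sqrt (real n) .. 1 / sqrt (real n)}"
    proof (intro allI impI)
      fix j assume "j < n"
      have "x j \<in> (if j < n then {- 1 / sqrt (real n) .. 1 / sqrt (real n)} else {0::real})"
        using x(1) unfolding B_def by (rule PiE_mem) simp
      then show "x j \<in> {- 1 / sqrt (real n) .. 1 / sqrt (real n)}" using \<open>j < n\<close> by simp
    qed
    then have "pos_part_norm m \<kappa> (mat_vec n A x) \<noteq> 0"
      using nf unfolding pos_part_norm_eq_0_iff box_feasible_def by blast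
    moreover have "0 \<le> pos_part_norm m \<kappa> (mat_vec n A x)" by (simp add: sum_nonneg)
    ultimately have "0 < pos_part_norm m \<kappa> (mat_vec n A x)" by linarith
    then obtain k where "1 / real (Suc k) < pos_part_norm m \<kappa> (mat_vec n A x)" using nat_approx_posE by blast
    then show "\<exists>k::nat. \<forall>x\<in>B. 1 / real (Suc k) \<le> pos_part_norm m \<kappa> (mat_vec n A x)"
      using x(2) by (meson less_le_trans less_imp_le)
  next
    assume "\<exists>k::nat. \<forall>x\<in>B. 1 / real (Suc k) \<le> pos_part_norm m \<kappa> (mat_vec n A x)"
    then obtain k :: nat where k: "\<And>x. x \<in> B \<Longrightarrow> 1 / real (Suc k) \<le> pos_part_norm m \<kappa> (mat_vec n A x)" by blast
    show "\<not> box_feasible \<kappa> m n A"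
    proof
      assume "box_feasible \<kappa> m n A"
      then obtain x where x: "\<forall>j<n. x j \<in> {- 1 / sqrt (real n) .. 1 / sqrt (real n)}" "\<forall>i<m. \<kappa> \<le> mat_vec n A x i"
        unfolding box_feasible_def by blast
      define y where "y = (\<lambda>j. if j < n then x j else 0)"
      have "y \<in> B" using x(1) by (auto simp: y_def B_def)
      moreover have "mat_vec n A y = mat_vec n A x" by (simp add: mat_vec_def y_def fun_eq_iff)
      then have "pos_part_norm m \<kappa> (mat_vec n A y) = 0" unfolding pos_part_norm_eq_0_iff using x(2) by simp
      ultimately show False using k[of y] by simp
    qed
  qed
  have "(\<lambda>\<omega>. pos_part_norm m \<kappa> (mat_vec n (H \<omega>) x)) \<in> borel_measurable M" for x
  proof -
    have "(\<lambda>\<omega>. \<Sum>i<m. (max 0 (\<kappa> - mat_vec n (H \<omega>) x i))\<^sup>2) \<in> borel_measurable M"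
      by (intro borel_measurable_sum borel_measurable_power borel_measurable_max
          borel_measurable_diff borel_measurable_const mat_vec_measurable[OF H]) auto
    then show ?thesis by measurable
  qed
  then have "{\<omega> \<in> space M. \<forall>x\<in>B. 1 / real (Suc k) \<le> pos_part_norm m \<kappa> (mat_vec n (H \<omega>) x)} \<in> sets M" for k
    by (intro sets_Collect_ball_ge cont)
  then show ?thesis unfolding iff by (rule sets.sets_Collect_countable_Ex)
qed

section \<open>Uniformity in the squared norm\<close>

lemma norm_event_imp_support_ge:
  assumes E: "norm_event m n S c r A" and r: "0 < r" and c: "c \<le> c'" and x: "x \<in> S"
  shows "r \<le> pos_part_norm m c' (mat_vec n A x)" "r \<le> nonneg_support m (\<lambda>i. c' - mat_vec n A x i)"
proof -
  have "r \<le> pos_part_norm m c (mat_vec n A x)" using E x by (simp add: norm_event_def)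
  also have "\<dots> \<le> pos_part_norm m c' (mat_vec n A x)"
    using c by (intro real_sqrt_le_mono sum_mono power_mono) auto
  finally show "r \<le> pos_part_norm m c' (mat_vec n A x)" .
  also have "\<dots> \<le> nonneg_support m (\<lambda>i. c' - mat_vec n A x i)"
    using r \<open>r \<le> pos_part_norm m c' (mat_vec n A x)\<close> by (intro nonneg_support_ge_pos_part_norm) linarith
  finally show "r \<le> nonneg_support m (\<lambda>i. c' - mat_vec n A x i)" .
qed

text \<open>
  If some coordinate of \<open>A x\<close> is below \<open>c\<close>, the unit vector of this coordinate is a good choice of \<open>\<lambda>\<close>.
\<close>

lemma norm_event_imp_support_ge_neg:
  assumes E: "norm_event m n S c r A" and r: "0 < r" and c: "0 \<le> c'" and x: "x \<in> S"
  shows "- c \<le> nonneg_support m (\<lambda>i. c' - mat_vec n A x i)"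
proof -
  have "r \<le> pos_part_norm m c (mat_vec n A x)" using E x by (simp only: norm_event_def)
  then have "pos_part_norm m c (mat_vec n A x) \<noteq> 0" using r by linarith
  then obtain i where i: "i < m" "mat_vec n A x i < c" unfolding pos_part_norm_eq_0_iff by (auto simp: not_le)
  have "- c \<le> c' - mat_vec n A x i" using i(2) c by linarith
  also have "\<dots> \<le> nonneg_support m (\<lambda>i. c' - mat_vec n A x i)"
    using nonneg_support_ge_entry[OF i(1), of "\<lambda>i. c' - mat_vec n A x i"] .
  finally show ?thesis .
qed

lemma (in prob_space) prob_finite_inter_ge:
  assumes "finite A" "\<And>a. a \<in> A \<Longrightarrow> {\<omega> \<in> space M. P a \<omega>} \<in> events"
  shows "1 - prob {\<omega> \<in> space M. \<forall>a\<in>A. P a \<omega>} \<le> (\<Sum>a\<in>A. 1 - prob {\<omega> \<in> space M. P a \<omega>})"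
proof -
  have s: "{\<omega> \<in> space M. \<forall>a\<in>A. P a \<omega>} \<in> events"
    using assms by (intro sets.sets_Collect_finite_All) auto
  have "1 - prob {\<omega> \<in> space M. \<forall>a\<in>A. P a \<omega>} = prob (space M - {\<omega> \<in> space M. \<forall>a\<in>A. P a \<omega>})"
    using prob_compl[OF s] by simp
  also have "space M - {\<omega> \<in> space M. \<forall>a\<in>A. P a \<omega>} = (\<Union>a\<in>A. space M - {\<omega> \<in> space M. P a \<omega>})" by auto
  also have "prob \<dots> \<le> (\<Sum>a\<in>A. prob (space M - {\<omega> \<in> space M. P a \<omega>}))"
    using assms by (intro finite_measure_subadditive_finite) auto
  also have "\<dots> = (\<Sum>a\<in>A. 1 - prob {\<omega> \<in> space M. P a \<omega>})"
    using assms(2) by (intro sum.cong refl prob_compl) auto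
  finally show ?thesis .
qed

lemma negligible_seq_event_mono:
  assumes E: "negligible_seq (\<lambda>n. 1 - measure (M n) {\<omega> \<in> space (M n). P n \<omega>})"
    and M: "\<And>n. prob_space (M n)"
    and imp: "\<forall>\<^sub>F n in sequentially. \<forall>\<omega>\<in>space (M n). P n \<omega> \<longrightarrow> Q n \<omega>"
    and Q: "\<forall>\<^sub>F n in sequentially. {\<omega> \<in> space (M n). Q n \<omega>} \<in> sets (M n)"
  shows "negligible_seq (\<lambda>n. 1 - measure (M n) {\<omega> \<in> space (M n). Q n \<omega>})"
proof (rule negligible_seq_mono[OF E])
  show "\<forall>\<^sub>F n in sequentially. 1 - measure (M n) {\<omega> \<in> space (M n). Q n \<omega>} \<le> 1 - measure (M n) {\<omega> \<in> space (M n). P n \<omega>}"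
    using imp Q
  proof eventually_elim
    case (elim n)
    interpret prob_space "M n" by (rule M)
    have "measure (M n) {\<omega> \<in> space (M n). P n \<omega>} \<le> measure (M n) {\<omega> \<in> space (M n). Q n \<omega>}"
      using elim by (intro finite_measure_mono) auto
    then show ?case by simp
  qed
qed

lemma box_sphere_mono:
  assumes "0 < b" "b \<le> \<beta>" "n > 0" shows "box_sphere \<beta> n \<subseteq> box_sphere b n"
proof
  fix x assume x: "x \<in> box_sphere \<beta> n"
  have "sqrt (b * real n) \<le> sqrt (\<beta> * real n)" using assms by simp
  moreover have "0 < sqrt (b * real n)" using assms by simp
  ultimately have "1 / sqrt (\<beta> * real n) \<le> 1 / sqrt (b * real n)" by (intro divide_left_mono mult_pos_pos) auto
  then show "x \<in> box_sphere b n" using x by (force simp: box_sphere_def)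
qed

text \<open>
  With \<open>R = 1 / sqrt \<beta>\<close>, the interval \<open>1 \<le> R < 1 + K d\<close> is cut into pieces of length \<open>d\<close>.  On the piece from
  \<open>1 + k d\<close> to \<open>1 + (k + 1) d\<close> the box sphere of \<open>\<beta>\<close> lies in the one for the right end point, and \<open>\<kappa> R\<close> is at
  least \<open>c k\<close>, its value at the left end point.  The loss in \<open>sqrt (\<alpha> f_gar)\<close> is at most \<open>sqrt \<alpha> \<kappa> d\<close>, which \<open>d\<close> is chosen
  to make \<open>\<eta> / 2\<close>.  For \<open>R \<ge> 1 + K d\<close> the bound for the whole sphere at \<open>c = \<kappa> (1 + K d)\<close> is at least \<open>\<tau>\<close>.
\<close>

theorem uniform_norm_event:
  fixes \<alpha> \<kappa> \<tau> \<eta> :: real and m :: "nat \<Rightarrow> nat"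
  assumes \<alpha>: "\<alpha> > 0" and \<kappa>: "\<kappa> > 0" and \<eta>: "\<eta> > 0"
    and m: "\<And>n. \<bar>real (m n) - \<alpha> * real n\<bar> < 1"
    and H: "\<And>n. std_normal_matrix (M n) (m n) n (H n)"
    and \<tau>: "\<And>\<beta>. 0 < \<beta> \<Longrightarrow> \<beta> \<le> 1 \<Longrightarrow> \<tau> + \<eta> \<le> sqrt (\<alpha> * f_gar (\<kappa> / sqrt \<beta>)) + f_box_hat \<beta>"
    and \<tau>0: "\<tau> > 0"
  obtains E where "negligible_seq (\<lambda>n. 1 - measure (M n) {\<omega> \<in> space (M n). E n (H n \<omega>)})"
    "\<And>n A \<beta> x. n > 0 \<Longrightarrow> E n A \<Longrightarrow> 0 < \<beta> \<Longrightarrow> \<beta> \<le> 1 \<Longrightarrow> x \<in> box_sphere \<beta> n \<Longrightarrow>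
       sqrt (real n) * \<tau> \<le> pos_part_norm (m n) (\<kappa> / sqrt \<beta>) (mat_vec n A x) \<and>
       sqrt (real n) * \<tau> \<le> nonneg_support (m n) (\<lambda>i. \<kappa> / sqrt \<beta> - mat_vec n A x i)"
proof -
  define d where "d = \<eta> / (2 * (sqrt \<alpha> * \<kappa>))"
  have d: "d > 0" "sqrt \<alpha> * (\<kappa> * d) = \<eta> / 2" using \<alpha> \<kappa> \<eta> by (auto simp: d_def)
  obtain K :: nat where K: "(\<tau> + 2) / (sqrt \<alpha> * \<kappa> * d) \<le> real K" using real_arch_simple by blast
  have K': "\<tau> + 2 \<le> sqrt \<alpha> * (\<kappa> * (1 + real K * d))"
  proof -
    have "0 < sqrt \<alpha> * \<kappa> * d" using \<alpha> \<kappa> d by simp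
    then have "\<tau> + 2 \<le> real K * (sqrt \<alpha> * \<kappa> * d)" using K by (simp add: pos_divide_le_eq)
    also have "\<dots> \<le> sqrt \<alpha> * (\<kappa> * (1 + real K * d))" using \<alpha> \<kappa> by (simp add: algebra_simps)
    finally show ?thesis .
  qed
  define b where "b k = 1 / (1 + real (Suc k) * d)\<^sup>2" for k :: nat
  define S where "S k n = (if k < K then box_sphere (b k) n else {x. (\<Sum>j<n. (x j)\<^sup>2) = 1})" for k n
  define c where "c k = \<kappa> * (1 + real k * d)" for k :: nat
  define P where "P k n A = norm_event (m n) n (S k n) (c k) (sqrt (real n) * \<tau>) A" for k n A
  have M: "prob_space (M n)" for n using H by (simp add: std_normal_matrix_def)
  have pos: "\<forall>\<^sub>F n in sequentially. m n > 0 \<and> n > 0"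
    using eventually_m_pos[OF \<alpha> m] eventually_gt_at_top[of 0] by eventually_elim simp
  have sets: "\<forall>\<^sub>F n in sequentially. {\<omega> \<in> space (M n). P k n (H n \<omega>)} \<in> sets (M n)" for k
    using pos by eventually_elim (auto simp: P_def intro: sets_norm_event[OF H])
  have N: "negligible_seq (\<lambda>n. 1 - measure (M n) {\<omega> \<in> space (M n). P k n (H n \<omega>)})" for k
  proof (cases "k < K")
    case True
    let ?q = "1 + real (Suc k) * d"
    have q: "?q \<ge> 1" using d by simp
    then have b: "0 < b k" "b k \<le> 1" "1 / sqrt (b k) = ?q"
      by (auto simp: b_def real_sqrt_divide power_le_one_iff)
    have "\<kappa> / sqrt (b k) = c k + \<kappa> * d"
    proof -
      have "\<kappa> / sqrt (b k) = \<kappa> * (1 / sqrt (b k))" by simp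
      then show ?thesis unfolding b(3) c_def by (simp add: algebra_simps)
    qed
    then have "sqrt (\<alpha> * f_gar (\<kappa> / sqrt (b k))) \<le> sqrt \<alpha> * (sqrt (f_gar (c k)) + \<kappa> * d)"
      using sqrt_f_gar_lipschitz[of "\<kappa> * d" "c k"] \<kappa> d \<alpha> by (simp add: real_sqrt_mult mult_left_mono)
    also have "\<dots> = sqrt (\<alpha> * f_gar (c k)) + \<eta> / 2" using d(2) by (simp add: real_sqrt_mult distrib_left)
    finally have "\<tau> \<le> sqrt (\<alpha> * f_gar (c k)) + f_box_hat (b k) - \<eta> / 2" using \<tau>[OF b(1,2)] by linarith
    then have le: "sqrt (real n) * \<tau> \<le> sqrt (real n) * (sqrt (\<alpha> * f_gar (c k)) + f_box_hat (b k) - \<eta> / 2)" for n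
      by (intro mult_left_mono) auto
    have "P k n A" if "norm_event (m n) n (box_sphere (b k) n) (c k)
        (sqrt (real n) * (sqrt (\<alpha> * f_gar (c k)) + f_box_hat (b k) - \<eta> / 2)) A" for n A
      using norm_event_mono[OF that le] True by (simp only: P_def S_def if_True)
    then show ?thesis using \<eta>
      by (intro negligible_seq_event_mono[OF box_sphere_norm_event[OF \<alpha> m H b(1), of "\<eta> / 2" "c k"] M _ sets]
          always_eventually allI ballI impI) simp
  next
    case False
    have "c k \<ge> 0" using \<kappa> d by (simp add: c_def)
    have "sqrt \<alpha> * (\<kappa> * (1 + real K * d)) \<le> sqrt \<alpha> * c k"
      using False \<alpha> \<kappa> d unfolding c_def by (intro mult_left_mono) auto
    then have le: "sqrt (real n) * \<tau> \<le> sqrt (real n) * (sqrt \<alpha> * c k - 1 - 1)" for n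
      using K' by (intro mult_left_mono) auto
    have "P k n A" if "norm_event (m n) n {x. (\<Sum>j<n. (x j)\<^sup>2) = 1} (c k)
        (sqrt (real n) * (sqrt \<alpha> * c k - 1 - 1)) A" for n A
      using norm_event_mono[OF that le] False by (simp only: P_def S_def if_False)
    then show ?thesis
      by (intro negligible_seq_event_mono[OF sphere_norm_event[OF \<alpha> m H \<open>c k \<ge> 0\<close>, of 1] M _ sets]
          always_eventually allI ballI impI) simp
  qed
  define E where "E n A \<longleftrightarrow> (\<forall>k\<in>{..K}. P k n A)" for n A
  show ?thesis
  proof (rule that)
    show "negligible_seq (\<lambda>n. 1 - measure (M n) {\<omega> \<in> space (M n). E n (H n \<omega>)})"
    proof (rule negligible_seq_mono[OF negligible_seq_sum[of "{..K}", OF _ N]])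
      show "\<forall>\<^sub>F n in sequentially. 1 - measure (M n) {\<omega> \<in> space (M n). E n (H n \<omega>)}
          \<le> (\<Sum>k\<le>K. 1 - measure (M n) {\<omega> \<in> space (M n). P k n (H n \<omega>)})"
        using pos
      proof eventually_elim
        case (elim n)
        interpret prob_space "M n" by (rule M)
        show ?case unfolding E_def
          using elim by (intro prob_finite_inter_ge) (auto simp: P_def intro: sets_norm_event[OF H])
      qed
    qed simp
    fix n A \<beta> x
    assume n: "n > 0" and E: "E n A" and \<beta>: "0 < \<beta>" "\<beta> \<le> 1" and x: "x \<in> box_sphere \<beta> n"
    define R where "R = 1 / sqrt \<beta>"
    have R: "R \<ge> 1" "\<beta> = 1 / R\<^sup>2" "\<kappa> / sqrt \<beta> = \<kappa> * R"
      using \<beta> by (auto simp: R_def power_divide)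
    have r: "0 < sqrt (real n) * \<tau>" using n \<tau>0 by simp
    have "\<exists>k\<le>K. c k \<le> \<kappa> / sqrt \<beta> \<and> x \<in> S k n"
    proof (cases "1 + real K * d \<le> R")
      case True
      then have "c K \<le> \<kappa> / sqrt \<beta>" unfolding c_def R(3) using \<kappa> by (intro mult_left_mono) auto
      moreover have "x \<in> S K n" using x by (auto simp: S_def box_sphere_def)
      ultimately show ?thesis by blast
    next
      case False
      define k where "k = nat \<lfloor>(R - 1) / d\<rfloor>"
      have "0 \<le> (R - 1) / d" using R(1) d by simp
      then have k: "real k \<le> (R - 1) / d" "(R - 1) / d < real (Suc k)"
        unfolding k_def by linarith+
      have k1: "1 + real k * d \<le> R" "R < 1 + real (Suc k) * d"
        using k d by (simp_all only: pos_le_divide_eq pos_divide_less_eq)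
      have "real k * d < real K * d" using k1(1) False by linarith
      then have kK: "k < K" using d by simp
      have "b k \<le> \<beta>"
        unfolding b_def R(2) using k1(2) R(1) by (intro divide_left_mono power_mono mult_pos_pos) auto
      moreover have "0 < 1 + real (Suc k) * d" using k1(2) R(1) by linarith
      then have "0 < b k" unfolding b_def by (intro divide_pos_pos zero_less_power) auto
      ultimately have "x \<in> box_sphere (b k) n" using box_sphere_mono[of "b k" \<beta> n] n x by blast
      moreover have "c k \<le> \<kappa> / sqrt \<beta>" unfolding c_def R(3) using \<kappa> k1(1) by (intro mult_left_mono) auto
      ultimately show ?thesis using kK by (intro exI[of _ k]) (auto simp: S_def)
    qed
    then obtain k where k: "k \<le> K" "c k \<le> \<kappa> / sqrt \<beta>" "x \<in> S k n" by blast
    have "norm_event (m n) n (S k n) (c k) (sqrt (real n) * \<tau>) A" using E k(1) by (simp add: E_def P_def)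
    from norm_event_imp_support_ge[OF this r k(2,3)]
    show "sqrt (real n) * \<tau> \<le> pos_part_norm (m n) (\<kappa> / sqrt \<beta>) (mat_vec n A x) \<and>
       sqrt (real n) * \<tau> \<le> nonneg_support (m n) (\<lambda>i. \<kappa> / sqrt \<beta> - mat_vec n A x i)" by blast
  qed
qed

text \<open>
  A negative level of order \<open>sqrt n\<close> lies below every constant eventually, so it suffices that every unit vector \<open>x\<close> has a
  coordinate of \<open>H x\<close> below the constant \<open>c\<close>.  The value \<open>c = 3 / sqrt \<alpha>\<close> makes \<open>sqrt \<alpha> * c - 1\<close>, the bound
  on the sphere, exceed the slack 1.
\<close>

lemma negative_level_event:
  fixes \<alpha> \<kappa> :: real and m :: "nat \<Rightarrow> nat"
  assumes \<alpha>: "\<alpha> > 0" and \<kappa>: "\<kappa> > 0"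
    and m: "\<And>n. \<bar>real (m n) - \<alpha> * real n\<bar> < 1"
    and H: "\<And>n. std_normal_matrix (M n) (m n) n (H n)"
    and t: "t < 0" and \<xi>: "\<forall>\<^sub>F n in sequentially. \<xi> n \<le> sqrt (real n) * t"
  obtains E where "negligible_seq (\<lambda>n. 1 - measure (M n) {\<omega> \<in> space (M n). E n (H n \<omega>)})"
    "\<forall>\<^sub>F n in sequentially. \<forall>A \<beta> x. E n A \<longrightarrow> 0 < \<beta> \<longrightarrow> x \<in> box_sphere \<beta> n \<longrightarrow>
       \<xi> n \<le> nonneg_support (m n) (\<lambda>i. \<kappa> / sqrt \<beta> - mat_vec n A x i)"
proof -
  define c where "c = 3 / sqrt \<alpha>"
  have c: "c \<ge> 0" "sqrt \<alpha> * c = 3" using \<alpha> by (auto simp: c_def)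
  define E where "E n A \<longleftrightarrow> norm_event (m n) n {x. (\<Sum>j<n. (x j)\<^sup>2) = 1} c (sqrt (real n) * (sqrt \<alpha> * c - 1 - 1)) A" for n A
  obtain N :: nat where N: "(c / t)\<^sup>2 \<le> real N" using real_arch_simple by blast
  show ?thesis
  proof (rule that)
    show "negligible_seq (\<lambda>n. 1 - measure (M n) {\<omega> \<in> space (M n). E n (H n \<omega>)})"
      unfolding E_def by (rule sphere_norm_event[OF \<alpha> m H c(1)]) simp
    show "\<forall>\<^sub>F n in sequentially. \<forall>A \<beta> x. E n A \<longrightarrow> 0 < \<beta> \<longrightarrow> x \<in> box_sphere \<beta> n \<longrightarrow>
       \<xi> n \<le> nonneg_support (m n) (\<lambda>i. \<kappa> / sqrt \<beta> - mat_vec n A x i)"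
      using \<xi> eventually_ge_at_top[of N] eventually_gt_at_top[of 0]
    proof eventually_elim
      case (elim n)
      have "(c / t)\<^sup>2 \<le> real n" using N elim(2) by linarith
      then have "\<bar>c / t\<bar> \<le> sqrt (real n)" by (intro real_le_rsqrt) (simp only: power2_abs)
      then have "c / - t \<le> sqrt (real n)" by linarith
      then have "c \<le> sqrt (real n) * - t" using t pos_divide_le_eq[of "- t" c "sqrt (real n)"] by simp
      then have xi: "\<xi> n \<le> - c" using elim(1) by linarith
      have r: "0 < sqrt (real n) * (sqrt \<alpha> * c - 1 - 1)" using elim(3) by (simp add: c(2))
      show ?case
      proof (intro allI impI)
        fix A \<beta> x assume A: "E n A" "0 < \<beta>" "x \<in> box_sphere \<beta> n"
        have "- c \<le> nonneg_support (m n) (\<lambda>i. \<kappa> / sqrt \<beta> - mat_vec n A x i)"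
          using A \<kappa> by (intro norm_event_imp_support_ge_neg[OF _ r]) (auto simp: E_def box_sphere_def)
        then show "\<xi> n \<le> nonneg_support (m n) (\<lambda>i. \<kappa> / sqrt \<beta> - mat_vec n A x i)" using xi by linarith
      qed
    qed
  qed
qed

text \<open>
  The factors \<open>1 - eps_m\<close> and \<open>1 + eps_n\<close> lower the threshold, since \<open>f_gar\<close> is nonnegative and \<open>f_box_hat\<close> is
  nonpositive; what remains as slack is \<open>eps_g\<close>.
\<close>

lemma box_threshold_le:
  assumes "\<alpha> > 0" "eps_m > 0" "eps_n > 0" "\<beta> > 0"
  shows "box_threshold \<alpha> \<kappa> eps_m eps_n eps_g \<beta> + eps_g \<le> sqrt (\<alpha> * f_gar (\<kappa> / sqrt \<beta>)) + f_box_hat \<beta>"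
proof -
  have "0 \<le> eps_m * sqrt (\<alpha> * f_gar (\<kappa> / sqrt \<beta>))"
    using assms f_gar_nonneg by (intro mult_nonneg_nonneg) auto
  moreover have "eps_n * f_box_hat \<beta> \<le> 0" using assms f_box_hat_le_0 by (intro mult_nonneg_nonpos) auto
  ultimately show ?thesis by (simp add: box_threshold_def algebra_simps)
qed

lemma infeasible_if_pos_part_norm_pos:
  assumes "m > 0" "n > 0" "\<kappa> > 0"
    and pos: "\<And>\<beta> x. 0 < \<beta> \<Longrightarrow> \<beta> \<le> 1 \<Longrightarrow> x \<in> box_sphere \<beta> n \<Longrightarrow> 0 < pos_part_norm m (\<kappa> / sqrt \<beta>) (mat_vec n A x)"
  shows "\<not> box_feasible \<kappa> m n A"
proof
  assume "box_feasible \<kappa> m n A"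
  then obtain y where yb: "\<forall>j<n. y j \<in> {- 1 / sqrt (real n) .. 1 / sqrt (real n)}"
      and yf: "\<forall>i<m. \<kappa> \<le> mat_vec n A y i"
    unfolding box_feasible_def by blast
  have y: "\<bar>y j\<bar> \<le> 1 / sqrt (real n)" if "j < n" for j
  proof -
    have "- 1 / sqrt (real n) \<le> y j" "y j \<le> 1 / sqrt (real n)" using yb that by auto
    then show ?thesis by (simp add: abs_le_iff)
  qed
  define \<beta> where "\<beta> = (\<Sum>j<n. (y j)\<^sup>2)"
  have "\<beta> \<noteq> 0"
  proof
    assume "\<beta> = 0"
    then have "\<And>j. j < n \<Longrightarrow> y j = 0" by (simp add: \<beta>_def sum_nonneg_eq_0_iff)
    then have "mat_vec n A y 0 = 0" by (simp add: mat_vec_def)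
    then show False using yf assms(1,3) by force
  qed
  moreover have "\<beta> \<ge> 0" unfolding \<beta>_def by (intro sum_nonneg) auto
  ultimately have \<beta>0: "\<beta> > 0" by simp
  have "(y j)\<^sup>2 \<le> 1 / real n" if "j < n" for j
  proof -
    have "\<bar>y j\<bar>\<^sup>2 \<le> (1 / sqrt (real n))\<^sup>2" using y[OF that] by (intro power_mono) auto
    then show ?thesis by (simp add: power_divide)
  qed
  then have "\<beta> \<le> (\<Sum>j<n. 1 / real n)" unfolding \<beta>_def by (intro sum_mono) auto
  then have \<beta>1: "\<beta> \<le> 1" using assms(2) by simp
  define x where "x = (\<lambda>j. y j / sqrt \<beta>)"
  have "(\<Sum>j<n. (x j)\<^sup>2) = 1"
    using \<beta>0 unfolding x_def power_divide by (simp flip: sum_divide_distrib \<beta>_def)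
  moreover have "- 1 / sqrt (\<beta> * real n) \<le> x j \<and> x j \<le> 1 / sqrt (\<beta> * real n)" if "j < n" for j
  proof -
    have "\<bar>x j\<bar> = \<bar>y j\<bar> / sqrt \<beta>" using \<beta>0 by (simp add: x_def abs_divide)
    also have "\<dots> \<le> (1 / sqrt (real n)) / sqrt \<beta>"
      using y[OF that] \<beta>0 by (intro divide_right_mono) auto
    also have "\<dots> = 1 / sqrt (\<beta> * real n)" by (simp add: real_sqrt_mult)
    finally show ?thesis by (simp add: abs_le_iff)
  qed
  ultimately have "x \<in> box_sphere \<beta> n" by (simp add: box_sphere_def)
  then have "0 < pos_part_norm m (\<kappa> / sqrt \<beta>) (mat_vec n A x)" by (rule pos[OF \<beta>0 \<beta>1])
  moreover have "mat_vec n A x i = mat_vec n A y i / sqrt \<beta>" for i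
    unfolding mat_vec_def x_def by (simp add: sum_divide_distrib)
  then have "pos_part_norm m (\<kappa> / sqrt \<beta>) (mat_vec n A x) = 0"
    unfolding pos_part_norm_eq_0_iff using yf \<beta>0 by (simp add: divide_right_mono)
  ultimately show False by simp
qed

theorem theorem10:
  fixes \<alpha> \<kappa> eps_m eps_n eps_g :: real
    and m :: "nat \<Rightarrow> nat"
    and M :: "nat \<Rightarrow> 'a measure"
    and H :: "nat \<Rightarrow> 'a \<Rightarrow> nat \<Rightarrow> nat \<Rightarrow> real"
  assumes "\<alpha> > 0" and "\<kappa> > 0" and "eps_m > 0" and "eps_n > 0" and "eps_g > 0"
    and "\<And>n. \<bar>real (m n) - \<alpha> * real n\<bar> < 1"
    and "\<And>n. std_normal_matrix (M n) (m n) n (H n)"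
  shows
    "(\<forall>\<beta>\<in>{0<..1}. f_gar (\<kappa> / sqrt \<beta>) =
        \<kappa> * exp (- \<kappa>\<^sup>2 / (2 * \<beta>)) / sqrt (2 * \<beta> * pi)
        + (\<kappa>\<^sup>2 / \<beta> + 1) * erfc (- \<kappa> / sqrt (2 * \<beta>)) / 2)
     \<and>
     (\<forall>\<beta>\<in>{0<..1}. \<forall>\<xi> :: nat \<Rightarrow> real.
        (\<forall>\<^sub>F n in sequentially.
           box_threshold \<alpha> \<kappa> eps_m eps_n eps_g \<beta> > \<xi> n / sqrt (real n)) \<longrightarrow>
        (\<lambda>n. \<P>(\<omega> in M n. xi_box_at \<kappa> (m n) n (H n \<omega>) \<beta> \<ge> ereal (\<xi> n)))
          \<longlonglongrightarrow> 1)
     \<and>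
     (\<forall>\<xi> :: nat \<Rightarrow> real.
        (\<forall>\<^sub>F n in sequentially.
           (INF \<beta>\<in>{0<..1}. ereal (box_threshold \<alpha> \<kappa> eps_m eps_n eps_g \<beta>))
             > ereal (\<xi> n / sqrt (real n))) \<longrightarrow>
        (\<lambda>n. \<P>(\<omega> in M n. xi_box \<kappa> (m n) n (H n \<omega>) \<ge> ereal (\<xi> n))) \<longlonglongrightarrow> 1 \<and>
        ((\<forall>\<^sub>F n in sequentially. \<xi> n > 0) \<longrightarrow>
          overwhelming (\<lambda>n. \<P>(\<omega> in M n. \<not> box_feasible \<kappa> (m n) n (H n \<omega>)))))"
proof -
  note \<alpha> = assms(1) and \<kappa> = assms(2) and eps = assms(3,4,5) and m = assms(6) and H = assms(7)
  have M: "prob_space (M n)" for n using H by (simp add: std_normal_matrix_def)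
  let ?thr = "box_threshold \<alpha> \<kappa> eps_m eps_n eps_g"
  let ?T = "\<lambda>\<beta>. sqrt (\<alpha> * f_gar (\<kappa> / sqrt \<beta>)) + f_box_hat \<beta>"
  \<comment> \<open>Half of the slack \<open>eps_g\<close> pays for the probabilistic estimates.  The other half makes the level at which they
    are applied positive whenever the threshold exceeds \<open>- \<eta>\<close>.\<close>
  define \<eta> where "\<eta> = eps_g / 2"
  have \<eta>: "\<eta> > 0" using eps by (simp add: \<eta>_def)
  have thr: "?thr \<beta> + \<eta> + \<eta> \<le> ?T \<beta>" if "\<beta> > 0" for \<beta>
    using box_threshold_le[OF \<alpha> eps(1,2) that, of \<kappa> eps_g] by (simp add: \<eta>_def)
  have mpos: "\<forall>\<^sub>F n in sequentially. m n > 0" by (rule eventually_m_pos[OF \<alpha> m])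
  have npos: "\<forall>\<^sub>F n :: nat in sequentially. n > 0" by (rule eventually_gt_at_top)
  have level: "\<forall>\<^sub>F n in sequentially. \<xi> n \<le> sqrt (real n) * t"
    if "\<forall>\<^sub>F n in sequentially. \<xi> n / sqrt (real n) \<le> t" for \<xi> :: "nat \<Rightarrow> real" and t
    using that npos by eventually_elim (simp add: pos_divide_le_eq mult.commute)
  have tends: "(\<lambda>n. measure (M n) {\<omega> \<in> space (M n). P n \<omega>}) \<longlonglongrightarrow> 1"
    if "negligible_seq (\<lambda>n. 1 - measure (M n) {\<omega> \<in> space (M n). P n \<omega>})" for P
    using that prob_space.prob_le_1[OF M] by (rule negligible_seq_tendsto_1)
  have part1: "\<forall>\<beta>\<in>{0<..1}. f_gar (\<kappa> / sqrt \<beta>) =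
        \<kappa> * exp (- \<kappa>\<^sup>2 / (2 * \<beta>)) / sqrt (2 * \<beta> * pi)
        + (\<kappa>\<^sup>2 / \<beta> + 1) * erfc (- \<kappa> / sqrt (2 * \<beta>)) / 2"
    using f_gar_closed_form by auto
  have part2: "(\<lambda>n. \<P>(\<omega> in M n. xi_box_at \<kappa> (m n) n (H n \<omega>) \<beta> \<ge> ereal (\<xi> n))) \<longlonglongrightarrow> 1"
    if \<beta>: "\<beta> \<in> {0<..1}" and \<xi>: "\<forall>\<^sub>F n in sequentially. ?thr \<beta> > \<xi> n / sqrt (real n)" for \<beta> \<xi>
  proof (rule tends)
    have \<beta>0: "\<beta> > 0" using \<beta> by simp
    have sets: "\<forall>\<^sub>F n in sequentially. {\<omega> \<in> space (M n). xi_box_at \<kappa> (m n) n (H n \<omega>) \<beta> \<ge> ereal (\<xi> n)} \<in> sets (M n)"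
      using mpos by eventually_elim (rule sets_xi_box_at_ge[OF H])
    show "negligible_seq (\<lambda>n. 1 - \<P>(\<omega> in M n. xi_box_at \<kappa> (m n) n (H n \<omega>) \<beta> \<ge> ereal (\<xi> n)))"
    proof (cases "?thr \<beta> \<le> - \<eta>")
      case True
      have "\<forall>\<^sub>F n in sequentially. \<xi> n / sqrt (real n) \<le> - \<eta>"
        using \<xi> by eventually_elim (use True in linarith)
      note level[OF this]
      then obtain E where E: "negligible_seq (\<lambda>n. 1 - measure (M n) {\<omega> \<in> space (M n). E n (H n \<omega>)})"
        "\<forall>\<^sub>F n in sequentially. \<forall>A \<beta> x. E n A \<longrightarrow> 0 < \<beta> \<longrightarrow> x \<in> box_sphere \<beta> n \<longrightarrow>
           \<xi> n \<le> nonneg_support (m n) (\<lambda>i. \<kappa> / sqrt \<beta> - mat_vec n A x i)"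
        using negative_level_event[OF \<alpha> \<kappa> m H, of "- \<eta>" \<xi>] \<eta> by auto
      show ?thesis
      proof (rule negligible_seq_event_mono[OF E(1) M _ sets])
        show "\<forall>\<^sub>F n in sequentially. \<forall>\<omega>\<in>space (M n). E n (H n \<omega>) \<longrightarrow> ereal (\<xi> n) \<le> xi_box_at \<kappa> (m n) n (H n \<omega>) \<beta>"
          using E(2) mpos
        proof eventually_elim
          case (elim n)
          then show ?case using \<beta>0 unfolding le_xi_box_at_iff[OF elim(2)] by blast
        qed
      qed
    next
      case False
      let ?r = "\<lambda>n. sqrt (real n) * (?T \<beta> - \<eta>)"
      have T: "?thr \<beta> \<le> ?T \<beta> - \<eta>" "0 < ?T \<beta> - \<eta>" using thr[OF \<beta>0] \<eta> False by linarith+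
      show ?thesis
      proof (rule negligible_seq_event_mono[OF box_sphere_norm_event[OF \<alpha> m H \<beta>0 \<eta>] M _ sets])
        have "\<forall>\<^sub>F n in sequentially. \<xi> n / sqrt (real n) \<le> ?T \<beta> - \<eta>"
          using \<xi> by eventually_elim (use T(1) in linarith)
        from level[OF this] mpos npos
        show "\<forall>\<^sub>F n in sequentially. \<forall>\<omega>\<in>space (M n). norm_event (m n) n (box_sphere \<beta> n) (\<kappa> / sqrt \<beta>) (?r n) (H n \<omega>)
            \<longrightarrow> ereal (\<xi> n) \<le> xi_box_at \<kappa> (m n) n (H n \<omega>) \<beta>"
        proof eventually_elim
          case (elim n)
          have r: "0 < ?r n" using elim(3) T(2) by simp
          show ?case unfolding le_xi_box_at_iff[OF elim(2)]
          proof (intro ballI impI)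
            fix \<omega> x assume "norm_event (m n) n (box_sphere \<beta> n) (\<kappa> / sqrt \<beta>) (?r n) (H n \<omega>)" "x \<in> box_sphere \<beta> n"
            from norm_event_imp_support_ge(2)[OF this(1) r order_refl this(2)] elim(1)
            show "\<xi> n \<le> nonneg_support (m n) (\<lambda>i. \<kappa> / sqrt \<beta> - mat_vec n (H n \<omega>) x i)" by (rule order_trans[rotated])
          qed
        qed
      qed
    qed
  qed
  have part3: "(\<lambda>n. \<P>(\<omega> in M n. xi_box \<kappa> (m n) n (H n \<omega>) \<ge> ereal (\<xi> n))) \<longlonglongrightarrow> 1 \<and>
        ((\<forall>\<^sub>F n in sequentially. \<xi> n > 0) \<longrightarrow>
          overwhelming (\<lambda>n. \<P>(\<omega> in M n. \<not> box_feasible \<kappa> (m n) n (H n \<omega>))))"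
    if \<xi>: "\<forall>\<^sub>F n in sequentially. (INF \<beta>\<in>{0<..1}. ereal (?thr \<beta>)) > ereal (\<xi> n / sqrt (real n))" for \<xi>
  proof -
    let ?I = "INF \<beta>\<in>{0<..1}. ereal (?thr \<beta>)"
    have le: "?I \<le> ereal (?thr \<beta>)" if "\<beta> \<in> {0<..1}" for \<beta> using that by (rule INF_lower)
    obtain k where "?I > ereal (\<xi> k / sqrt (real k))" using eventually_happens'[OF _ \<xi>] by auto
    \<comment> \<open>The infimum is not \<open>-\<infinity>\<close> because it exceeds a real number.\<close>
    then obtain t where t: "?I = ereal t" using le[of 1] by (cases ?I) auto
    have \<xi>': "\<forall>\<^sub>F n in sequentially. \<xi> n / sqrt (real n) < t" using \<xi> unfolding t by simp
    have thr_t: "t \<le> ?thr \<beta>" if "\<beta> \<in> {0<..1}" for \<beta> using le[OF that] unfolding t by simp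
    have sets: "\<forall>\<^sub>F n in sequentially. {\<omega> \<in> space (M n). xi_box \<kappa> (m n) n (H n \<omega>) \<ge> ereal (\<xi> n)} \<in> sets (M n)"
      using mpos by eventually_elim (rule sets_xi_box_ge[OF H])
    show ?thesis
    proof (cases "t \<le> - \<eta>")
      case True
      have "\<forall>\<^sub>F n in sequentially. \<xi> n / sqrt (real n) \<le> - \<eta>"
        using \<xi>' by eventually_elim (use True in linarith)
      note l = level[OF this]
      then obtain E where E: "negligible_seq (\<lambda>n. 1 - measure (M n) {\<omega> \<in> space (M n). E n (H n \<omega>)})"
        "\<forall>\<^sub>F n in sequentially. \<forall>A \<beta> x. E n A \<longrightarrow> 0 < \<beta> \<longrightarrow> x \<in> box_sphere \<beta> n \<longrightarrow>
           \<xi> n \<le> nonneg_support (m n) (\<lambda>i. \<kappa> / sqrt \<beta> - mat_vec n A x i)"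
        using negative_level_event[OF \<alpha> \<kappa> m H, of "- \<eta>" \<xi>] \<eta> by auto
      have N: "negligible_seq (\<lambda>n. 1 - \<P>(\<omega> in M n. xi_box \<kappa> (m n) n (H n \<omega>) \<ge> ereal (\<xi> n)))"
      proof (rule negligible_seq_event_mono[OF E(1) M _ sets])
        show "\<forall>\<^sub>F n in sequentially. \<forall>\<omega>\<in>space (M n). E n (H n \<omega>) \<longrightarrow> ereal (\<xi> n) \<le> xi_box \<kappa> (m n) n (H n \<omega>)"
          using E(2) mpos
        proof eventually_elim
          case (elim n)
          then show ?case unfolding le_xi_box_iff[OF elim(2)] by simp
        qed
      qed
      moreover have "\<not> (\<forall>\<^sub>F n in sequentially. \<xi> n > 0)"
      proof
        assume "\<forall>\<^sub>F n in sequentially. \<xi> n > 0"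
        with l have "\<forall>\<^sub>F n :: nat in sequentially. False"
        proof eventually_elim
          case (elim n)
          have "sqrt (real n) * - \<eta> \<le> 0" using \<eta> by (intro mult_nonneg_nonpos) auto
          then show False using elim by linarith
        qed
        then show False by simp
      qed
      ultimately show ?thesis using tends[OF N] by blast
    next
      case False
      define \<tau> where "\<tau> = t + \<eta>"
      have \<tau>: "\<tau> > 0" using False by (simp add: \<tau>_def)
      have "\<tau> + \<eta> \<le> ?T \<beta>" if "0 < \<beta>" "\<beta> \<le> 1" for \<beta>
        using thr[OF that(1)] thr_t[of \<beta>] that unfolding \<tau>_def by simp
      from uniform_norm_event[OF \<alpha> \<kappa> \<eta> m H this \<tau>]
      obtain E where E: "negligible_seq (\<lambda>n. 1 - measure (M n) {\<omega> \<in> space (M n). E n (H n \<omega>)})"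
        "\<And>n A \<beta> x. n > 0 \<Longrightarrow> E n A \<Longrightarrow> 0 < \<beta> \<Longrightarrow> \<beta> \<le> 1 \<Longrightarrow> x \<in> box_sphere \<beta> n \<Longrightarrow>
           sqrt (real n) * \<tau> \<le> pos_part_norm (m n) (\<kappa> / sqrt \<beta>) (mat_vec n A x) \<and>
           sqrt (real n) * \<tau> \<le> nonneg_support (m n) (\<lambda>i. \<kappa> / sqrt \<beta> - mat_vec n A x i)" by blast
      have N: "negligible_seq (\<lambda>n. 1 - \<P>(\<omega> in M n. xi_box \<kappa> (m n) n (H n \<omega>) \<ge> ereal (\<xi> n)))"
      proof (rule negligible_seq_event_mono[OF E(1) M _ sets])
        have "\<forall>\<^sub>F n in sequentially. \<xi> n / sqrt (real n) \<le> \<tau>"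
          using \<xi>' by eventually_elim (use \<eta> in \<open>simp add: \<tau>_def\<close>)
        from level[OF this] mpos npos
        show "\<forall>\<^sub>F n in sequentially. \<forall>\<omega>\<in>space (M n). E n (H n \<omega>) \<longrightarrow> ereal (\<xi> n) \<le> xi_box \<kappa> (m n) n (H n \<omega>)"
        proof eventually_elim
          case (elim n)
          show ?case unfolding le_xi_box_iff[OF elim(2)]
            using E(2)[OF elim(3)] elim(1) by (auto intro: order_trans)
        qed
      qed
      moreover have "negligible_seq (\<lambda>n. 1 - \<P>(\<omega> in M n. \<not> box_feasible \<kappa> (m n) n (H n \<omega>)))"
      proof (rule negligible_seq_event_mono[OF E(1) M])
        show "\<forall>\<^sub>F n in sequentially. \<forall>\<omega>\<in>space (M n). E n (H n \<omega>) \<longrightarrow> \<not> box_feasible \<kappa> (m n) n (H n \<omega>)"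
          using mpos npos
        proof eventually_elim
          case (elim n)
          have "0 < sqrt (real n) * \<tau>" using elim(2) \<tau> by simp
          then have "0 < pos_part_norm (m n) (\<kappa> / sqrt \<beta>) (mat_vec n A x)"
            if "E n A" "0 < \<beta>" "\<beta> \<le> 1" "x \<in> box_sphere \<beta> n" for A \<beta> x
            using E(2)[OF elim(2) that] by linarith
          then show ?case using infeasible_if_pos_part_norm_pos[OF elim \<kappa>] by blast
        qed
        show "\<forall>\<^sub>F n in sequentially. {\<omega> \<in> space (M n). \<not> box_feasible \<kappa> (m n) n (H n \<omega>)} \<in> sets (M n)"
          by (intro always_eventually allI sets_infeasible[OF H])
      qed
      ultimately show ?thesis using tends[OF N] unfolding overwhelming_iff by blast
    qed
  qed
  show ?thesis using part1 part2 part3 by blast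
qed

end
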